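(* Let $H_1$ be the complex reflection group of order $96$ (Shephard–Todd group No. 8), and let $K_1,K_3,K_4,K_8,K_9$ be representatives of the five conjugacy classes of subgroups $K\le H_1$ for which the transitive permutation representation of $H_1$ on $K\backslash H_1$ is faithful, with $|K_1|=1$, $|K_3|=2$, $|K_4|=3$, $|K_8|=|K_9|=4$. For $i\in\{1,3,4,8,9\}$ let $\theta_i$ be the permutation character of $H_1$ on $K_i\backslash H_1$ (so the degrees are $96,48,32,24,24$ respectively), and for an integer $k\ge 1$ let $\mathfrak{A}_{\theta_i}^{(k)}$ be the centralizer ring of the $k$-th tensor power of this permutation representation. Then for every $k\ge 1$ the following isomorphisms of $\mathbb{C}$-algebras hold. (1) $\mathfrak{A}_{\theta_1}^{(k)}\cong 4M_{a_k}\oplus 6M_{e_k}\oplus 4M_{l_k}\oplus 2M_{p_k}$, where $a_k=96^{k-1}$, $e_k=\frac{96^k}{48}$, $l_k=\frac{96^k}{32}$, $p_k=\frac{96^k}{24}$. (2) $\mathfrak{A}_{\theta_3}^{(k)}\cong 2M_{a_k}\oplus 2M_{c_k}\oplus M_{e_k}\oplus M_{f_k}\oplus 4M_{g_k}\oplus 2M_{l_k}\oplus 2M_{n_k}\oplus 2M_{p_k}$, where $a_k=\frac{48^{k-1}}{2}+\frac{8^{k-1}}{2}$, $c_k=\frac{48^{k-1}}{2}-\frac{8^{k-1}}{2}$, $e_k=48^{k-1}+8^{k-1}$, $f_k=48^{k-1}-8^{k-1}$, $g_k=48^{k-1}$, $l_k=\frac{48^k}{32}-\frac{8^{k-1}}{2}$,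 $n_k=\frac{48^k}{32}+\frac{8^{k-1}}{2}$, $p_k=\frac{48^k}{24}$. (3) $\mathfrak{A}_{\theta_4}^{(k)}\cong 4M_{a_k}\oplus 6M_{e_k}\oplus 4M_{l_k}\oplus 2M_{p_k}$, where $a_k=\frac{32^{k-1}}{3}+\frac{8^k}{12}$, $e_k=\frac{32^k}{48}-\frac{8^k}{12}$, $l_k=32^{k-1}$, $p_k=\frac{32^k}{24}+\frac{8^k}{12}$. (4) For each $i\in\{8,9\}$, $\mathfrak{A}_{\theta_i}^{(k)}\cong M_{a_k}\oplus 3M_{b_k}\oplus M_{e_k}\oplus 3M_{f_k}\oplus 2M_{e_k}\oplus M_{l_k}\oplus 3M_{m_k}\oplus 2M_{p_k}$, where $a_k=\frac{24^{k-1}}{4}+3\cdot 4^{k-2}$, $b_k=\frac{24^{k-1}}{4}-4^{k-2}$, $e_k=\frac{24^{k-1}}{2}+\frac{4^{k-1}}{2}$, $f_k=\frac{24^{k-1}}{2}-\frac{4^{k-1}}{2}$, $l_k=\frac{24^k}{32}-3\cdot 4^{k-2}$, $m_k=\frac{24^k}{32}+4^{k-2}$, $p_k=24^{k-1}$.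
   Context: The group $H_1$ is the primitive complex reflection group of order $96$, No. 8 in the Shephard–Todd list; concretely, $H_1=\langle T,D\rangle\le GL(2,\mathbb{C})$ with $T=\frac{1+i}{2}\begin{pmatrix}1&1\\1&-1\end{pmatrix}$ and $D=\begin{pmatrix}1&0\\0&i\end{pmatrix}$, where $i=\sqrt{-1}$. For a subgroup $K\le H_1$, the permutation representation of $H_1$ with respect to $K$ is the action of $H_1$ by right multiplication on the set of right cosets $K\backslash H_1$, $Kg\mapsto Kga$, regarded as a complex matrix representation by permutation matrices of degree $|H_1|/|K|$. It is faithful if the homomorphism $H_1\to \mathrm{Sym}(K\backslash H_1)$ is injective. Two such representations are equivalent if and only if the subgroups are conjugate. $H_1$ has $24$ conjugacy classes of subgroups, of which exactly five give faithful representations; these have orders $1,2,3,4,4$, and the two of order $4$ are not conjugate to each other. If $V$ is the $\mathbb{C}$-space of a representation of $H_1$, the centralizer ring of its $k$-th tensor power is $\mathrm{End}_{H_1}(V^{\otimes k})$, the algebra of all $\mathbb{C}$-linear endomorphisms of $V^{\otimes k}$ commuting with the diagonal action of $H_1$. $M_d$ denotes the full matrix algebra of degree $d$ over $\mathbb{C}$ (with $M_0=0$), and $nM_d$ denotes the direct sum of $n$ copies of $M_d$. *)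

theory Defs
  imports
    "HOL-Algebra.QuotRing"
    "HOL-Algebra.Elementary_Groups"
    "Jordan_Normal_Form.Matrix"
begin

section \<open>The group\<close>

definition GL2 :: "complex mat monoid" where
  "GL2 = units_of (ring_mat TYPE(complex) 2 ())"

definition T_mat :: "complex mat" where
  "T_mat = ((1 + \<i>) / 2) \<cdot>\<^sub>m mat_of_rows_list 2 [[1, 1], [1, -1]]"

definition D_mat :: "complex mat" where
  "D_mat = mat_of_rows_list 2 [[1, 0], [0, \<i>]]"

definition H1 :: "complex mat monoid" where
  "H1 = subgroup_generated GL2 {T_mat, D_mat}"

lemma mat2_eqI:
  fixes A B :: "complex mat"
  assumes "A \<in> carrier_mat 2 2" "B \<in> carrier_mat 2 2"
    and "A $$ (0,0) = B $$ (0,0)" "A $$ (0,1) = B $$ (0,1)"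
    and "A $$ (1,0) = B $$ (1,0)" "A $$ (1,1) = B $$ (1,1)"
  shows "A = B"
proof (rule eq_matI)
  fix i j assume "i < dim_row B" "j < dim_col B"
  hence "(i = 0 \<or> i = 1) \<and> (j = 0 \<or> j = 1)" using assms(2) by auto
  thus "A $$ (i, j) = B $$ (i, j)" using assms by blast
qed (use assms in auto)

text \<open>The operator \<^const>\<open>subgroup_generated\<close> discards generators outside the carrier; nothing is
  discarded in \<^const>\<open>H1\<close>.\<close>

lemma T_mat_D_mat_in_GL2: "T_mat \<in> carrier GL2" "D_mat \<in> carrier GL2"
proof -
  define T' :: "complex mat" where
    "T' = ((1 - \<i>) / 2) \<cdot>\<^sub>m mat_of_rows_list 2 [[1, 1], [1, -1]]"
  define D' :: "complex mat" where "D' = mat_of_rows_list 2 [[1, 0], [0, -\<i>]]"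
  note defs = T_mat_def T'_def D_mat_def D'_def mat_of_rows_list_def
  have c: "T_mat \<in> carrier_mat 2 2" "T' \<in> carrier_mat 2 2"
    "D_mat \<in> carrier_mat 2 2" "D' \<in> carrier_mat 2 2"
    unfolding defs by auto
  have "T_mat * T' = 1\<^sub>m 2" "T' * T_mat = 1\<^sub>m 2" "D_mat * D' = 1\<^sub>m 2" "D' * D_mat = 1\<^sub>m 2"
    using c
    by (auto intro!: mat2_eqI simp: defs scalar_prod_def numeral_2_eq_2 field_simps)
  thus "T_mat \<in> carrier GL2" "D_mat \<in> carrier GL2"
    unfolding GL2_def units_of_def Units_def using c by (auto simp: ring_mat_simps)
qed

lemma group_H1: "group H1"
  unfolding H1_def GL2_def
  by (intro group.group_subgroup_generated monoid.units_group ring.is_monoid ring_mat)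

section \<open>Permutation representations on right cosets\<close>

definition faithful_on_cosets :: "('g, 'r) monoid_scheme \<Rightarrow> 'g set \<Rightarrow> bool" where
  "faithful_on_cosets G K \<longleftrightarrow>
     inj_on (\<lambda>a. \<lambda>C \<in> rcosets\<^bsub>G\<^esub> K. C #>\<^bsub>G\<^esub> a) (carrier G)"

definition conjugate_subgroups :: "('g, 'r) monoid_scheme \<Rightarrow> 'g set \<Rightarrow> 'g set \<Rightarrow> bool" where
  "conjugate_subgroups G K L \<longleftrightarrow> (\<exists>g \<in> carrier G. L = (\<lambda>x. inv\<^bsub>G\<^esub> g \<otimes>\<^bsub>G\<^esub> x \<otimes>\<^bsub>G\<^esub> g) ` K)"

text \<open>Matrices over a finite index set are functions of two indices. With the convention below,
  row \<open>C\<close> of the permutation matrix of \<open>a\<close> has its entry \<open>1\<close> in column \<open>C a\<close>, so that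
  \<open>a \<mapsto> coset_perm_mat G a\<close> turns products into products of matrices.\<close>

definition coset_perm_mat :: "('g, 'r) monoid_scheme \<Rightarrow> 'g \<Rightarrow> 'g set \<Rightarrow> 'g set \<Rightarrow> complex" where
  "coset_perm_mat G a C C' = (if C' = C #>\<^bsub>G\<^esub> a then 1 else 0)"

section \<open>Tensor powers and centralizer rings\<close>

text \<open>For \<open>V = \<complex>\<^bsup>X\<^esup>\<close> with \<open>X\<close> finite, the \<open>k\<close>-th tensor power of \<open>V\<close> is the space of functions on
  \<open>X\<^bsup>k\<^esup>\<close>, the pure tensor \<open>v\<^sub>0 \<otimes> \<dots> \<otimes> v\<^bsub>k-1\<^esub>\<close> being \<open>s \<mapsto> v\<^sub>0 (s\<^sub>0) \<cdots> v\<^bsub>k-1\<^esub> (s\<^bsub>k-1\<^esub>)\<close>.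
  Elements of \<open>X\<^bsup>k\<^esup>\<close> are lists of length \<open>k\<close>.\<close>

definition tuples :: "'x set \<Rightarrow> nat \<Rightarrow> 'x list set" where
  "tuples X k = {s. set s \<subseteq> X \<and> length s = k}"

definition tensor_space :: "'x set \<Rightarrow> nat \<Rightarrow> ('x list \<Rightarrow> complex) set" where
  "tensor_space X k = {v. \<forall>s. s \<notin> tuples X k \<longrightarrow> v s = 0}"

definition pure_tensor :: "'x set \<Rightarrow> nat \<Rightarrow> (nat \<Rightarrow> 'x \<Rightarrow> complex) \<Rightarrow> 'x list \<Rightarrow> complex" where
  "pure_tensor X k v = (\<lambda>s. if s \<in> tuples X k then \<Prod>j<k. v j (s ! j) else 0)"

text \<open>The \<open>k\<close>-th tensor power of the endomorphism with matrix \<open>P\<close>, given by the \<open>k\<close>-th Kronecker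
  power of \<open>P\<close>.\<close>

definition tensor_power_map ::
    "'x set \<Rightarrow> nat \<Rightarrow> ('x \<Rightarrow> 'x \<Rightarrow> complex) \<Rightarrow> ('x list \<Rightarrow> complex) \<Rightarrow> 'x list \<Rightarrow> complex" where
  "tensor_power_map X k P v =
     (\<lambda>s. if s \<in> tuples X k
          then \<Sum>t \<in> tuples X k. (\<Prod>j<k. P (s ! j) (t ! j)) * v t else 0)"

lemma sum_tuples_prod:
  fixes f :: "nat \<Rightarrow> 'x \<Rightarrow> complex"
  assumes "finite X"
  shows "(\<Sum>t \<in> tuples X k. \<Prod>j<k. f j (t ! j)) = (\<Prod>j<k. \<Sum>y \<in> X. f j y)"
proof (induction k arbitrary: f)
  case 0
  have "tuples X 0 = {[]}" by (auto simp: tuples_def)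
  thus ?case by simp
next
  case (Suc k)
  have eq: "tuples X (Suc k) = (\<lambda>(y, t). y # t) ` (X \<times> tuples X k)"
    by (auto simp: tuples_def length_Suc_conv image_iff)
  have inj: "inj_on (\<lambda>(y, t). y # t) (X \<times> tuples X k)" by (auto simp: inj_on_def)
  have "(\<Sum>t \<in> tuples X (Suc k). \<Prod>j<Suc k. f j (t ! j))
      = (\<Sum>(y, t) \<in> X \<times> tuples X k. f 0 y * (\<Prod>j<k. f (Suc j) (t ! j)))"
    unfolding eq by (subst sum.reindex[OF inj], rule sum.cong)
      (auto simp: prod.lessThan_Suc_shift simp del: prod.lessThan_Suc)
  also have "\<dots> = (\<Sum>y \<in> X. f 0 y) * (\<Sum>t \<in> tuples X k. \<Prod>j<k. f (Suc j) (t ! j))"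
    by (simp add: sum_product sum.cartesian_product)
  also have "\<dots> = (\<Prod>j<Suc k. \<Sum>y \<in> X. f j y)"
    by (simp only: Suc.IH[of "\<lambda>j. f (Suc j)"] prod.lessThan_Suc_shift)
  finally show ?case .
qed

lemma tensor_power_map_pure_tensor:
  assumes "finite X"
  shows "tensor_power_map X k P (pure_tensor X k v) =
         pure_tensor X k (\<lambda>j x. \<Sum>y \<in> X. P x y * v j y)"
proof
  fix s
  have "(\<Sum>t \<in> tuples X k. (\<Prod>j<k. P (s ! j) (t ! j)) * pure_tensor X k v t)
      = (\<Sum>t \<in> tuples X k. \<Prod>j<k. P (s ! j) (t ! j) * v j (t ! j))"
    by (rule sum.cong) (auto simp: pure_tensor_def prod.distrib)
  also have "\<dots> = (\<Prod>j<k. \<Sum>y \<in> X. P (s ! j) y * v j y)"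
    by (rule sum_tuples_prod[OF assms])
  finally show "tensor_power_map X k P (pure_tensor X k v) s =
         pure_tensor X k (\<lambda>j x. \<Sum>y \<in> X. P x y * v j y) s"
    by (simp add: tensor_power_map_def pure_tensor_def)
qed

definition linear_endos :: "'x set \<Rightarrow> nat \<Rightarrow> (('x list \<Rightarrow> complex) \<Rightarrow> 'x list \<Rightarrow> complex) set" where
  "linear_endos X k = {F \<in> tensor_space X k \<rightarrow>\<^sub>E tensor_space X k.
     (\<forall>u \<in> tensor_space X k. \<forall>v \<in> tensor_space X k. F (\<lambda>s. u s + v s) = (\<lambda>s. F u s + F v s)) \<and>
     (\<forall>c. \<forall>v \<in> tensor_space X k. F (\<lambda>s. c * v s) = (\<lambda>s. c * F v s))}"

text \<open>Algebras over \<open>\<complex>\<close> are records of type \<^typ>\<open>(complex, 'a) module\<close>: a ring with a scalar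
  multiplication.\<close>

definition centralizer_ring ::
    "('g, 'r) monoid_scheme \<Rightarrow> 'g set \<Rightarrow> nat
      \<Rightarrow> (complex, ('g set list \<Rightarrow> complex) \<Rightarrow> 'g set list \<Rightarrow> complex) module" where
  "centralizer_ring G K k =
    (let X = rcosets\<^bsub>G\<^esub> K; V = tensor_space X k in
     \<lparr> carrier = {F \<in> linear_endos X k. \<forall>a \<in> carrier G. \<forall>v \<in> V.
          F (tensor_power_map X k (coset_perm_mat G a) v)
          = tensor_power_map X k (coset_perm_mat G a) (F v)},
       monoid.mult = (\<lambda>E F. \<lambda>v \<in> V. E (F v)),
       one = (\<lambda>v \<in> V. v),
       zero = (\<lambda>v \<in> V. \<lambda>s. 0),
       add = (\<lambda>E F. \<lambda>v \<in> V. \<lambda>s. E v s + F v s),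
       smult = (\<lambda>c F. \<lambda>v \<in> V. \<lambda>s. c * F v s) \<rparr>)"

section \<open>Direct sums of matrix algebras\<close>

definition alg_direct_sum :: "('r, 'a) module list \<Rightarrow> ('r, 'a list) module" where
  "alg_direct_sum As =
     \<lparr> carrier = {xs. list_all2 (\<lambda>x A. x \<in> carrier A) xs As},
       monoid.mult = (\<lambda>xs ys. map (\<lambda>(A, x, y). x \<otimes>\<^bsub>A\<^esub> y) (zip As (zip xs ys))),
       one = map (\<lambda>A. \<one>\<^bsub>A\<^esub>) As,
       zero = map (\<lambda>A. \<zero>\<^bsub>A\<^esub>) As,
       add = (\<lambda>xs ys. map (\<lambda>(A, x, y). x \<oplus>\<^bsub>A\<^esub> y) (zip As (zip xs ys))),
       smult = (\<lambda>c xs. map (\<lambda>(A, x). c \<odot>\<^bsub>A\<^esub> x) (zip As xs)) \<rparr>"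

text \<open>\<open>mat_alg_sum ds\<close> is the direct sum of the full matrix algebras whose degrees are listed in \<open>ds\<close>;
  in degree \<open>0\<close> the carrier is a singleton, so \<open>M\<^sub>0 = 0\<close>. The sum of \<open>n\<close> copies of \<open>M\<^sub>d\<close> is the
  segment \<open>replicate n d\<close>.\<close>

definition mat_alg_sum :: "nat list \<Rightarrow> (complex, complex mat list) module" where
  "mat_alg_sum ds = alg_direct_sum (map (\<lambda>d. module_mat TYPE(complex) d d) ds)"

definition alg_iso :: "('r, 'a) module \<Rightarrow> ('r, 'b) module \<Rightarrow> bool"  (infix \<open>\<cong>\<^sub>A\<close> 50) where
  "A \<cong>\<^sub>A B \<longleftrightarrow> (\<exists>h \<in> ring_iso A B. \<forall>c. \<forall>x \<in> carrier A. h (c \<odot>\<^bsub>A\<^esub> x) = c \<odot>\<^bsub>B\<^esub> h x)"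

end

theory Submission
  imports Defs "HOL-Algebra.Multiplicative_Group"
begin

text \<open>For a finite group \<open>G\<close> with irreducible representations \<open>\<rho>\<^sub>p\<close>, the matrix units of the group algebra
  act on any permutation module \<open>V\<close> by operators \<open>E\<^sub>p\<^sub>i\<^sub>j\<close>, and an endomorphism commuting with \<open>G\<close> is
  determined by its restrictions to the spaces \<open>E\<^sub>p\<^sub>0\<^sub>0 V\<close>, which are arbitrary. So the centralizer ring is
  the sum of the matrix algebras of degree \<open>dim E\<^sub>p\<^sub>0\<^sub>0 V = tr E\<^sub>p\<^sub>0\<^sub>0\<close>, the multiplicity of \<open>\<rho>\<^sub>p\<close> in \<open>V\<close>. Schur
  orthogonality is obtained from the orthogonality of characters because the averaging operator
  \<open>X \<mapsto> |G|\<^sup>-\<^sup>1 \<Sum>\<^sub>g \<rho>(g) X \<sigma>(g\<^sup>-\<^sup>1)\<close> is idempotent, so that its trace is its rank.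

  The 16 irreducible representations of \<open>H1\<close> are polynomial in the matrix entries, and the conjugacy
  classes are told apart by trace and determinant. By column orthogonality the permutation
  character on the cosets of \<open>K\<close> depends only on the traces and determinants of the elements of \<open>K\<close>,
  and these follow from the order of \<open>K\<close> once faithfulness excludes \<open>-1\<close> from \<open>K\<close>.\<close>

section \<open>Idempotent matrices\<close>

text \<open>Irreducibility and completeness enter only as numerical identities between characters:
  norm one, pairwise orthogonality, and the regular character as \<Sum> d_p \<chi>_p. Each is a sum
  over sixteen table rows. Likewise the classes are never exhibited as orbits; the computations use
  only the multiset of invariants of the 96 elements.

  The shape of the degrees has one source. Off the identity the permutation character has a single
  nonzero value m (8, 8 and 4 for orders 2, 3 and 4), taken on the classes that meet K. So its k-th
  power contains \<rho>_p with multiplicity (d_p n^k + B_p m^k) / 96, where n = 96 / |K| and B_p is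
  the sum of the conjugate of \<chi>_p over those classes.

  For order four the invariants of K are fixed only up to a sign in the trace of a generator. The
  two signs permute the multiplicities among the representations of equal degree, so the list of
  degrees is the same up to order.\<close>

lemma idempotent_factorization:
  fixes P :: "'y \<Rightarrow> 'y \<Rightarrow> 'a::field"
  assumes "finite Y"
    and "\<And>x z. x \<in> Y \<Longrightarrow> z \<in> Y \<Longrightarrow> (\<Sum>y\<in>Y. P x y * P y z) = P x z"
  shows "\<exists>(r::nat) a b. (\<forall>x\<in>Y. \<forall>y\<in>Y. P x y = (\<Sum>s<r. a s x * b s y)) \<and>
           (\<forall>s<r. \<forall>t<r. (\<Sum>y\<in>Y. b s y * a t y) = (if s = t then 1 else 0))"
  using assms(2)
proof (induction "card {x\<in>Y. \<exists>y\<in>Y. P x y \<noteq> 0}" arbitrary: P rule: less_induct)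
  case less
  note idem = less.prems
  show ?case
  proof (cases "\<exists>i\<in>Y. \<exists>j\<in>Y. P i j \<noteq> 0")
    case False
    thus ?thesis by (intro exI[of _ 0]) auto
  next
    case True
    then obtain i j where ij: "i \<in> Y" "j \<in> Y" "P i j \<noteq> 0" by blast
    \<comment> \<open>Rank one deflation: \<open>u\<close> is a column and \<open>w\<close> a row
      through a nonzero entry, scaled so that w u = 1. Removing the product u w leaves an idempotent
      \<open>Q\<close> with Q u = 0 and w Q = 0, and row \<open>i\<close> of \<open>Q\<close>
      vanishes. This is why the induction counts nonzero rows.\<close>
    define u where "u x = P x j / P i j" for x
    define w where "w = P i"
    define Q where "Q x y = P x y - u x * w y" for x y
    have Pu: "(\<Sum>y\<in>Y. P x y * u y) = u x" if "x \<in> Y" for x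
      using idem[OF that ij(2)] by (simp add: u_def sum_divide_distrib[symmetric])
    have wP: "(\<Sum>x\<in>Y. w x * P x y) = w y" if "y \<in> Y" for y
      using idem[OF ij(1) that] by (simp add: w_def)
    have wu: "(\<Sum>x\<in>Y. w x * u x) = 1"
      using Pu[OF ij(1)] ij(3) by (simp add: w_def u_def)
    have Qu: "(\<Sum>y\<in>Y. Q x y * u y) = 0" if "x \<in> Y" for x
    proof -
      have "(\<Sum>y\<in>Y. Q x y * u y) = (\<Sum>y\<in>Y. P x y * u y) - u x * (\<Sum>y\<in>Y. w y * u y)"
        by (simp add: Q_def algebra_simps sum_subtractf sum_distrib_left)
      thus ?thesis using Pu[OF that] wu by simp
    qed
    have wQ: "(\<Sum>x\<in>Y. w x * Q x y) = 0" if "y \<in> Y" for y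
    proof -
      have "(\<Sum>x\<in>Y. w x * Q x y) = (\<Sum>x\<in>Y. w x * P x y) - (\<Sum>x\<in>Y. w x * u x) * w y"
        by (simp add: Q_def algebra_simps sum_subtractf sum_distrib_left sum_distrib_right)
      thus ?thesis using wP[OF that] wu by simp
    qed
    have Qidem: "(\<Sum>y\<in>Y. Q x y * Q y z) = Q x z" if "x \<in> Y" "z \<in> Y" for x z
    proof -
      have "(\<Sum>y\<in>Y. Q x y * Q y z) = (\<Sum>y\<in>Y. Q x y * P y z) - (\<Sum>y\<in>Y. Q x y * u y) * w z"
        by (simp add: Q_def[of _ z] algebra_simps sum_subtractf sum_distrib_left sum_distrib_right)
      also have "\<dots> = (\<Sum>y\<in>Y. P x y * P y z) - u x * (\<Sum>y\<in>Y. w y * P y z)"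
        using Qu[OF that(1)]
        by (simp add: Q_def algebra_simps sum_subtractf sum_distrib_left sum_distrib_right)
      finally show ?thesis using idem[OF that] wP[OF that(2)] by (simp add: Q_def)
    qed
    have "{x\<in>Y. \<exists>y\<in>Y. Q x y \<noteq> 0} \<subset> {x\<in>Y. \<exists>y\<in>Y. P x y \<noteq> 0}"
    proof
      show "{x\<in>Y. \<exists>y\<in>Y. Q x y \<noteq> 0} \<subseteq> {x\<in>Y. \<exists>y\<in>Y. P x y \<noteq> 0}"
      proof clarify
        fix x y assume "x \<in> Y" "y \<in> Y" "Q x y \<noteq> 0"
        thus "\<exists>y\<in>Y. P x y \<noteq> 0" using ij(2) by (cases "P x y = 0") (auto simp: Q_def u_def)
      qed
      have "Q i y = 0" for y using ij by (simp add: Q_def u_def w_def)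
      thus "{x\<in>Y. \<exists>y\<in>Y. Q x y \<noteq> 0} \<noteq> {x\<in>Y. \<exists>y\<in>Y. P x y \<noteq> 0}" using ij by auto
    qed
    hence "card {x\<in>Y. \<exists>y\<in>Y. Q x y \<noteq> 0} < card {x\<in>Y. \<exists>y\<in>Y. P x y \<noteq> 0}"
      using assms(1) by (intro psubset_card_mono) auto
    from less.hyps[OF this Qidem] obtain r :: nat and a b
      where "\<forall>x\<in>Y. \<forall>y\<in>Y. Q x y = (\<Sum>s<r. a s x * b s y)"
        and ba: "\<forall>s<r. \<forall>t<r. (\<Sum>y\<in>Y. b s y * a t y) = (if s = t then 1 else 0)"
      by blast
    hence ab: "\<And>x y. x \<in> Y \<Longrightarrow> y \<in> Y \<Longrightarrow> Q x y = (\<Sum>s<r. a s x * b s y)" by blast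
    \<comment> \<open>The functionals satisfy b Q = b and the vectors Q a = a, so Q u = 0 and w Q =
      0 make the old pairs orthogonal to the new pair.\<close>
    have bQ: "(\<Sum>x\<in>Y. b s x * Q x y) = b s y" if "s < r" "y \<in> Y" for s y
    proof -
      have "(\<Sum>x\<in>Y. b s x * Q x y) = (\<Sum>x\<in>Y. \<Sum>t<r. b s x * a t x * b t y)"
        using that by (intro sum.cong refl) (simp add: ab sum_distrib_left mult.assoc)
      also have "\<dots> = (\<Sum>t<r. (\<Sum>x\<in>Y. b s x * a t x) * b t y)"
        by (subst sum.swap) (simp add: sum_distrib_right)
      also have "\<dots> = (\<Sum>t<r. if t = s then b t y else 0)"
        using that by (intro sum.cong refl) (auto simp: ba)
      finally show ?thesis using that by (simp add: sum.delta)
    qed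
    have Qa: "(\<Sum>y\<in>Y. Q x y * a s y) = a s x" if "s < r" "x \<in> Y" for s x
    proof -
      have "(\<Sum>y\<in>Y. Q x y * a s y) = (\<Sum>y\<in>Y. \<Sum>t<r. a t x * (b t y * a s y))"
        using that by (intro sum.cong refl) (simp add: ab sum_distrib_right mult.assoc)
      also have "\<dots> = (\<Sum>t<r. a t x * (\<Sum>y\<in>Y. b t y * a s y))"
        by (subst sum.swap) (simp add: sum_distrib_left)
      also have "\<dots> = (\<Sum>t<r. if t = s then a t x else 0)"
        using that by (intro sum.cong refl) (auto simp: ba)
      finally show ?thesis using that by (simp add: sum.delta)
    qed
    have bu: "(\<Sum>y\<in>Y. b s y * u y) = 0" if "s < r" for s
    proof -
      have "(\<Sum>y\<in>Y. b s y * u y) = (\<Sum>y\<in>Y. (\<Sum>x\<in>Y. b s x * Q x y) * u y)"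
        using that by (intro sum.cong refl) (simp add: bQ)
      also have "\<dots> = (\<Sum>y\<in>Y. \<Sum>x\<in>Y. b s x * (Q x y * u y))"
        by (simp add: sum_distrib_right mult.assoc)
      also have "\<dots> = (\<Sum>x\<in>Y. b s x * (\<Sum>y\<in>Y. Q x y * u y))"
        by (subst sum.swap) (simp add: sum_distrib_left)
      finally show ?thesis by (simp add: Qu)
    qed
    have wa: "(\<Sum>x\<in>Y. w x * a s x) = 0" if "s < r" for s
    proof -
      have "(\<Sum>x\<in>Y. w x * a s x) = (\<Sum>x\<in>Y. w x * (\<Sum>y\<in>Y. Q x y * a s y))"
        using that by (intro sum.cong refl) (simp add: Qa)
      also have "\<dots> = (\<Sum>x\<in>Y. \<Sum>y\<in>Y. w x * Q x y * a s y)"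
        by (simp add: sum_distrib_left mult.assoc)
      also have "\<dots> = (\<Sum>y\<in>Y. (\<Sum>x\<in>Y. w x * Q x y) * a s y)"
        by (subst sum.swap) (simp add: sum_distrib_right)
      finally show ?thesis by (simp add: wQ)
    qed
    \<comment> \<open>The pair (u, w) takes the free index \<open>r\<close>.\<close>
    define a' where "a' s = (if s < r then a s else u)" for s
    define b' where "b' s = (if s < r then b s else w)" for s
    have "P x y = (\<Sum>s<Suc r. a' s x * b' s y)" if "x \<in> Y" "y \<in> Y" for x y
    proof -
      have "P x y = Q x y + u x * w y" by (simp add: Q_def)
      thus ?thesis using ab[OF that] by (simp add: a'_def b'_def)
    qed
    moreover have "(\<Sum>y\<in>Y. b' s y * a' t y) = (if s = t then 1 else 0)"
      if "s < Suc r" "t < Suc r" for s t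
      using that ba bu[of s] wa[of t] wu by (auto simp: a'_def b'_def less_Suc_eq)
    ultimately show ?thesis by blast
  qed
qed

text \<open>With P = A B and B A the identity of size r, the equality tr(A B) = tr(B A) reads r off
  the diagonal of P.\<close>

lemma idempotent_factorization_trace:
  fixes P :: "'y \<Rightarrow> 'y \<Rightarrow> 'a::field"
  assumes "finite Y"
    and "\<And>x z. x \<in> Y \<Longrightarrow> z \<in> Y \<Longrightarrow> (\<Sum>y\<in>Y. P x y * P y z) = P x z"
  obtains r :: nat and a b
  where "\<And>x y. x \<in> Y \<Longrightarrow> y \<in> Y \<Longrightarrow> P x y = (\<Sum>s<r. a s x * b s y)"
    and "\<And>s t. s < r \<Longrightarrow> t < r \<Longrightarrow> (\<Sum>y\<in>Y. b s y * a t y) = (if s = t then 1 else 0)"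
    and "of_nat r = (\<Sum>x\<in>Y. P x x)"
proof -
  from idempotent_factorization[OF assms] obtain r :: nat and a b
    where "\<forall>x\<in>Y. \<forall>y\<in>Y. P x y = (\<Sum>s<r. a s x * b s y)"
      and "\<forall>s<r. \<forall>t<r. (\<Sum>y\<in>Y. b s y * a t y) = (if s = t then 1 else 0)"
    by blast
  hence ab: "\<And>x y. x \<in> Y \<Longrightarrow> y \<in> Y \<Longrightarrow> P x y = (\<Sum>s<r. a s x * b s y)"
    and ba: "\<And>s t. s < r \<Longrightarrow> t < r \<Longrightarrow> (\<Sum>y\<in>Y. b s y * a t y) = (if s = t then 1 else 0)"
    by blast+
  have "(\<Sum>x\<in>Y. P x x) = (\<Sum>s<r. \<Sum>x\<in>Y. b s x * a s x)"
    by (subst sum.swap) (simp add: ab mult.commute)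
  also have "\<dots> = of_nat r" by (simp add: ba)
  finally show thesis using that[OF ab ba] by simp
qed

section \<open>Matrix representations and Schur orthogonality\<close>

text \<open>Entries with an index at or beyond \<open>d\<close> are unconstrained, so that one
  formula may serve several degrees; the index bounds are carried by the lemmas instead.\<close>

definition matrix_rep :: "('g, 'r) monoid_scheme \<Rightarrow> nat \<Rightarrow> ('g \<Rightarrow> nat \<Rightarrow> nat \<Rightarrow> complex) \<Rightarrow> bool" where
  "matrix_rep G d \<rho> \<longleftrightarrow>
     (\<forall>i<d. \<forall>j<d. \<rho> \<one>\<^bsub>G\<^esub> i j = (if i = j then 1 else 0)) \<and>
     (\<forall>g\<in>carrier G. \<forall>h\<in>carrier G. \<forall>i<d. \<forall>j<d.
        \<rho> (g \<otimes>\<^bsub>G\<^esub> h) i j = (\<Sum>l<d. \<rho> g i l * \<rho> h l j))"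

definition mat_character :: "nat \<Rightarrow> ('g \<Rightarrow> nat \<Rightarrow> nat \<Rightarrow> complex) \<Rightarrow> 'g \<Rightarrow> complex" where
  "mat_character d \<rho> g = (\<Sum>i<d. \<rho> g i i)"

lemma matrix_rep_one:
  "matrix_rep G d \<rho> \<Longrightarrow> i < d \<Longrightarrow> j < d \<Longrightarrow> \<rho> \<one>\<^bsub>G\<^esub> i j = (if i = j then 1 else 0)"
  by (simp add: matrix_rep_def)

lemma matrix_rep_mult:
  "matrix_rep G d \<rho> \<Longrightarrow> g \<in> carrier G \<Longrightarrow> h \<in> carrier G \<Longrightarrow> i < d \<Longrightarrow> j < d \<Longrightarrow>
     \<rho> (g \<otimes>\<^bsub>G\<^esub> h) i j = (\<Sum>l<d. \<rho> g i l * \<rho> h l j)"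
  by (simp add: matrix_rep_def)

context group
begin

lemma sum_carrier_translate:
  assumes "a \<in> carrier G"
  shows "(\<Sum>g\<in>carrier G. f (a \<otimes> g)) = (\<Sum>g\<in>carrier G. f g)"
proof -
  have "bij_betw (\<lambda>g. a \<otimes> g) (carrier G) (carrier G)"
    using assms by (simp add: bij_betw_def inj_on_cmult surj_const_mult)
  thus ?thesis by (rule sum.reindex_bij_betw)
qed

lemma sum_carrier_inv: "(\<Sum>g\<in>carrier G. f (inv g)) = (\<Sum>g\<in>carrier G. f g)"
  by (rule sum.reindex_bij_witness[of _ "\<lambda>g. inv g" "\<lambda>g. inv g"]) auto

lemma matrix_rep_inv:
  assumes "matrix_rep G d \<rho>" "g \<in> carrier G" "i < d" "j < d"
  shows "(\<Sum>l<d. \<rho> g i l * \<rho> (inv g) l j) = (if i = j then 1 else 0)"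
    and "(\<Sum>l<d. \<rho> (inv g) i l * \<rho> g l j) = (if i = j then 1 else 0)"
  using assms matrix_rep_mult[OF assms(1), of g "inv g" i j]
    matrix_rep_mult[OF assms(1), of "inv g" g i j] by (auto simp: matrix_rep_one)

text \<open>A pair indexes an entry of a d by e matrix X, and \<open>P\<close> is the averaging
  operator in these coordinates; the indices of \<sigma> appear reversed because \<sigma> multiplies
  X from the right. Composing the operator with itself gives a double sum in g and h that involves
  only the product g h, and translation makes all inner sums equal.\<close>

lemma averaging_idempotent:
  assumes fin: "finite (carrier G)" and \<rho>: "matrix_rep G d \<rho>" and \<sigma>: "matrix_rep G e \<sigma>"
  defines "P \<equiv> \<lambda>x y. (\<Sum>g\<in>carrier G. \<rho> g (fst x) (fst y) * \<sigma> (inv g) (snd y) (snd x)) / of_nat (order G)"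
  assumes x: "x \<in> {..<d} \<times> {..<e}" and z: "z \<in> {..<d} \<times> {..<e}"
  shows "(\<Sum>y\<in>{..<d} \<times> {..<e}. P x y * P y z) = P x z"
proof -
  obtain i k p q where xz: "x = (i, k)" "z = (p, q)" "i < d" "k < e" "p < d" "q < e"
    using x z by auto
  let ?n = "of_nat (order G) :: complex"
  have n0: "?n \<noteq> 0" using fin by (simp add: order_gt_0_iff_finite[symmetric])
  define A where "A g h = (\<Sum>y\<in>{..<d} \<times> {..<e}. (\<rho> g i (fst y) * \<rho> h (fst y) p) *
         (\<sigma> (inv h) q (snd y) * \<sigma> (inv g) (snd y) k))" for g h
  have "(\<Sum>y\<in>{..<d} \<times> {..<e}. P x y * P y z)
     = (\<Sum>y\<in>{..<d} \<times> {..<e}. \<Sum>g\<in>carrier G. \<Sum>h\<in>carrier G. (\<rho> g i (fst y) * \<rho> h (fst y) p) *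
         (\<sigma> (inv h) q (snd y) * \<sigma> (inv g) (snd y) k) / ?n ^ 2)"
    unfolding P_def xz
    by (simp add: sum_product sum_divide_distrib power2_eq_square mult_ac)
  also have "\<dots> = (\<Sum>g\<in>carrier G. \<Sum>h\<in>carrier G. A g h / ?n ^ 2)"
    by (subst sum.swap, rule sum.cong[OF refl], subst sum.swap)
       (simp add: A_def sum_divide_distrib)
  also have "\<dots> = (\<Sum>g\<in>carrier G. \<Sum>h\<in>carrier G. \<rho> (g \<otimes> h) i p * \<sigma> (inv (g \<otimes> h)) q k / ?n ^ 2)"
  proof (intro sum.cong refl)
    fix g h assume gh: "g \<in> carrier G" "h \<in> carrier G"
    have "A g h = (\<Sum>j<d. \<rho> g i j * \<rho> h j p) * (\<Sum>l<e. \<sigma> (inv h) q l * \<sigma> (inv g) l k)"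
      by (simp add: A_def sum_product sum.cartesian_product case_prod_beta)
    also have "\<dots> = \<rho> (g \<otimes> h) i p * \<sigma> (inv (g \<otimes> h)) q k"
      using gh xz by (simp add: inv_mult_group matrix_rep_mult[OF \<rho>] matrix_rep_mult[OF \<sigma>])
    finally show "A g h / ?n ^ 2 = \<rho> (g \<otimes> h) i p * \<sigma> (inv (g \<otimes> h)) q k / ?n ^ 2" by simp
  qed
  also have "\<dots> = (\<Sum>g\<in>carrier G. \<Sum>h\<in>carrier G. \<rho> h i p * \<sigma> (inv h) q k / ?n ^ 2)"
    by (rule sum.cong[OF refl]) (rule sum_carrier_translate[of _ "\<lambda>h. \<rho> h i p * \<sigma> (inv h) q k / ?n ^ 2"])
  also have "\<dots> = P x z"
    using n0 by (simp add: P_def xz order_def sum_divide_distrib[symmetric] power2_eq_square)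
  finally show ?thesis .
qed

lemma averaging_trace:
  "(\<Sum>x\<in>{..<d} \<times> {..<e}. (\<Sum>g\<in>carrier G. \<rho> g (fst x) (fst x) * \<sigma> (inv g) (snd x) (snd x)) / c)
     = (\<Sum>g\<in>carrier G. mat_character d \<rho> g * mat_character e \<sigma> (inv g)) / c"
proof -
  have "(\<Sum>x\<in>{..<d} \<times> {..<e}. (\<Sum>g\<in>carrier G. \<rho> g (fst x) (fst x) * \<sigma> (inv g) (snd x) (snd x)) / c)
     = (\<Sum>g\<in>carrier G. \<Sum>x\<in>{..<d} \<times> {..<e}. \<rho> g (fst x) (fst x) * \<sigma> (inv g) (snd x) (snd x)) / c"
    by (subst sum.swap) (simp add: sum_divide_distrib)
  thus ?thesis
    by (simp add: mat_character_def sum_product sum.cartesian_product case_prod_beta)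
qed

text \<open>The trace of the averaging operator is the inner product of the characters. If it is
  zero, the factorization is empty, and the entries of the operator, which are the sums in question
  up to the factor |G|, all vanish.\<close>

lemma schur_distinct:
  assumes fin: "finite (carrier G)" and \<rho>: "matrix_rep G d \<rho>" and \<sigma>: "matrix_rep G e \<sigma>"
    and orth: "(\<Sum>g\<in>carrier G. mat_character d \<rho> g * mat_character e \<sigma> (inv g)) = 0"
    and "i < d" "j < d" "k < e" "l < e"
  shows "(\<Sum>g\<in>carrier G. \<rho> g i j * \<sigma> (inv g) l k) = 0"
proof -
  let ?n = "of_nat (order G) :: complex"
  have n0: "?n \<noteq> 0" using fin by (simp add: order_gt_0_iff_finite[symmetric])
  define P where "P x y = (\<Sum>g\<in>carrier G. \<rho> g (fst x) (fst y) * \<sigma> (inv g) (snd y) (snd x)) / ?n"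
    for x y
  have idem: "\<And>x z. x \<in> {..<d} \<times> {..<e} \<Longrightarrow> z \<in> {..<d} \<times> {..<e} \<Longrightarrow>
      (\<Sum>y\<in>{..<d} \<times> {..<e}. P x y * P y z) = P x z"
    unfolding P_def by (rule averaging_idempotent[OF fin \<rho> \<sigma>])
  have finY: "finite ({..<d} \<times> {..<e})" by simp
  obtain r :: nat and a b
    where ab: "\<And>x y. x \<in> {..<d} \<times> {..<e} \<Longrightarrow> y \<in> {..<d} \<times> {..<e} \<Longrightarrow> P x y = (\<Sum>s<r. a s x * b s y)"
      and "\<And>s t. s < r \<Longrightarrow> t < r \<Longrightarrow>
        (\<Sum>y\<in>{..<d} \<times> {..<e}. b s y * a t y) = (if s = t then 1 else 0)"
      and tr: "of_nat r = (\<Sum>x\<in>{..<d} \<times> {..<e}. P x x)"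
    by (rule idempotent_factorization_trace[OF finY idem]) (assumption | rule that)+
  have "r = 0" using tr unfolding P_def averaging_trace orth by simp
  thus ?thesis using ab[of "(i, k)" "(j, l)"] assms(5-) n0 by (simp add: P_def)
qed

text \<open>Trace one means rank one, so the sum over g splits as
  \<open>\<alpha> i k * \<beta> j l\<close>. Contracting j with l, or i with k, leaves a product
  \<rho>(g) \<rho>(g^-1) and shows that both factors are multiples of the Kronecker delta. The
  product of their traces, d |G|, then fixes the constant |G| / d.\<close>

lemma schur_same:
  assumes fin: "finite (carrier G)" and \<rho>: "matrix_rep G d \<rho>"
    and norm: "(\<Sum>g\<in>carrier G. mat_character d \<rho> g * mat_character d \<rho> (inv g)) = of_nat (order G)"
    and ijkl: "i < d" "j < d" "k < d" "l < d"
  shows "(\<Sum>g\<in>carrier G. \<rho> g i j * \<rho> (inv g) l k)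
     = (if i = k \<and> j = l then of_nat (order G) / of_nat d else 0)"
proof -
  let ?n = "of_nat (order G) :: complex"
  let ?S = "\<lambda>i k j l. (\<Sum>g\<in>carrier G. \<rho> g i j * \<rho> (inv g) l k)"
  have n0: "?n \<noteq> 0" using fin by (simp add: order_gt_0_iff_finite[symmetric])
  define P where "P x y = (\<Sum>g\<in>carrier G. \<rho> g (fst x) (fst y) * \<rho> (inv g) (snd y) (snd x)) / ?n"
    for x y
  have idem: "\<And>x z. x \<in> {..<d} \<times> {..<d} \<Longrightarrow> z \<in> {..<d} \<times> {..<d} \<Longrightarrow>
      (\<Sum>y\<in>{..<d} \<times> {..<d}. P x y * P y z) = P x z"
    unfolding P_def by (rule averaging_idempotent[OF fin \<rho> \<rho>])
  have finY: "finite ({..<d} \<times> {..<d})" by simp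
  obtain r :: nat and a b
    where ab: "\<And>x y. x \<in> {..<d} \<times> {..<d} \<Longrightarrow> y \<in> {..<d} \<times> {..<d} \<Longrightarrow> P x y = (\<Sum>s<r. a s x * b s y)"
      and "\<And>s t. s < r \<Longrightarrow> t < r \<Longrightarrow>
        (\<Sum>y\<in>{..<d} \<times> {..<d}. b s y * a t y) = (if s = t then 1 else 0)"
      and "of_nat r = (\<Sum>x\<in>{..<d} \<times> {..<d}. P x x)"
    by (rule idempotent_factorization_trace[OF finY idem]) (assumption | rule that)+
  hence "of_nat r = (1 :: complex)" unfolding P_def averaging_trace norm using n0 by simp
  hence "r = 1" by simp
  define \<alpha> where "\<alpha> i k = a 0 (i, k) * ?n" for i k
  define \<beta> where "\<beta> j l = b 0 (j, l)" for j l
  have S: "?S i k j l = \<alpha> i k * \<beta> j l" if "i < d" "j < d" "k < d" "l < d" for i j k l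
    using ab[of "(i, k)" "(j, l)"] that \<open>r = 1\<close> n0 by (simp add: P_def \<alpha>_def \<beta>_def field_simps)
  txt \<open>The averaging operator fixes the identity matrix, and so does its transpose.\<close>
  have 1: "\<alpha> i k * (\<Sum>j<d. \<beta> j j) = (if i = k then ?n else 0)" if "i < d" "k < d" for i k
  proof -
    have "\<alpha> i k * (\<Sum>j<d. \<beta> j j) = (\<Sum>j<d. ?S i k j j)"
      using that by (simp add: S sum_distrib_left)
    also have "\<dots> = (\<Sum>g\<in>carrier G. \<Sum>j<d. \<rho> g i j * \<rho> (inv g) j k)" by (rule sum.swap)
    also have "\<dots> = (\<Sum>g\<in>carrier G. if i = k then 1 else 0)"
      using that by (intro sum.cong refl matrix_rep_inv(1)[OF \<rho>]) auto
    finally show ?thesis by (simp add: order_def)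
  qed
  have 2: "(\<Sum>i<d. \<alpha> i i) * \<beta> j l = (if j = l then ?n else 0)" if "j < d" "l < d" for j l
  proof -
    have "(\<Sum>i<d. \<alpha> i i) * \<beta> j l = (\<Sum>i<d. ?S i i j l)"
      using that by (simp add: S sum_distrib_right)
    also have "\<dots> = (\<Sum>g\<in>carrier G. \<Sum>i<d. \<rho> (inv g) l i * \<rho> g i j)"
      by (subst sum.swap) (simp add: mult.commute)
    also have "\<dots> = (\<Sum>g\<in>carrier G. if l = j then 1 else 0)"
      using that by (intro sum.cong refl matrix_rep_inv(2)[OF \<rho>]) auto
    finally show ?thesis by (auto simp: order_def)
  qed
  have d0: "of_nat d \<noteq> (0 :: complex)" using ijkl by simp
  have tr: "(\<Sum>i<d. \<alpha> i i) * (\<Sum>j<d. \<beta> j j) = of_nat d * ?n"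
    using 1 by (simp add: sum_distrib_right)
  hence nz: "(\<Sum>i<d. \<alpha> i i) \<noteq> 0" "(\<Sum>j<d. \<beta> j j) \<noteq> 0" using d0 n0 by auto
  have "\<alpha> i k = (if i = k then ?n else 0) / (\<Sum>j<d. \<beta> j j)"
    using 1[OF ijkl(1,3)] nz by (simp add: eq_divide_eq)
  moreover have "\<beta> j l = (if j = l then ?n else 0) / (\<Sum>i<d. \<alpha> i i)"
    using 2[OF ijkl(2,4)] nz by (simp add: eq_divide_eq mult.commute)
  ultimately have "\<alpha> i k * \<beta> j l =
      (if i = k \<and> j = l then ?n * ?n / ((\<Sum>i<d. \<alpha> i i) * (\<Sum>j<d. \<beta> j j)) else 0)"
    by (simp add: mult.commute)
  thus ?thesis using S[OF ijkl] n0 unfolding tr by simp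
qed

end

text \<open>Character orthogonality stands for irreducibility and pairwise inequivalence, the
  regular character for completeness of the list. In this form every assumption about the characters
  can be checked on a table of values.\<close>

locale irreducible_system = group G for G (structure) +
  fixes N :: nat and d :: "nat \<Rightarrow> nat" and \<rho> :: "nat \<Rightarrow> 'a \<Rightarrow> nat \<Rightarrow> nat \<Rightarrow> complex"
  assumes finite_carrier: "finite (carrier G)"
    and rep: "p < N \<Longrightarrow> matrix_rep G (d p) (\<rho> p)"
    and dim_pos: "p < N \<Longrightarrow> 0 < d p"
    and character_orthogonal: "p < N \<Longrightarrow> q < N \<Longrightarrow>
      (\<Sum>g\<in>carrier G. mat_character (d p) (\<rho> p) g * mat_character (d q) (\<rho> q) (inv g))
        = (if p = q then of_nat (order G) else 0)"
    and regular_character: "g \<in> carrier G \<Longrightarrow>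
      (\<Sum>p<N. of_nat (d p) * mat_character (d p) (\<rho> p) g) = (if g = \<one> then of_nat (order G) else 0)"
begin

abbreviation \<chi> where "\<chi> p \<equiv> mat_character (d p) (\<rho> p)"
abbreviation n where "n \<equiv> (of_nat (order G) :: complex)"

lemma n_nonzero: "n \<noteq> 0"
  using finite_carrier by (simp add: order_gt_0_iff_finite[symmetric])

lemma schur:
  assumes "p < N" "q < N" "i < d p" "j < d p" "k < d q" "l < d q"
  shows "(\<Sum>g\<in>carrier G. \<rho> p g i j * \<rho> q (inv g) l k)
     = (if p = q \<and> i = k \<and> j = l then n / of_nat (d p) else 0)"
proof (cases "p = q")
  case True
  thus ?thesis
    using schur_same[OF finite_carrier rep[OF assms(1)]] character_orthogonal[of p p] assms by auto
next
  case False
  thus ?thesis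
    using schur_distinct[OF finite_carrier rep[OF assms(1)] rep[OF assms(2)]]
      character_orthogonal[of p q] assms by auto
qed

text \<open>This is the averaging operator applied to \<rho>_p(g), hence a scalar matrix; comparing
  traces gives the scalar.\<close>

lemma sum_conjugates:
  assumes p: "p < N" and g: "g \<in> carrier G" and ij: "i < d p" "j < d p"
  shows "(\<Sum>x\<in>carrier G. \<rho> p (x \<otimes> g \<otimes> inv x) i j) = (if i = j then n / of_nat (d p) * \<chi> p g else 0)"
proof -
  have "(\<Sum>x\<in>carrier G. \<rho> p (x \<otimes> g \<otimes> inv x) i j)
      = (\<Sum>x\<in>carrier G. \<Sum>l<d p. \<Sum>k<d p. \<rho> p g k l * (\<rho> p x i k * \<rho> p (inv x) l j))"
    using g ij by (intro sum.cong refl)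
      (simp add: matrix_rep_mult[OF rep[OF p]] sum_distrib_right sum_distrib_left mult_ac)
  also have "\<dots> = (\<Sum>l<d p. \<Sum>k<d p. \<Sum>x\<in>carrier G. \<rho> p g k l * (\<rho> p x i k * \<rho> p (inv x) l j))"
    by (subst sum.swap, rule sum.cong[OF refl], subst sum.swap) (rule refl)
  also have "\<dots> = (\<Sum>l<d p. \<Sum>k<d p. \<rho> p g k l *
      (\<Sum>x\<in>carrier G. \<rho> p x i k * \<rho> p (inv x) l j))"
    by (simp add: sum_distrib_left)
  also have "\<dots> = (\<Sum>l<d p. \<Sum>k<d p. if k = l then if i = j then n / of_nat (d p) * \<rho> p g k l else 0 else 0)"
    using p ij by (intro sum.cong refl) (auto simp: schur)
  also have "\<dots> = (if i = j then n / of_nat (d p) * \<chi> p g else 0)"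
    by (simp add: sum.delta mat_character_def sum_distrib_left)
  finally show ?thesis .
qed

text \<open>Both sides evaluate the sum over x and p of d_p \<chi>_p(x g x^-1 h^-1). Summing over p
  first, the regular character detects x g x^-1 = h; summing over x first, the average of the
  conjugates is scalar and the characters separate.\<close>

lemma column_orthogonality:
  assumes g: "g \<in> carrier G" and h: "h \<in> carrier G"
  shows "of_nat (card {x\<in>carrier G. x \<otimes> g = h \<otimes> x}) = (\<Sum>p<N. \<chi> p g * \<chi> p (inv h))"
proof -
  have char: "(\<Sum>x\<in>carrier G. \<chi> p (x \<otimes> g \<otimes> inv x \<otimes> inv h)) = n / of_nat (d p) * (\<chi> p g * \<chi> p (inv h))"
    if p: "p < N" for p
  proof -
    have "(\<Sum>x\<in>carrier G. \<chi> p (x \<otimes> g \<otimes> inv x \<otimes> inv h))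
        = (\<Sum>x\<in>carrier G. \<Sum>i<d p. \<Sum>j<d p. \<rho> p (x \<otimes> g \<otimes> inv x) i j * \<rho> p (inv h) j i)"
      using g h unfolding mat_character_def
      by (intro sum.cong refl matrix_rep_mult[OF rep[OF p]]) auto
    also have "\<dots> = (\<Sum>i<d p. \<Sum>j<d p. (\<Sum>x\<in>carrier G. \<rho> p (x \<otimes> g \<otimes> inv x) i j) * \<rho> p (inv h) j i)"
      by (subst sum.swap, rule sum.cong[OF refl], subst sum.swap) (simp add: sum_distrib_right)
    also have "\<dots> = (\<Sum>i<d p. \<Sum>j<d p. if j = i then n / of_nat (d p) * \<chi> p g * \<rho> p (inv h) j i else 0)"
      by (intro sum.cong refl) (simp add: sum_conjugates[OF p g])
    finally show ?thesis
      by (simp add: sum.delta mat_character_def[of _ _ "inv h"] sum_distrib_left mult.assoc)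
  qed
  have "x \<otimes> g = h \<otimes> x \<longleftrightarrow> x \<otimes> g \<otimes> inv x \<otimes> inv h = \<one>" if "x \<in> carrier G" for x
    using that g h by (simp add: inv_solve_right')
  hence "n * of_nat (card {x\<in>carrier G. x \<otimes> g = h \<otimes> x})
      = (\<Sum>x\<in>carrier G. if x \<otimes> g \<otimes> inv x \<otimes> inv h = \<one> then n else 0)"
    using finite_carrier by (simp add: sum.If_cases Int_def cong: conj_cong)
  also have "\<dots> = (\<Sum>x\<in>carrier G. \<Sum>p<N. of_nat (d p) * \<chi> p (x \<otimes> g \<otimes> inv x \<otimes> inv h))"
    using g h by (intro sum.cong refl) (simp add: regular_character)
  also have "\<dots> = (\<Sum>p<N. of_nat (d p) * (\<Sum>x\<in>carrier G. \<chi> p (x \<otimes> g \<otimes> inv x \<otimes> inv h)))"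
    by (subst sum.swap) (simp add: sum_distrib_left)
  also have "\<dots> = n * (\<Sum>p<N. \<chi> p g * \<chi> p (inv h))"
    using dim_pos by (auto simp: char sum_distrib_left intro!: sum.cong)
  finally show ?thesis using n_nonzero by simp
qed

text \<open>Against a class function, \<rho>_p(g) may be averaged over conjugates, and the average
  has all diagonal entries equal to \<chi>_p(g) / d_p. The trace of \<open>unit_op p 0 0\<close> is
  turned into a character sum in this way.\<close>

lemma sum_class_function:
  assumes p: "p < N" and i: "i < d p"
    and f: "\<And>x g. x \<in> carrier G \<Longrightarrow> g \<in> carrier G \<Longrightarrow> f (x \<otimes> g \<otimes> inv x) = f g"
  shows "of_nat (d p) * (\<Sum>g\<in>carrier G. \<rho> p g i i * f g) = (\<Sum>g\<in>carrier G. \<chi> p g * f g)"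
proof -
  have conj: "(\<Sum>g\<in>carrier G. \<rho> p g i i * f g) = (\<Sum>g\<in>carrier G. \<rho> p (x \<otimes> g \<otimes> inv x) i i * f g)"
    if x: "x \<in> carrier G" for x
  proof -
    have "x \<otimes> (inv x \<otimes> g) = g" if "g \<in> carrier G" for g
      using x that by (simp add: m_assoc[symmetric])
    hence "inv x \<otimes> (x \<otimes> g \<otimes> inv x) \<otimes> x = g" "x \<otimes> (inv x \<otimes> g \<otimes> x) \<otimes> inv x = g"
      if "g \<in> carrier G" for g
      using x that by (simp_all add: m_assoc inv_solve_left')
    hence "bij_betw (\<lambda>g. x \<otimes> g \<otimes> inv x) (carrier G) (carrier G)"
      using x by (intro bij_betw_byWitness[where f' = "\<lambda>g. inv x \<otimes> g \<otimes> x"]) auto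
    from sum.reindex_bij_betw[OF this, of "\<lambda>g. \<rho> p g i i * f g"] show ?thesis
      using x by (simp add: f)
  qed
  have "n * (\<Sum>g\<in>carrier G. \<rho> p g i i * f g)
      = (\<Sum>x\<in>carrier G. \<Sum>g\<in>carrier G. \<rho> p g i i * f g)"
    by (simp add: order_def)
  also have "\<dots> = (\<Sum>x\<in>carrier G. \<Sum>g\<in>carrier G. \<rho> p (x \<otimes> g \<otimes> inv x) i i * f g)"
    by (intro sum.cong refl conj)
  also have "\<dots> = (\<Sum>g\<in>carrier G. (\<Sum>x\<in>carrier G. \<rho> p (x \<otimes> g \<otimes> inv x) i i) * f g)"
    by (subst sum.swap) (simp add: sum_distrib_right)
  also have "\<dots> = (\<Sum>g\<in>carrier G. n / of_nat (d p) * (\<chi> p g * f g))"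
    using p i by (intro sum.cong refl) (simp add: sum_conjugates)
  also have "\<dots> = n / of_nat (d p) * (\<Sum>g\<in>carrier G. \<chi> p g * f g)"
    by (simp add: sum_distrib_left)
  finally show ?thesis using n_nonzero dim_pos[OF p] by (simp add: field_simps)
qed

end

section \<open>Isotypic decomposition of permutation modules\<close>

text \<open>The action is on the right, as for right cosets; precomposition with it therefore makes
  the functions on \<open>Y\<close> a left module, with \<open>perm_op\<close> multiplicative in the
  usual order.\<close>

locale permutation_module = irreducible_system +
  fixes Y :: "'y set" and act :: "'a \<Rightarrow> 'y \<Rightarrow> 'y"
  assumes finite_Y: "finite Y"
    and act_closed: "g \<in> carrier G \<Longrightarrow> y \<in> Y \<Longrightarrow> act g y \<in> Y"
    and act_one: "y \<in> Y \<Longrightarrow> act \<one> y = y"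
    and act_mult: "g \<in> carrier G \<Longrightarrow> h \<in> carrier G \<Longrightarrow> y \<in> Y \<Longrightarrow> act (g \<otimes> h) y = act h (act g y)"
begin

definition V :: "('y \<Rightarrow> complex) set" where
  "V = {v. \<forall>y. y \<notin> Y \<longrightarrow> v y = 0}"

definition perm_op :: "'a \<Rightarrow> ('y \<Rightarrow> complex) \<Rightarrow> 'y \<Rightarrow> complex" where
  "perm_op g v = (\<lambda>y. if y \<in> Y then v (act g y) else 0)"

definition fixed_points :: "'a \<Rightarrow> nat" where
  "fixed_points g = card {y\<in>Y. act g y = y}"

text \<open>The images of the matrix units of the group algebra.\<close>

definition unit_op :: "nat \<Rightarrow> nat \<Rightarrow> nat \<Rightarrow> ('y \<Rightarrow> complex) \<Rightarrow> 'y \<Rightarrow> complex" where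
  "unit_op p i j v = (\<lambda>y. \<Sum>g\<in>carrier G. of_nat (d p) / n * \<rho> p (inv g) j i * perm_op g v y)"

lemma perm_op_in_V [simp]: "perm_op g v \<in> V"
  by (simp add: V_def perm_op_def)

lemma unit_op_in_V [simp]: "unit_op p i j v \<in> V"
  by (simp add: V_def unit_op_def perm_op_def)

lemma perm_op_one: "v \<in> V \<Longrightarrow> perm_op \<one> v = v"
  by (auto simp: perm_op_def V_def act_one)

lemma perm_op_mult:
  "g \<in> carrier G \<Longrightarrow> h \<in> carrier G \<Longrightarrow> perm_op (g \<otimes> h) v = perm_op g (perm_op h v)"
  by (auto simp: perm_op_def act_closed act_mult)

lemma perm_op_lincomb:
  "perm_op g (\<lambda>y. \<Sum>t\<in>T. c t * f t y) = (\<lambda>y. \<Sum>t\<in>T. c t * perm_op g (f t) y)"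
  by (auto simp: perm_op_def)

lemma unit_op_lincomb:
  "unit_op p i j (\<lambda>y. \<Sum>t\<in>T. c t * f t y) = (\<lambda>y. \<Sum>t\<in>T. c t * unit_op p i j (f t) y)"
proof
  fix y
  have "unit_op p i j (\<lambda>y. \<Sum>t\<in>T. c t * f t y) y
     = (\<Sum>g\<in>carrier G. \<Sum>t\<in>T. c t * (of_nat (d p) / n * \<rho> p (inv g) j i * perm_op g (f t) y))"
    by (simp add: unit_op_def perm_op_lincomb sum_distrib_left sum_divide_distrib mult_ac)
  also have "\<dots> = (\<Sum>t\<in>T. c t * unit_op p i j (f t) y)"
    by (subst sum.swap) (simp add: unit_op_def sum_distrib_left)
  finally show "unit_op p i j (\<lambda>y. \<Sum>t\<in>T. c t * f t y) y = (\<Sum>t\<in>T. c t * unit_op p i j (f t) y)" .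
qed

text \<open>For fixed j the operators E_ij transform among themselves as the standard basis of
  \<rho>_p. The substitution h = g^-1 (g h) moves g out of the operator and into the matrix
  coefficient.\<close>

lemma perm_op_unit_op:
  assumes p: "p < N" "i < d p" "j < d p" and g: "g \<in> carrier G"
  shows "perm_op g (unit_op p i j v) = (\<lambda>y. \<Sum>l<d p. \<rho> p g l i * unit_op p l j v y)"
proof
  fix y
  let ?c = "of_nat (d p) / n"
  have "perm_op g (unit_op p i j v) y
      = (\<Sum>h\<in>carrier G. ?c * \<rho> p (inv h) j i * perm_op (g \<otimes> h) v y)"
    unfolding unit_op_def perm_op_lincomb using g by (intro sum.cong refl) (simp add: perm_op_mult)
  also have "\<dots> = (\<Sum>h\<in>carrier G. ?c * \<rho> p (inv (inv g \<otimes> (g \<otimes> h))) j i * perm_op (g \<otimes> h) v y)"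
    using g by (intro sum.cong refl) (simp add: m_assoc[symmetric])
  also have "\<dots> = (\<Sum>h\<in>carrier G. ?c * \<rho> p (inv (inv g \<otimes> h)) j i * perm_op h v y)"
    by (rule sum_carrier_translate[OF g, of "\<lambda>h. ?c * \<rho> p (inv (inv g \<otimes> h)) j i * perm_op h v y"])
  also have "\<dots> = (\<Sum>h\<in>carrier G. \<Sum>l<d p. \<rho> p g l i * (?c * \<rho> p (inv h) j l * perm_op h v y))"
    using g p by (intro sum.cong refl)
      (simp add: inv_mult_group matrix_rep_mult[OF rep] sum_distrib_left sum_distrib_right mult_ac)
  also have "\<dots> = (\<Sum>l<d p. \<rho> p g l i * unit_op p l j v y)"
    by (subst sum.swap) (simp add: unit_op_def sum_distrib_left)
  finally show "perm_op g (unit_op p i j v) y = (\<Sum>l<d p. \<rho> p g l i * unit_op p l j v y)" .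
qed

lemma unit_op_perm_op:
  assumes p: "p < N" "i < d p" "j < d p" and g: "g \<in> carrier G"
  shows "unit_op p i j (perm_op g v) = (\<lambda>y. \<Sum>l<d p. \<rho> p g j l * unit_op p i l v y)"
proof
  fix y
  let ?c = "of_nat (d p) / n"
  let ?f = "\<lambda>h. ?c * \<rho> p (g \<otimes> inv h) j i * perm_op h v y"
  have bij: "bij_betw (\<lambda>h. h \<otimes> g) (carrier G) (carrier G)"
    using g by (intro bij_betw_byWitness[where f' = "\<lambda>h. h \<otimes> inv g"]) (auto simp: m_assoc)
  have "unit_op p i j (perm_op g v) y
      = (\<Sum>h\<in>carrier G. ?f (h \<otimes> g))"
    unfolding unit_op_def using g
    by (intro sum.cong refl) (simp add: perm_op_mult inv_mult_group m_assoc[symmetric])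
  also have "\<dots> = (\<Sum>h\<in>carrier G. ?f h)"
    by (rule sum.reindex_bij_betw[OF bij])
  also have "\<dots> = (\<Sum>h\<in>carrier G. \<Sum>l<d p. \<rho> p g j l * (?c * \<rho> p (inv h) l i * perm_op h v y))"
    using g p by (intro sum.cong refl)
      (simp add: matrix_rep_mult[OF rep] sum_distrib_left sum_distrib_right mult_ac)
  also have "\<dots> = (\<Sum>l<d p. \<rho> p g j l * unit_op p i l v y)"
    by (subst sum.swap) (simp add: unit_op_def sum_distrib_left)
  finally show "unit_op p i j (perm_op g v) y = (\<Sum>l<d p. \<rho> p g j l * unit_op p i l v y)" .
qed

text \<open>Once the outer group element has been absorbed into the row index of the inner unit,
  what remains is a Schur sum; the factor d_p / n in \<open>unit_op\<close> cancels its value n /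
  d_p.\<close>

lemma unit_op_unit_op:
  assumes "p < N" "q < N" "i < d p" "j < d p" "k < d q" "l < d q"
  shows "unit_op p i j (unit_op q k l v) = (if p = q \<and> j = k then unit_op p i l v else (\<lambda>y. 0))"
proof
  fix y
  let ?c = "of_nat (d p) / n"
  have "unit_op p i j (unit_op q k l v) y
      = (\<Sum>g\<in>carrier G. ?c * \<rho> p (inv g) j i * (\<Sum>m<d q. \<rho> q g m k * unit_op q m l v y))"
    unfolding unit_op_def[of p i j "unit_op q k l v"]
    using assms by (intro sum.cong refl) (simp add: perm_op_unit_op)
  also have "\<dots> = (\<Sum>m<d q. ?c * (\<Sum>g\<in>carrier G. \<rho> q g m k * \<rho> p (inv g) j i) * unit_op q m l v y)"
    by (simp add: sum_distrib_left sum_distrib_right mult_ac) (rule sum.swap)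
  also have "\<dots> = (\<Sum>m<d q. if m = i then if p = q \<and> j = k then unit_op q m l v y else 0 else 0)"
    using assms n_nonzero dim_pos[OF assms(1)] by (intro sum.cong refl) (auto simp: schur)
  also have "\<dots> = (if p = q \<and> j = k then unit_op p i l v else (\<lambda>y. 0)) y"
    using assms by (auto simp: sum.delta)
  finally show "unit_op p i j (unit_op q k l v) y = (if p = q \<and> j = k then unit_op p i l v else (\<lambda>y. 0)) y" .
qed

text \<open>The diagonal units of \<rho>_p add up to the operator with coefficients d_p
  \<chi>_p(g^-1) / n, and the regular character concentrates the total at the identity. Completeness
  of the list of representations enters here.\<close>

lemma sum_unit_op:
  assumes "v \<in> V"
  shows "(\<Sum>p<N. \<Sum>i<d p. unit_op p i i v y) = v y"
proof -
  have "(\<Sum>p<N. \<Sum>i<d p. unit_op p i i v y)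
      = (\<Sum>p<N. \<Sum>g\<in>carrier G. of_nat (d p) * \<chi> p (inv g) * perm_op g v y / n)"
    unfolding unit_op_def mat_character_def
    by (rule sum.cong[OF refl], subst sum.swap)
       (simp add: sum_distrib_left sum_distrib_right sum_divide_distrib mult_ac)
  also have "\<dots> = (\<Sum>g\<in>carrier G. (\<Sum>p<N. of_nat (d p) * \<chi> p (inv g)) * perm_op g v y / n)"
    by (subst sum.swap) (simp add: sum_distrib_right sum_divide_distrib)
  also have "\<dots> = (\<Sum>g\<in>carrier G. if g = \<one> then perm_op \<one> v y else 0)"
    using n_nonzero by (intro sum.cong refl) (auto simp: regular_character inv_eq_1_iff)
  also have "\<dots> = v y"
    using finite_carrier assms by (simp add: sum.delta perm_op_one)
  finally show ?thesis .
qed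

section \<open>Multiplicities as traces of diagonal idempotents\<close>

lemma fixed_points_conj:
  assumes "x \<in> carrier G" "g \<in> carrier G"
  shows "fixed_points (x \<otimes> g \<otimes> inv x) = fixed_points g"
proof -
  have inv: "act (inv x) (act x y) = y" "act x (act (inv x) y) = y" if "y \<in> Y" for y
    using that assms act_mult[of x "inv x" y] act_mult[of "inv x" x y] by (auto simp: act_one)
  have "bij_betw (act x) {y\<in>Y. act (x \<otimes> g \<otimes> inv x) y = y} {y\<in>Y. act g y = y}"
  proof (rule bij_betw_byWitness[where f' = "act (inv x)"])
    show "act x ` {y\<in>Y. act (x \<otimes> g \<otimes> inv x) y = y} \<subseteq> {y\<in>Y. act g y = y}"
    proof clarify
      fix y assume y: "y \<in> Y" "act (x \<otimes> g \<otimes> inv x) y = y"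
      hence "act (inv x) (act g (act x y)) = y" using assms by (simp add: act_mult)
      thus "act x y \<in> Y \<and> act g (act x y) = act x y"
        using inv(2)[of "act g (act x y)"] assms y by (simp add: act_closed)
    qed
    show "act (inv x) ` {y\<in>Y. act g y = y} \<subseteq> {y\<in>Y. act (x \<otimes> g \<otimes> inv x) y = y}"
      using assms by (auto simp: act_mult act_closed inv)
  qed (auto simp: inv)
  thus ?thesis unfolding fixed_points_def by (rule bij_betw_same_card)
qed

text \<open>The inner product of the permutation character with \<chi>_p, a complex number a priori;
  that it is a natural number follows from its being the trace of an idempotent.\<close>

definition multiplicity :: "nat \<Rightarrow> complex" where
  "multiplicity p = (\<Sum>g\<in>carrier G. \<chi> p (inv g) * of_nat (fixed_points g)) / n"

text \<open>The image of the idempotent \<open>unit_op p 0 0\<close> has basis \<open>a\<close>, with dual functionals \<open>b\<close>.\<close>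

definition multiplicity_basis ::
    "nat \<Rightarrow> nat \<Rightarrow> (nat \<Rightarrow> 'y \<Rightarrow> complex) \<Rightarrow> (nat \<Rightarrow> 'y \<Rightarrow> complex) \<Rightarrow> bool" where
  "multiplicity_basis p m a b \<longleftrightarrow>
     of_nat m = multiplicity p \<and> (\<forall>s<m. a s \<in> V) \<and>
     (\<forall>v\<in>V. unit_op p 0 0 v = (\<lambda>y. \<Sum>s<m. (\<Sum>z\<in>Y. b s z * v z) * a s y)) \<and>
     (\<forall>s<m. \<forall>t<m. (\<Sum>z\<in>Y. b s z * a t z) = (if s = t then 1 else 0))"

text \<open>In the basis of delta functions \<open>unit_op p 0 0\<close> is an idempotent matrix,
  and its rank factorization supplies the basis and the dual functionals. Its trace counts fixed
  points with weights \<rho>_p(g^-1)_00; as the number of fixed points is a class function, these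
  weights may be replaced by \<chi>_p(g^-1) / d_p.\<close>

lemma multiplicity_basis_exists:
  assumes p: "p < N"
  shows "\<exists>m a b. multiplicity_basis p m a b"
proof -
  define \<delta> :: "'y \<Rightarrow> 'y \<Rightarrow> complex" where "\<delta> z = (\<lambda>y. if y = z then 1 else 0)" for z
  define P where "P y z = unit_op p 0 0 (\<delta> z) y" for y z
  have kernel: "unit_op p 0 0 v y = (\<Sum>z\<in>Y. P y z * v z)" if "v \<in> V" for v y
  proof -
    have "v = (\<lambda>y. \<Sum>z\<in>Y. v z * \<delta> z y)"
    proof
      fix y
      have "(\<Sum>z\<in>Y. v z * \<delta> z y) = (\<Sum>z\<in>Y. if z = y then v y else 0)"
        by (intro sum.cong) (auto simp: \<delta>_def)
      thus "v y = (\<Sum>z\<in>Y. v z * \<delta> z y)"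
        using that finite_Y by (auto simp: V_def sum.delta)
    qed
    hence "unit_op p 0 0 v = unit_op p 0 0 (\<lambda>y. \<Sum>z\<in>Y. v z * \<delta> z y)" by simp
    thus ?thesis by (simp add: unit_op_lincomb P_def mult.commute)
  qed
  have idem: "(\<Sum>y\<in>Y. P x y * P y z) = P x z" for x z
  proof -
    have "(\<Sum>y\<in>Y. P x y * P y z) = unit_op p 0 0 (unit_op p 0 0 (\<delta> z)) x"
      using kernel[of "unit_op p 0 0 (\<delta> z)" x] by (simp add: P_def)
    thus ?thesis using unit_op_unit_op[OF p p] dim_pos[OF p] by (simp add: P_def)
  qed
  obtain m :: nat and a b
    where ab: "\<And>x y. x \<in> Y \<Longrightarrow> y \<in> Y \<Longrightarrow> P x y = (\<Sum>s<m. a s x * b s y)"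
      and ba: "\<And>s t. s < m \<Longrightarrow> t < m \<Longrightarrow> (\<Sum>y\<in>Y. b s y * a t y) = (if s = t then 1 else 0)"
      and m: "of_nat m = (\<Sum>x\<in>Y. P x x)"
    by (rule idempotent_factorization_trace[OF finite_Y idem]) (assumption | rule that)+
  have "(\<Sum>y\<in>Y. P y y) = (\<Sum>g\<in>carrier G. \<Sum>y\<in>Y. of_nat (d p) / n * \<rho> p (inv g) 0 0 * perm_op g (\<delta> y) y)"
    unfolding P_def unit_op_def by (rule sum.swap)
  also have "\<dots> = (\<Sum>g\<in>carrier G. of_nat (d p) / n * (\<rho> p (inv g) 0 0 * of_nat (fixed_points g)))"
  proof (rule sum.cong[OF refl])
    fix g
    have "(\<Sum>y\<in>Y. perm_op g (\<delta> y) y) = of_nat (fixed_points g)"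
      using finite_Y
      by (simp add: perm_op_def \<delta>_def fixed_points_def sum.If_cases Int_def cong: conj_cong)
    thus "(\<Sum>y\<in>Y. of_nat (d p) / n * \<rho> p (inv g) 0 0 * perm_op g (\<delta> y) y)
        = of_nat (d p) / n * (\<rho> p (inv g) 0 0 * of_nat (fixed_points g))"
      unfolding sum_distrib_left[symmetric] by simp
  qed
  also have "\<dots> = (of_nat (d p) * (\<Sum>g\<in>carrier G. \<rho> p (inv g) 0 0 * of_nat (fixed_points (inv (inv g))))) / n"
    by (simp add: sum_distrib_left sum_divide_distrib)
  also have "\<dots> = (of_nat (d p) * (\<Sum>g\<in>carrier G. \<rho> p g 0 0 * of_nat (fixed_points (inv g)))) / n"
    by (subst sum_carrier_inv[of "\<lambda>g. \<rho> p g 0 0 * of_nat (fixed_points (inv g))"]) (rule refl)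
  also have "\<dots> = (\<Sum>g\<in>carrier G. \<chi> p g * of_nat (fixed_points (inv g))) / n"
  proof (subst sum_class_function[OF p dim_pos[OF p]])
    fix x g assume "x \<in> carrier G" "g \<in> carrier G"
    thus "of_nat (fixed_points (inv (x \<otimes> g \<otimes> inv x))) = (of_nat (fixed_points (inv g)) :: complex)"
      using fixed_points_conj[of x "inv g"] by (simp add: inv_mult_group m_assoc)
  qed (rule refl)
  also have "\<dots> = multiplicity p"
    using sum_carrier_inv[of "\<lambda>g. \<chi> p g * of_nat (fixed_points (inv g))"]
    by (simp add: multiplicity_def)
  finally have mult: "of_nat m = multiplicity p" using m by simp
  \<comment> \<open>The factorization says nothing outside \<open>Y\<close>; cutting off there puts
    the basis into \<open>V\<close>.\<close>
  define a' where "a' s y = (if y \<in> Y then a s y else 0)" for s y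
  have "unit_op p 0 0 v y = (\<Sum>s<m. (\<Sum>z\<in>Y. b s z * v z) * a' s y)" if "v \<in> V" for v y
  proof (cases "y \<in> Y")
    case True
    have "unit_op p 0 0 v y = (\<Sum>z\<in>Y. \<Sum>s<m. b s z * v z * a s y)"
      using True by (simp add: kernel[OF that] ab sum_distrib_left sum_distrib_right mult_ac)
    thus ?thesis using True by (subst (asm) sum.swap) (simp add: a'_def sum_distrib_right)
  next
    case False
    thus ?thesis using unit_op_in_V[of p 0 0 v] by (simp add: V_def a'_def)
  qed
  moreover have "(\<Sum>z\<in>Y. b s z * a' t z) = (\<Sum>z\<in>Y. b s z * a t z)" for s t
    by (intro sum.cong refl) (simp add: a'_def)
  ultimately have "multiplicity_basis p m a' b"
    using mult ba by (auto simp: multiplicity_basis_def V_def a'_def)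
  thus ?thesis by blast
qed

end

section \<open>The commutant of a permutation module\<close>

text \<open>An element of the direct sum is presented as a function of the label p, listed along
  \<open>ps\<close>, so that all operations become pointwise in p.\<close>

lemma mat_alg_sum_simps:
  "monoid.mult (mat_alg_sum (map m ps)) (map A ps) (map B ps) = map (\<lambda>p. A p * B p) ps"
  "add (mat_alg_sum (map m ps)) (map A ps) (map B ps) = map (\<lambda>p. A p + B p) ps"
  "one (mat_alg_sum (map m ps)) = map (\<lambda>p. 1\<^sub>m (m p)) ps"
  "smult (mat_alg_sum (map m ps)) c (map A ps) = map (\<lambda>p. c \<cdot>\<^sub>m A p) ps"
  by (induction ps) (simp_all add: mat_alg_sum_def alg_direct_sum_def module_mat_def)

lemma map_in_mat_alg_sum:
  "map A ps \<in> carrier (mat_alg_sum (map m ps)) \<longleftrightarrow> (\<forall>p\<in>set ps. A p \<in> carrier_mat (m p) (m p))"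
  by (simp add: mat_alg_sum_def alg_direct_sum_def module_mat_def list_all2_conv_all_nth all_set_conv_all_nth)

lemma mat_alg_sum_carrier_map:
  assumes "distinct ps" "xs \<in> carrier (mat_alg_sum (map m ps))"
  obtains X where "xs = map X ps"
proof
  have len: "length xs = length ps"
    using assms(2) by (simp add: mat_alg_sum_def alg_direct_sum_def list_all2_conv_all_nth)
  show "xs = map (\<lambda>p. the (map_of (zip ps xs) p)) ps"
    using assms(1) len by (intro nth_equalityI) (auto simp: map_of_zip_nth)
qed

context permutation_module
begin

text \<open>The record copies the shape of \<open>centralizer_ring\<close> field by field, so that
  the two coincide as soon as \<open>V\<close> and \<open>perm_op\<close> are identified.\<close>

definition commutant :: "(complex, ('y \<Rightarrow> complex) \<Rightarrow> 'y \<Rightarrow> complex) module" where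
  "commutant =
     \<lparr> carrier = {F \<in> V \<rightarrow>\<^sub>E V.
          (\<forall>u\<in>V. \<forall>v\<in>V. F (\<lambda>s. u s + v s) = (\<lambda>s. F u s + F v s)) \<and>
          (\<forall>c. \<forall>v\<in>V. F (\<lambda>s. c * v s) = (\<lambda>s. c * F v s)) \<and>
          (\<forall>g\<in>carrier G. \<forall>v\<in>V. F (perm_op g v) = perm_op g (F v))},
       monoid.mult = (\<lambda>E F. \<lambda>v\<in>V. E (F v)),
       one = (\<lambda>v\<in>V. v),
       zero = (\<lambda>v\<in>V. \<lambda>s. 0),
       add = (\<lambda>E F. \<lambda>v\<in>V. \<lambda>s. E v s + F v s),
       smult = (\<lambda>c F. \<lambda>v\<in>V. \<lambda>s. c * F v s) \<rparr>"

lemma commutant_iff: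
  "F \<in> carrier commutant \<longleftrightarrow> F \<in> V \<rightarrow>\<^sub>E V \<and>
     (\<forall>u\<in>V. \<forall>v\<in>V. F (\<lambda>s. u s + v s) = (\<lambda>s. F u s + F v s)) \<and>
     (\<forall>c. \<forall>v\<in>V. F (\<lambda>s. c * v s) = (\<lambda>s. c * F v s)) \<and>
     (\<forall>g\<in>carrier G. \<forall>v\<in>V. F (perm_op g v) = perm_op g (F v))"
  unfolding commutant_def partial_object.simps mem_Collect_eq by (rule refl)

lemma
  assumes "F \<in> carrier commutant"
  shows commutant_in_V: "v \<in> V \<Longrightarrow> F v \<in> V"
    and commutant_add: "u \<in> V \<Longrightarrow> v \<in> V \<Longrightarrow> F (\<lambda>s. u s + v s) = (\<lambda>s. F u s + F v s)"
    and commutant_scale: "v \<in> V \<Longrightarrow> F (\<lambda>s. c * v s) = (\<lambda>s. c * F v s)"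
    and commutant_perm_op: "g \<in> carrier G \<Longrightarrow> v \<in> V \<Longrightarrow> F (perm_op g v) = perm_op g (F v)"
  using assms unfolding commutant_iff by blast+

lemma commutant_lincomb:
  assumes F: "F \<in> carrier commutant" and "finite T" and "\<And>t. t \<in> T \<Longrightarrow> f t \<in> V"
  shows "F (\<lambda>y. \<Sum>t\<in>T. c t * f t y) = (\<lambda>y. \<Sum>t\<in>T. c t * F (f t) y)"
  using assms(2,3)
proof (induction T)
  case empty
  have "(\<lambda>y. 0) \<in> V" by (simp add: V_def)
  from commutant_scale[OF F this, of 0] show ?case by simp
next
  case (insert t T)
  have 1: "(\<lambda>y. c t * f t y) \<in> V" and 2: "(\<lambda>y. \<Sum>t\<in>T. c t * f t y) \<in> V"
    using insert.prems by (auto simp: V_def)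
  show ?case
    using insert commutant_add[OF F 1 2] commutant_scale[OF F, of "f t" "c t"] by simp
qed

lemma commutant_unit_op:
  assumes F: "F \<in> carrier commutant" and v: "v \<in> V"
  shows "F (unit_op p i j v) = unit_op p i j (F v)"
proof -
  show ?thesis
    unfolding unit_op_def
    by (subst commutant_lincomb[OF F finite_carrier]) (simp_all add: commutant_perm_op[OF F _ v])
qed

text \<open>The isomorphism sends F to the matrices of its restrictions to the images of
  \<open>unit_op p 0 0\<close>. Any enumeration \<open>ps\<close> of the labels is allowed, which
  later lets the blocks be listed in a prescribed order.\<close>

theorem commutant_iso:
  assumes ps: "distinct ps" "set ps = {..<N}"
    and m: "\<And>p. p < N \<Longrightarrow> of_nat (m p) = multiplicity p"
  shows "commutant \<cong>\<^sub>A mat_alg_sum (map m ps)"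
proof -
  have "\<exists>ab. multiplicity_basis p (m p) (fst ab) (snd ab)" if "p < N" for p
  proof -
    obtain m' a b where "multiplicity_basis p m' a b" using multiplicity_basis_exists[OF \<open>p < N\<close>] by blast
    moreover from this have "m' = m p"
      using m[OF that] by (metis multiplicity_basis_def of_nat_eq_iff)
    ultimately show ?thesis by (intro exI[of _ "(a, b)"]) simp
  qed
  then obtain ab where "\<And>p. p < N \<Longrightarrow> multiplicity_basis p (m p) (fst (ab p)) (snd (ab p))"
    by metis
  then obtain a b where basis: "\<And>p. p < N \<Longrightarrow> multiplicity_basis p (m p) (a p) (b p)"
    by (rule that[of "\<lambda>p. fst (ab p)" "\<lambda>p. snd (ab p)"])
  define B where "B p s v = (\<Sum>z\<in>Y. b p s z * v z)" for p s and v :: "'y \<Rightarrow> complex"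
  have aV: "a p s \<in> V" if "p < N" "s < m p" for p s
    using basis[OF that(1)] that by (simp add: multiplicity_basis_def)
  have e: "unit_op p 0 0 v = (\<lambda>y. \<Sum>s<m p. B p s v * a p s y)" if "p < N" "v \<in> V" for p v
    using basis[OF that(1)] that by (simp add: multiplicity_basis_def B_def)
  have Ba: "B p s (a p t) = (if s = t then 1 else 0)" if "p < N" "s < m p" "t < m p" for p s t
    using basis[OF that(1)] that by (simp add: multiplicity_basis_def B_def)
  have B_lincomb: "B p s (\<lambda>y. \<Sum>t\<in>T. c t * f t y) = (\<Sum>t\<in>T. c t * B p s (f t))"
    for p s T and c :: "nat \<Rightarrow> complex" and f
    unfolding B_def by (simp add: sum_distrib_left mult_ac) (rule sum.swap)
  have ea: "unit_op p 0 0 (a p t) = a p t" if "p < N" "t < m p" for p t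
  proof -
    have "(\<Sum>s<m p. B p s (a p t) * a p s y) = (\<Sum>s<m p. if s = t then a p s y else 0)" for y
      using that by (intro sum.cong refl) (simp add: Ba)
    thus ?thesis using that by (simp add: e aV sum.delta)
  qed
  define M where "M p F = mat (m p) (m p) (\<lambda>(s, t). B p s (F (a p t)))"
    for p and F :: "('y \<Rightarrow> complex) \<Rightarrow> 'y \<Rightarrow> complex"
  \<comment> \<open>F commutes with the idempotent \<open>unit_op p 0 0\<close> that fixes
    \<open>a p t\<close>, so it preserves the span of the \<open>a p s\<close>.\<close>
  have Fa: "F (a p t) = (\<lambda>y. \<Sum>s<m p. M p F $$ (s, t) * a p s y)"
    if "F \<in> carrier commutant" "p < N" "t < m p" for F p t
  proof -
    have "F (a p t) = F (unit_op p 0 0 (a p t))" using that by (simp add: ea)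
    also have "\<dots> = unit_op p 0 0 (F (a p t))" using that aV commutant_unit_op by blast
    finally show ?thesis using that e[OF that(2) commutant_in_V[OF that(1) aV[OF that(2,3)]]]
      by (simp add: M_def)
  qed
  \<comment> \<open>The vectors \<open>\<psi> p i s\<close> lie in the image of E_ii and are
    transported from the basis \<open>a p s\<close> by E_i0; the functionals
    \<open>\<phi> p i t\<close> are dual to them. An operator in the commutant has the same matrix X
    p on each of the d_p copies, which is what \<open>assemble\<close> writes out.\<close>
  define \<phi> where "\<phi> p i t v = B p t (unit_op p 0 i v)" for p i t v
  define \<psi> where "\<psi> p i s = unit_op p i 0 (a p s)" for p i s
  define assemble where "assemble X = (\<lambda>v\<in>V. \<lambda>y. \<Sum>p<N. \<Sum>i<d p. \<Sum>s<m p. \<Sum>t<m p.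
      X p $$ (s, t) * \<phi> p i t v * \<psi> p i s y)" for X :: "nat \<Rightarrow> complex mat"
  have recover: "F = assemble (\<lambda>p. M p F)" if F: "F \<in> carrier commutant" for F
  proof
    fix v
    show "F v = assemble (\<lambda>p. M p F) v"
    proof (cases "v \<in> V")
      case False
      thus ?thesis using F by (auto simp: assemble_def commutant_iff)
    next
      case v: True
      show ?thesis
      proof
        fix y
        have unit: "unit_op p i i (F v) = (\<lambda>y. \<Sum>s<m p. \<Sum>t<m p. M p F $$ (s, t) * \<phi> p i t v * \<psi> p i s y)"
          if p: "p < N" "i < d p" for p i
        proof -
          have w: "unit_op p 0 i v \<in> V" by simp
          \<comment> \<open>Factoring E_ii = E_i0 E_00 E_0i and commuting F past the last two
            factors leaves F acting on the span of the \<open>a p t\<close> only.\<close>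
          have "unit_op p i i (F v) = unit_op p i 0 (unit_op p 0 0 (unit_op p 0 i (F v)))"
            using p dim_pos[of p] by (simp add: unit_op_unit_op)
          also have "\<dots> = unit_op p i 0 (F (unit_op p 0 0 (unit_op p 0 i v)))"
            using v F by (simp add: commutant_unit_op)
          also have "\<dots> = unit_op p i 0 (F (\<lambda>y. \<Sum>t<m p. \<phi> p i t v * a p t y))"
            using p by (simp add: e \<phi>_def)
          also have "\<dots> = (\<lambda>y. \<Sum>t<m p. \<phi> p i t v * unit_op p i 0 (F (a p t)) y)"
            using p aV commutant_lincomb[OF F, of "{..<m p}" "a p" "\<lambda>t. \<phi> p i t v"]
            by (simp add: unit_op_lincomb)
          also have "\<dots> = (\<lambda>y. \<Sum>t<m p. \<phi> p i t v * (\<Sum>s<m p. M p F $$ (s, t) * \<psi> p i s y))"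
            using p by (intro ext sum.cong refl) (simp add: Fa[OF F] unit_op_lincomb \<psi>_def)
          also have "\<dots> = (\<lambda>y. \<Sum>s<m p. \<Sum>t<m p. M p F $$ (s, t) * \<phi> p i t v * \<psi> p i s y)"
            by (rule ext, subst sum.swap) (simp add: sum_distrib_left mult_ac)
          finally show ?thesis .
        qed
        have "F v y = (\<Sum>p<N. \<Sum>i<d p. unit_op p i i (F v) y)"
          using commutant_in_V[OF F v] by (simp add: sum_unit_op)
        also have "\<dots> = assemble (\<lambda>p. M p F) v y"
          using v by (simp add: unit assemble_def)
        finally show "F v y = assemble (\<lambda>p. M p F) v y" .
      qed
    qed
  qed
  have assemble: "assemble X \<in> carrier commutant" for X
  proof -
    have \<psi>V: "\<psi> p i s y = 0" if "y \<notin> Y" for p i s y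
      using unit_op_in_V[of p i 0 "a p s"] that by (simp add: \<psi>_def V_def)
    have \<phi>_add: "\<phi> p i t (\<lambda>y. u y + v y) = \<phi> p i t u + \<phi> p i t v" for p i t u v
      by (simp add: \<phi>_def B_def unit_op_def perm_op_def sum.distrib distrib_left add_divide_distrib)
    have \<phi>_scale: "\<phi> p i t (\<lambda>y. c * v y) = c * \<phi> p i t v" for p i t c v
      by (simp add: \<phi>_def B_def unit_op_def perm_op_def sum_distrib_left mult_ac)
    have V_add: "(\<lambda>y. u y + v y) \<in> V" and V_scale: "(\<lambda>y. c * v y) \<in> V"
      if "u \<in> V" "v \<in> V" for u v c using that by (auto simp: V_def)
    have "assemble X (perm_op g v) = perm_op g (assemble X v)" if g: "g \<in> carrier G" and v: "v \<in> V" for g v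
    proof
      fix y
      \<comment> \<open>\<open>Z p i j\<close> pairs the functional at i with the vector at j.
        Moving g through the functionals or through the vectors gives the same combination of the
        \<open>Z p i j\<close>, up to the names of i and j.\<close>
      define Z where "Z p i j = (\<Sum>s<m p. \<Sum>t<m p. X p $$ (s, t) * \<phi> p i t v * \<psi> p j s y)" for p i j
      have \<phi>_perm: "\<phi> p i t (perm_op g v) = (\<Sum>j<d p. \<rho> p g i j * \<phi> p j t v)"
        if "p < N" "i < d p" for p i t
        using that dim_pos[of p] g by (simp add: \<phi>_def unit_op_perm_op B_lincomb)
      have \<psi>_perm: "perm_op g (\<psi> p i s) = (\<lambda>y. \<Sum>j<d p. \<rho> p g j i * \<psi> p j s y)"
        if "p < N" "i < d p" for p i s
        using that dim_pos[of p] g by (simp add: \<psi>_def perm_op_unit_op)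
      have "assemble X (perm_op g v) y = (\<Sum>p<N. \<Sum>i<d p. \<Sum>j<d p. \<rho> p g i j * Z p j i)"
      proof -
        have "(\<Sum>s<m p. \<Sum>t<m p. X p $$ (s, t) * \<phi> p i t (perm_op g v) * \<psi> p i s y)
            = (\<Sum>j<d p. \<rho> p g i j * Z p j i)" if "p < N" "i < d p" for p i
        proof -
          have "(\<Sum>s<m p. \<Sum>t<m p. X p $$ (s, t) * \<phi> p i t (perm_op g v) * \<psi> p i s y)
            = (\<Sum>s<m p. \<Sum>t<m p. \<Sum>j<d p. \<rho> p g i j * (X p $$ (s, t) * \<phi> p j t v * \<psi> p i s y))"
            using that by (simp add: \<phi>_perm sum_distrib_left sum_distrib_right mult_ac)
          also have "\<dots> = (\<Sum>s<m p. \<Sum>j<d p. \<Sum>t<m p. \<rho> p g i j * (X p $$ (s, t) * \<phi> p j t v * \<psi> p i s y))"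
            by (rule sum.cong[OF refl], rule sum.swap)
          also have "\<dots> = (\<Sum>j<d p. \<rho> p g i j * Z p j i)"
            by (subst sum.swap) (simp add: Z_def sum_distrib_left)
          finally show ?thesis .
        qed
        thus ?thesis by (simp add: assemble_def)
      qed
      also have "\<dots> = (\<Sum>p<N. \<Sum>i<d p. \<Sum>j<d p. \<rho> p g j i * Z p i j)"
        by (rule sum.cong[OF refl], rule sum.swap)
      also have "\<dots> = (\<Sum>p<N. \<Sum>i<d p. \<Sum>s<m p. \<Sum>t<m p.
            X p $$ (s, t) * \<phi> p i t v * perm_op g (\<psi> p i s) y)"
      proof (rule sum.cong[OF refl], rule sum.cong[OF refl])
        fix p i assume pi: "p \<in> {..<N}" "i \<in> {..<d p}"
        have "(\<Sum>s<m p. \<Sum>t<m p. X p $$ (s, t) * \<phi> p i t v * perm_op g (\<psi> p i s) y)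
          = (\<Sum>s<m p. \<Sum>t<m p. \<Sum>j<d p. \<rho> p g j i * (X p $$ (s, t) * \<phi> p i t v * \<psi> p j s y))"
          using pi by (simp add: \<psi>_perm sum_distrib_left sum_distrib_right mult_ac)
        also have "\<dots> = (\<Sum>s<m p. \<Sum>j<d p. \<Sum>t<m p. \<rho> p g j i * (X p $$ (s, t) * \<phi> p i t v * \<psi> p j s y))"
          by (rule sum.cong[OF refl], rule sum.swap)
        also have "\<dots> = (\<Sum>j<d p. \<rho> p g j i * Z p i j)"
          by (subst sum.swap) (simp add: Z_def sum_distrib_left)
        finally show "(\<Sum>j<d p. \<rho> p g j i * Z p i j)
          = (\<Sum>s<m p. \<Sum>t<m p. X p $$ (s, t) * \<phi> p i t v * perm_op g (\<psi> p i s) y)" ..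
      qed
      also have "\<dots> = perm_op g (assemble X v) y"
        using v by (simp add: assemble_def perm_op_def)
      finally show "assemble X (perm_op g v) y = perm_op g (assemble X v) y" .
    qed
    moreover have "assemble X \<in> V \<rightarrow>\<^sub>E V"
      by (auto simp: assemble_def V_def \<psi>V)
    moreover have "assemble X (\<lambda>y. u y + v y) = (\<lambda>y. assemble X u y + assemble X v y)"
      if "u \<in> V" "v \<in> V" for u v
      using that V_add[OF that] by (simp add: assemble_def \<phi>_add sum.distrib distrib_left distrib_right)
    moreover have "assemble X (\<lambda>y. c * v y) = (\<lambda>y. c * assemble X v y)" if "v \<in> V" for c v
      using that V_scale[OF that that] by (simp add: assemble_def \<phi>_scale sum_distrib_left mult_ac)
    ultimately show ?thesis unfolding commutant_iff by blast
  qed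
  have M_assemble: "M q (assemble X) = X q" if q: "q < N" and X: "X q \<in> carrier_mat (m q) (m q)" for q X
  proof (rule eq_matI)
    fix s' t' assume "s' < dim_row (X q)" "t' < dim_col (X q)"
    hence st: "s' < m q" "t' < m q" using X by auto
    \<comment> \<open>Since \<open>a q t'\<close> lies in the image of \<open>unit_op q 0 0\<close>,
      only the functional with p = q, i = 0 and t = t' sees it.\<close>
    have \<phi>a: "\<phi> p i t (a q t') = (if p = q \<and> i = 0 \<and> t = t' then 1 else 0)"
      if "p < N" "i < d p" "t < m p" for p i t
    proof -
      have "unit_op p 0 i (a q t') = unit_op p 0 i (unit_op q 0 0 (a q t'))"
        using q st by (simp only: ea)
      also have "\<dots> = (if p = q \<and> i = 0 then a q t' else (\<lambda>y. 0))"
        using that q st dim_pos[of p] dim_pos[of q]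
        by (subst unit_op_unit_op) (auto simp: ea)
      finally have "\<phi> p i t (a q t') = B p t (if p = q \<and> i = 0 then a q t' else (\<lambda>y. 0))"
        by (simp only: \<phi>_def)
      thus ?thesis using that st by (auto simp: Ba) (simp_all add: B_def)
    qed
    have "assemble X (a q t') = (\<lambda>y. \<Sum>s<m q. X q $$ (s, t') * a q s y)"
    proof
      fix y
      have inner: "(\<Sum>t<m p. X p $$ (s, t) * \<phi> p i t (a q t') * \<psi> p i s y)
          = (if p = q \<and> i = 0 then X p $$ (s, t') * \<psi> p i s y else 0)"
        if "p < N" "i < d p" for p i s
      proof -
        have "(\<Sum>t<m p. X p $$ (s, t) * \<phi> p i t (a q t') * \<psi> p i s y)
            = (\<Sum>t<m p. if t = t' then if p = q \<and> i = 0 then X p $$ (s, t') * \<psi> p i s y else 0 else 0)"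
          using that by (intro sum.cong refl) (simp add: \<phi>a)
        thus ?thesis using st by (simp add: sum.delta)
      qed
      have "assemble X (a q t') y
          = (\<Sum>p<N. \<Sum>i<d p. \<Sum>s<m p. if p = q \<and> i = 0 then X p $$ (s, t') * \<psi> p i s y else 0)"
        using q st aV by (simp add: assemble_def inner)
      also have "\<dots> = (\<Sum>p<N. \<Sum>i<d p. if p = q \<and> i = 0 then \<Sum>s<m p. X p $$ (s, t') * \<psi> p i s y else 0)"
        by (rule sum.cong[OF refl], rule sum.cong[OF refl]) auto
      also have "\<dots> = (\<Sum>p<N. if p = q then \<Sum>i<d p. if i = 0 then \<Sum>s<m p. X p $$ (s, t') * \<psi> p i s y else 0 else 0)"
        by (rule sum.cong[OF refl]) auto
      also have "\<dots> = (\<Sum>s<m q. X q $$ (s, t') * \<psi> q 0 s y)"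
        using q dim_pos[OF q] by (simp add: sum.delta)
      also have "\<dots> = (\<Sum>s<m q. X q $$ (s, t') * a q s y)"
        using q by (simp add: \<psi>_def ea)
      finally show "assemble X (a q t') y = (\<Sum>s<m q. X q $$ (s, t') * a q s y)" .
    qed
    hence "M q (assemble X) $$ (s', t') = (\<Sum>s<m q. X q $$ (s, t') * B q s' (a q s))"
      using st by (simp add: M_def B_lincomb)
    also have "\<dots> = (\<Sum>s<m q. if s = s' then X q $$ (s, t') else 0)"
      using q st by (intro sum.cong refl) (auto simp: Ba)
    finally show "M q (assemble X) $$ (s', t') = X q $$ (s', t')" using st by (simp add: sum.delta)
  qed (use X in \<open>auto simp: M_def\<close>)
  define h where "h F = map (\<lambda>p. M p F) ps" for F
  have psN: "p < N" if "p \<in> set ps" for p using that ps(2) by auto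
  have "h \<in> ring_iso commutant (mat_alg_sum (map m ps))"
  proof (rule ring_iso_memI)
    fix E F assume E: "E \<in> carrier commutant" and F: "F \<in> carrier commutant"
    show "h F \<in> carrier (mat_alg_sum (map m ps))"
      by (simp add: h_def map_in_mat_alg_sum M_def)
    have "M p (E \<otimes>\<^bsub>commutant\<^esub> F) = M p E * M p F" if p: "p < N" for p
    proof (rule eq_matI)
      fix s t assume "s < dim_row (M p E * M p F)" "t < dim_col (M p E * M p F)"
      hence st: "s < m p" "t < m p" by (auto simp: M_def)
      have "M p (E \<otimes>\<^bsub>commutant\<^esub> F) $$ (s, t) = B p s (E (F (a p t)))"
        using st p aV by (simp add: M_def commutant_def)
      also have "\<dots> = (\<Sum>u<m p. M p F $$ (u, t) * B p s (E (a p u)))"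
        using st p aV commutant_lincomb[OF E, of "{..<m p}" "a p" "\<lambda>u. M p F $$ (u, t)"]
        by (simp add: Fa[OF F] B_lincomb)
      also have "\<dots> = (M p E * M p F) $$ (s, t)"
        using st by (simp add: M_def scalar_prod_def lessThan_atLeast0 mult.commute)
      finally show "M p (E \<otimes>\<^bsub>commutant\<^esub> F) $$ (s, t) = (M p E * M p F) $$ (s, t)" .
    qed (auto simp: M_def)
    thus "h (E \<otimes>\<^bsub>commutant\<^esub> F) = h E \<otimes>\<^bsub>mat_alg_sum (map m ps)\<^esub> h F"
      using psN by (simp add: h_def mat_alg_sum_simps)
    have "M p (E \<oplus>\<^bsub>commutant\<^esub> F) = M p E + M p F" if p: "p < N" for p
      using p aV by (intro eq_matI) (auto simp: M_def commutant_def B_def sum.distrib distrib_left)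
    thus "h (E \<oplus>\<^bsub>commutant\<^esub> F) = h E \<oplus>\<^bsub>mat_alg_sum (map m ps)\<^esub> h F"
      using psN by (simp add: h_def mat_alg_sum_simps)
  next
    have "M p \<one>\<^bsub>commutant\<^esub> = 1\<^sub>m (m p)" if p: "p < N" for p
      using p aV by (intro eq_matI) (auto simp: M_def commutant_def Ba)
    thus "h \<one>\<^bsub>commutant\<^esub> = \<one>\<^bsub>mat_alg_sum (map m ps)\<^esub>"
      using psN by (simp add: h_def mat_alg_sum_simps)
  next
    show "bij_betw h (carrier commutant) (carrier (mat_alg_sum (map m ps)))"
      unfolding bij_betw_def
    proof
      show "inj_on h (carrier commutant)"
      proof (rule inj_onI)
        fix E F assume E: "E \<in> carrier commutant" and F: "F \<in> carrier commutant" and "h E = h F"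
        hence "M p E = M p F" if "p < N" for p using that ps(2) by (auto simp: h_def)
        hence "assemble (\<lambda>p. M p E) = assemble (\<lambda>p. M p F)" by (simp add: assemble_def)
        thus "E = F" using recover[OF E] recover[OF F] by simp
      qed
      show "h ` carrier commutant = carrier (mat_alg_sum (map m ps))"
      proof
        show "h ` carrier commutant \<subseteq> carrier (mat_alg_sum (map m ps))"
          by (auto simp: h_def map_in_mat_alg_sum M_def)
        show "carrier (mat_alg_sum (map m ps)) \<subseteq> h ` carrier commutant"
        proof
          fix xs assume xs: "xs \<in> carrier (mat_alg_sum (map m ps))"
          then obtain X where X: "xs = map X ps" using mat_alg_sum_carrier_map[OF ps(1)] by blast
          hence "h (assemble X) = xs"
            using xs psN by (auto simp: h_def map_in_mat_alg_sum M_assemble)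
          thus "xs \<in> h ` carrier commutant" using assemble by blast
        qed
      qed
    qed
  qed
  moreover have "h (c \<odot>\<^bsub>commutant\<^esub> F) = c \<odot>\<^bsub>mat_alg_sum (map m ps)\<^esub> h F" for c F
  proof -
    have "M p (c \<odot>\<^bsub>commutant\<^esub> F) = c \<cdot>\<^sub>m M p F" if p: "p < N" for p
      using p aV by (intro eq_matI) (auto simp: M_def commutant_def B_def sum_distrib_left mult_ac)
    thus ?thesis using psN by (simp add: h_def mat_alg_sum_simps)
  qed
  ultimately show ?thesis unfolding alg_iso_def by blast
qed

end

section \<open>Centralizer rings of transitive permutation representations\<close>

definition coset_fixed_points :: "('g, 'r) monoid_scheme \<Rightarrow> 'g set \<Rightarrow> 'g \<Rightarrow> nat" where
  "coset_fixed_points G K g = card {C \<in> rcosets\<^bsub>G\<^esub> K. C #>\<^bsub>G\<^esub> g = C}"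

context group
begin

lemma rcosets_translate:
  assumes "subgroup K G" "C \<in> rcosets K" "g \<in> carrier G"
  shows "C #> g \<in> rcosets K"
  using assms by (auto simp: RCOSETS_def coset_mult_assoc subgroup.subset)

text \<open>The coset K x is fixed by g exactly when x g x^-1 lies in K. The set of such x is
  counted twice: as a union of fixed cosets of size |K|, and according to the element h = x g x^-1
  of K.\<close>

lemma card_mult_coset_fixed_points:
  assumes fin: "finite (carrier G)" and K: "subgroup K G" and g: "g \<in> carrier G"
  shows "card K * coset_fixed_points G K g = (\<Sum>h\<in>K. card {x\<in>carrier G. x \<otimes> g = h \<otimes> x})"
proof -
  have KG: "K \<subseteq> carrier G" using K by (rule subgroup.subset)
  let ?F = "{C \<in> rcosets K. C #> g = C}"
  have iff: "x \<otimes> g \<otimes> inv x \<in> K \<longleftrightarrow> (\<exists>h\<in>K. x \<otimes> g = h \<otimes> x)" if "x \<in> carrier G" for x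
  proof -
    have "x \<otimes> g \<otimes> inv x = h \<longleftrightarrow> x \<otimes> g = h \<otimes> x" if "h \<in> K" for h
      using \<open>x \<in> carrier G\<close> g subsetD[OF KG that] by (intro inv_solve_right') auto
    thus ?thesis by blast
  qed
  have Union: "\<Union>?F = {x\<in>carrier G. x \<otimes> g \<otimes> inv x \<in> K}"
  proof (intro equalityI subsetI)
    fix x assume "x \<in> \<Union>?F"
    then obtain C where C: "C \<in> rcosets K" "C #> g = C" "x \<in> C" by blast
    hence x: "x \<in> carrier G" using rcosets_part_G[OF K] by blast
    obtain y where y: "y \<in> carrier G" "C = K #> y" using C(1) by (auto simp: RCOSETS_def)
    hence "C = K #> x" using repr_independence[of x K y] C(3) K by simp
    hence "K #> (x \<otimes> g) = K #> x" using C x g KG by (simp add: coset_mult_assoc)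
    hence "x \<otimes> g \<in> K #> x" using rcos_self[OF _ K, of "x \<otimes> g"] x g by simp
    hence "\<exists>h\<in>K. x \<otimes> g = h \<otimes> x" by (auto simp: r_coset_def)
    thus "x \<in> {x\<in>carrier G. x \<otimes> g \<otimes> inv x \<in> K}" using x iff by simp
  next
    fix x assume "x \<in> {x\<in>carrier G. x \<otimes> g \<otimes> inv x \<in> K}"
    hence x: "x \<in> carrier G" "x \<otimes> g \<otimes> inv x \<in> K" by auto
    have "K #> x #> g = K #> (x \<otimes> g \<otimes> inv x \<otimes> x)"
      using x(1) g KG by (simp add: coset_mult_assoc m_assoc)
    also have "\<dots> = K #> (x \<otimes> g \<otimes> inv x) #> x"
      using x(1) g KG by (simp add: coset_mult_assoc)
    also have "\<dots> = K #> x" using x K subsetD[OF KG] by (simp add: coset_join2)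
    finally show "x \<in> \<Union>?F" using x(1) K rcos_self[of x K] rcosetsI[of K x] KG by blast
  qed
  have disj: "pairwise disjnt ?F"
    using rcos_disjoint[OF K] by (rule pairwise_subset) auto
  have finC: "finite C" if "C \<in> ?F" for C
    using that rcosets_part_G[OF K] fin finite_subset[of C "carrier G"] by blast
  have "card (\<Union>?F) = (\<Sum>C\<in>?F. card C)"
    by (rule card_Union_disjoint[OF disj finC])
  also have "\<dots> = (\<Sum>C\<in>?F. card K)"
    using card_rcosets_equal KG by (intro sum.cong refl) auto
  also have "\<dots> = card K * coset_fixed_points G K g" by (simp add: coset_fixed_points_def)
  finally have 1: "card K * coset_fixed_points G K g = card (\<Union>?F)" ..
  have "\<Union>?F = (\<Union>h\<in>K. {x\<in>carrier G. x \<otimes> g = h \<otimes> x})"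
    unfolding Union using iff by blast
  also have "card \<dots> = (\<Sum>h\<in>K. card {x\<in>carrier G. x \<otimes> g = h \<otimes> x})"
  proof (rule card_UN_disjoint)
    show "finite K" using KG fin by (rule finite_subset)
    show "\<forall>h\<in>K. finite {x\<in>carrier G. x \<otimes> g = h \<otimes> x}" using fin by auto
    show "\<forall>h\<in>K. \<forall>h'\<in>K. h \<noteq> h' \<longrightarrow>
        {x\<in>carrier G. x \<otimes> g = h \<otimes> x} \<inter> {x\<in>carrier G. x \<otimes> g = h' \<otimes> x} = {}"
      using KG by (auto simp: subset_iff)
  qed
  finally show ?thesis using 1 by simp
qed

end

context irreducible_system
begin

text \<open>Frobenius reciprocity for the trivial character of K. Keeping the sum over K outermost
  shows that only the character values on K enter.\<close>

lemma coset_fixed_points_character: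
  assumes K: "subgroup K G" and g: "g \<in> carrier G"
  shows "of_nat (coset_fixed_points G K g) = (\<Sum>h\<in>K. \<Sum>p<N. \<chi> p g * \<chi> p (inv h)) / of_nat (card K)"
proof -
  have "finite K" using subgroup.subset[OF K] finite_carrier by (rule finite_subset)
  moreover have "K \<noteq> {}" using subgroup.one_closed[OF K] by blast
  ultimately have "of_nat (card K) \<noteq> (0 :: complex)" by simp
  moreover have "of_nat (card K) * of_nat (coset_fixed_points G K g)
      = (\<Sum>h\<in>K. of_nat (card {x\<in>carrier G. x \<otimes> g = h \<otimes> x}) :: complex)"
    unfolding of_nat_mult[symmetric] card_mult_coset_fixed_points[OF finite_carrier K g] by simp
  moreover have "\<dots> = (\<Sum>h\<in>K. \<Sum>p<N. \<chi> p g * \<chi> p (inv h))"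
    using subgroup.mem_carrier[OF K] g by (intro sum.cong refl) (simp add: column_orthogonality)
  ultimately show ?thesis by (simp add: field_simps)
qed

text \<open>The k-th tensor power of a permutation module is the permutation module on k-tuples with
  diagonal action: a product of permutation matrix entries is 1 exactly when one tuple is the
  translate of the other. A tuple is fixed iff all its entries are, so the character is the k-th
  power.\<close>

theorem centralizer_ring_decomposition:
  assumes K: "subgroup K G"
  obtains m :: "nat \<Rightarrow> nat"
  where "\<And>p. p < N \<Longrightarrow> of_nat (m p) =
      (\<Sum>g\<in>carrier G. \<chi> p (inv g) * of_nat (coset_fixed_points G K g) ^ k) / n"
    and "\<And>ps. distinct ps \<Longrightarrow> set ps = {..<N} \<Longrightarrow>
      centralizer_ring G K k \<cong>\<^sub>A mat_alg_sum (map m ps)"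
proof -
  let ?X = "rcosets K"
  let ?act = "\<lambda>a. map (\<lambda>C. C #> a)"
  have KG: "K \<subseteq> carrier G" using K by (rule subgroup.subset)
  have rc: "C #> \<one> = C" "\<And>g h. g \<in> carrier G \<Longrightarrow> h \<in> carrier G \<Longrightarrow> C #> (g \<otimes> h) = C #> g #> h"
    if "C \<in> ?X" for C
    using that rcosets_subset_PowG[OF K] by (auto simp: coset_mult_assoc)
  have finX: "finite ?X"
    using rcosets_subset_PowG[OF K] finite_carrier by (meson finite_Pow_iff finite_subset)
  interpret permutation_module G N d \<rho> "tuples ?X k" ?act
  proof
    show "finite (tuples ?X k)"
      unfolding tuples_def using finX by (rule finite_lists_length_eq)
  next
    fix g s assume "g \<in> carrier G" "s \<in> tuples ?X k"
    thus "?act g s \<in> tuples ?X k" by (auto simp: tuples_def rcosets_translate[OF K])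
  next
    fix s assume "s \<in> tuples ?X k"
    thus "?act \<one> s = s" by (auto simp: tuples_def rc intro!: map_idI)
  next
    fix g h s assume "g \<in> carrier G" "h \<in> carrier G" "s \<in> tuples ?X k"
    thus "?act (g \<otimes> h) s = ?act h (?act g s)" by (auto simp: tuples_def rc)
  qed
  have V: "V = tensor_space ?X k" by (simp add: V_def tensor_space_def)
  have perm_op: "tensor_power_map ?X k (coset_perm_mat G a) v = perm_op a v" if a: "a \<in> carrier G" for a v
  proof
    fix s
    show "tensor_power_map ?X k (coset_perm_mat G a) v s = perm_op a v s"
    proof (cases "s \<in> tuples ?X k")
      case True
      have "(\<Prod>j<k. coset_perm_mat G a (s ! j) (t ! j)) = (if t = ?act a s then 1 else 0)"
        if t: "t \<in> tuples ?X k" for t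
      proof (cases "t = ?act a s")
        case True
        thus ?thesis using \<open>s \<in> _\<close> by (simp add: coset_perm_mat_def tuples_def)
      next
        case False
        have "\<exists>j<k. t ! j \<noteq> s ! j #> a"
        proof (rule ccontr)
          assume "\<not> ?thesis"
          hence "t = ?act a s"
            using t \<open>s \<in> _\<close> by (intro nth_equalityI) (simp_all add: tuples_def)
          with False show False by contradiction
        qed
        thus ?thesis using False by (auto simp: coset_perm_mat_def prod_zero_iff)
      qed
      hence "tensor_power_map ?X k (coset_perm_mat G a) v s
          = (\<Sum>t\<in>tuples ?X k. if t = ?act a s then v t else 0)"
        using True unfolding tensor_power_map_def by (auto intro!: sum.cong)
      thus ?thesis
        using True act_closed[OF a True] finite_Y by (simp add: perm_op_def sum.delta)
    qed (simp add: tensor_power_map_def perm_op_def)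
  qed
  have "centralizer_ring G K k = commutant"
    unfolding centralizer_ring_def commutant_def Let_def linear_endos_def V[symmetric]
    using perm_op by (auto simp: conj_assoc)
  moreover have "fixed_points g = coset_fixed_points G K g ^ k" for g
  proof -
    have "{s \<in> tuples ?X k. ?act g s = s} = {s. set s \<subseteq> {C\<in>?X. C #> g = C} \<and> length s = k}"
      unfolding tuples_def by (auto simp: map_idI subset_iff list_eq_iff_nth_eq in_set_conv_nth)
    thus ?thesis
      using finX by (simp add: fixed_points_def coset_fixed_points_def card_lists_length_eq)
  qed
  hence mult: "multiplicity p = (\<Sum>g\<in>carrier G. \<chi> p (inv g) * of_nat (coset_fixed_points G K g) ^ k) / n" for p
    by (simp add: multiplicity_def)
  have "\<exists>m. of_nat m = multiplicity p" if "p < N" for p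
    using multiplicity_basis_exists[OF that] by (auto simp: multiplicity_basis_def)
  then obtain m where "\<And>p. p < N \<Longrightarrow> of_nat (m p) = multiplicity p" by metis
  ultimately show thesis using that[of m] commutant_iso mult by simp
qed

end

section \<open>The elements of the reflection group\<close>

definition m2 :: "'a \<Rightarrow> 'a \<Rightarrow> 'a \<Rightarrow> 'a \<Rightarrow> 'a mat" where
  "m2 a b c d = mat 2 2 (\<lambda>(i, j). if i = 0 then if j = 0 then a else b else if j = 0 then c else d)"

lemma m2_simps [simp]:
  "m2 a b c d \<in> carrier_mat 2 2"
  "m2 a b c d $$ (0, 0) = a" "m2 a b c d $$ (0, Suc 0) = b"
  "m2 a b c d $$ (Suc 0, 0) = c" "m2 a b c d $$ (Suc 0, Suc 0) = d"
  "dim_row (m2 a b c d) = 2" "dim_col (m2 a b c d) = 2"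
  by (auto simp: m2_def)

lemma m2_eq_iff: "m2 a b c d = m2 a' b' c' d' \<longleftrightarrow> a = a' \<and> b = b' \<and> c = c' \<and> d = d'"
  by (metis m2_simps(2-5))

lemma m2_mult:
  fixes a :: complex
  shows "m2 a b c d * m2 a' b' c' d' =
    m2 (a * a' + b * c') (a * b' + b * d') (c * a' + d * c') (c * b' + d * d')"
  by (rule mat2_eqI) (auto simp: scalar_prod_def numeral_2_eq_2)

lemma one_mat_eq_m2: "1\<^sub>m 2 = m2 (1::complex) 0 0 1"
  by (rule mat2_eqI) auto

definition half_unit :: complex  (\<open>\<omega>\<close>) where
  "\<omega> = (1 + \<i>) / 2"

lemma T_mat_eq: "T_mat = m2 \<omega> \<omega> \<omega> (- \<omega>)"
  unfolding T_mat_def mat_of_rows_list_def half_unit_def by (rule mat2_eqI) auto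

lemma D_mat_eq: "D_mat = m2 1 0 0 \<i>"
  unfolding D_mat_def mat_of_rows_list_def by (rule mat2_eqI) auto

definition quarter_units :: "complex set" where
  "quarter_units = {1, \<i>, -1, -\<i>}"

lemma quarter_units_closed:
  assumes "a \<in> quarter_units" "b \<in> quarter_units"
  shows "a * b \<in> quarter_units" "- a \<in> quarter_units" "a ^ k \<in> quarter_units" "cnj a \<in> quarter_units"
proof -
  have mult: "a * b \<in> quarter_units" if "a \<in> quarter_units" "b \<in> quarter_units" for a b
    using that by (auto simp: quarter_units_def)
  show "- a \<in> quarter_units" "cnj a \<in> quarter_units"
    using assms by (auto simp: quarter_units_def)
  show "a * b \<in> quarter_units" using assms by (rule mult)
  show "a ^ k \<in> quarter_units"
    by (induction k) (simp_all add: mult assms, simp add: quarter_units_def)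
qed

lemma quarter_units_mem [simp]:
  "1 \<in> quarter_units" "\<i> \<in> quarter_units" "- 1 \<in> quarter_units" "- \<i> \<in> quarter_units"
  by (auto simp: quarter_units_def)

lemma quarter_units_power4: "a \<in> quarter_units \<Longrightarrow> a ^ 4 = 1"
  by (auto simp: quarter_units_def)

lemma quarter_units_cnj: "a \<in> quarter_units \<Longrightarrow> cnj a = a ^ 3"
  by (auto simp: quarter_units_def power3_eq_cube)

lemma half_unit_power:
  "\<omega> ^ 2 = \<i> / 2" "\<omega> ^ 4 = - 1 / 4"
proof -
  show 2: "\<omega> ^ 2 = \<i> / 2" by (simp add: half_unit_def power2_eq_square complex_eq_iff)
  have "\<omega> ^ 4 = (\<omega> ^ 2) ^ 2" by simp
  thus "\<omega> ^ 4 = - 1 / 4" unfolding 2 by (simp add: power2_eq_square complex_eq_iff)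
qed

lemma half_unit_mult: "\<omega> * \<omega> = \<i> / 2" "\<omega> * (\<omega> * x) = \<i> / 2 * x"
  using half_unit_power(1) by (simp_all add: power2_eq_square mult.assoc[symmetric])

definition diag_elt :: "complex \<Rightarrow> complex \<Rightarrow> complex mat" where
  "diag_elt a b = m2 a 0 0 b"

definition anti_elt :: "complex \<Rightarrow> complex \<Rightarrow> complex mat" where
  "anti_elt a b = m2 0 a b 0"

text \<open>The last entry makes the rows orthogonal, since \<open>a\<^sup>3 = 1 / a\<close>.\<close>

definition full_elt :: "complex \<Rightarrow> complex \<Rightarrow> complex \<Rightarrow> complex mat" where
  "full_elt a b c = m2 (\<omega> * a) (\<omega> * b) (\<omega> * c) (- (\<omega> * (a ^ 3 * b * c)))"

text \<open>16 + 16 + 64 = 96 unitary matrices: the monomial ones with fourth roots of unity as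
  entries, and \<omega> times those all of whose entries are fourth roots of unity and whose rows
  are orthogonal.\<close>

definition H1_elements :: "complex mat set" where
  "H1_elements = {g. (\<exists>a\<in>quarter_units. \<exists>b\<in>quarter_units. g = diag_elt a b) \<or>
     (\<exists>a\<in>quarter_units. \<exists>b\<in>quarter_units. g = anti_elt a b) \<or>
     (\<exists>a\<in>quarter_units. \<exists>b\<in>quarter_units. \<exists>c\<in>quarter_units. g = full_elt a b c)}"

lemma H1_elementsI:
  "a \<in> quarter_units \<Longrightarrow> b \<in> quarter_units \<Longrightarrow> diag_elt a b \<in> H1_elements"
  "a \<in> quarter_units \<Longrightarrow> b \<in> quarter_units \<Longrightarrow> anti_elt a b \<in> H1_elements"
  "a \<in> quarter_units \<Longrightarrow> b \<in> quarter_units \<Longrightarrow> c \<in> quarter_units \<Longrightarrow> full_elt a b c \<in> H1_elements"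
  unfolding H1_elements_def by blast+

lemma H1_elements_cases:
  assumes "g \<in> H1_elements"
  obtains (diag) a b where "a \<in> quarter_units" "b \<in> quarter_units" "g = diag_elt a b"
    | (anti) a b where "a \<in> quarter_units" "b \<in> quarter_units" "g = anti_elt a b"
    | (full) a b c where "a \<in> quarter_units" "b \<in> quarter_units" "c \<in> quarter_units" "g = full_elt a b c"
  using assms unfolding H1_elements_def by blast

lemma H1_elements_eq:
  "H1_elements = (\<lambda>(a, b). diag_elt a b) ` (quarter_units \<times> quarter_units) \<union>
     (\<lambda>(a, b). anti_elt a b) ` (quarter_units \<times> quarter_units) \<union>
     (\<lambda>(a, b, c). full_elt a b c) ` (quarter_units \<times> quarter_units \<times> quarter_units)"
  (is "_ = ?R")
proof (intro equalityI subsetI)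
  fix g assume "g \<in> H1_elements"
  thus "g \<in> ?R"
  proof (cases rule: H1_elements_cases)
    case (diag a b)
    show ?thesis by (rule UnI1, rule UnI1, rule rev_image_eqI[of "(a, b)"]) (simp_all add: diag)
  next
    case (anti a b)
    show ?thesis by (rule UnI1, rule UnI2, rule rev_image_eqI[of "(a, b)"]) (simp_all add: anti)
  next
    case (full a b c)
    show ?thesis by (rule UnI2, rule rev_image_eqI[of "(a, b, c)"]) (simp_all add: full)
  qed
qed (auto intro: H1_elementsI)

lemma finite_quarter_units [simp]: "finite quarter_units"
  by (simp add: quarter_units_def)

lemma finite_H1_elements: "finite H1_elements"
  unfolding H1_elements_eq by (intro finite_UnI finite_imageI finite_cartesian_product finite_quarter_units)

lemma full_eltI:
  assumes "a \<in> quarter_units" "b \<in> quarter_units" "c \<in> quarter_units" "a * d = - (b * c)"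
  shows "m2 (\<omega> * a) (\<omega> * b) (\<omega> * c) (\<omega> * d) \<in> H1_elements"
proof -
  have "d = a ^ 4 * d" using quarter_units_power4[OF assms(1)] by simp
  also have "\<dots> = a ^ 3 * (a * d)" by (simp add: eval_nat_numeral)
  finally have "d = - (a ^ 3 * b * c)" by (simp add: assms(4))
  thus ?thesis using H1_elementsI(3)[OF assms(1-3)] by (simp add: full_elt_def)
qed

lemma H1_elements_mult_D:
  assumes "g \<in> H1_elements"
  shows "g * D_mat \<in> H1_elements"
  using assms
proof (cases rule: H1_elements_cases)
  case (diag a b)
  hence "g * D_mat = diag_elt a (b * \<i>)" by (simp add: diag_elt_def D_mat_eq m2_mult)
  thus ?thesis using diag by (simp add: H1_elementsI quarter_units_closed)
next
  case (anti a b)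
  hence "g * D_mat = anti_elt (a * \<i>) b" by (simp add: anti_elt_def D_mat_eq m2_mult)
  thus ?thesis using anti by (simp add: H1_elementsI quarter_units_closed)
next
  case (full a b c)
  hence "g * D_mat = full_elt a (b * \<i>) c" by (simp add: full_elt_def D_mat_eq m2_mult m2_eq_iff mult_ac)
  thus ?thesis using full by (simp add: H1_elementsI quarter_units_closed)
qed

text \<open>The entries of a product with T are sums and differences of two fourth roots of unity,
  so the form of the result depends only on their ratio.\<close>

lemma H1_elements_mult_T:
  assumes "g \<in> H1_elements"
  shows "g * T_mat \<in> H1_elements"
  using assms
proof (cases rule: H1_elements_cases)
  case (diag a b)
  hence "g * T_mat = m2 (\<omega> * a) (\<omega> * a) (\<omega> * b) (\<omega> * (- b))"
    by (simp add: diag_elt_def T_mat_eq m2_mult m2_eq_iff)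
  thus ?thesis using diag full_eltI[of a a b "- b"] by simp
next
  case (anti a b)
  hence "g * T_mat = m2 (\<omega> * a) (\<omega> * (- a)) (\<omega> * b) (\<omega> * b)"
    by (simp add: anti_elt_def T_mat_eq m2_mult m2_eq_iff)
  thus ?thesis using anti full_eltI[of a "- a" b b] by (simp add: quarter_units_closed)
next
  case (full a b c)
  \<comment> \<open>This is the ratio b / a, since a^3 is the inverse of a.\<close>
  define r where "r = a ^ 3 * b"
  have r: "r \<in> quarter_units" using full by (simp add: r_def quarter_units_closed)
  have "a * r = a ^ 4 * b" by (simp add: r_def eval_nat_numeral)
  hence b: "b = a * r" using quarter_units_power4[OF full(1)] by simp
  have "full_elt a b c * T_mat = m2 (\<omega> * (\<omega> * (a * (1 + r)))) (\<omega> * (\<omega> * (a * (1 - r))))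
      (\<omega> * (\<omega> * (c * (1 - r)))) (\<omega> * (\<omega> * (c * (1 + r))))"
    unfolding T_mat_eq full_elt_def m2_mult m2_eq_iff r_def[symmetric] unfolding b
    by (simp add: algebra_simps)
  hence eq: "g * T_mat = m2 (\<i> / 2 * (a * (1 + r))) (\<i> / 2 * (a * (1 - r)))
      (\<i> / 2 * (c * (1 - r))) (\<i> / 2 * (c * (1 + r)))"
    unfolding full(4) by (simp only: half_unit_mult)
  have w1: "\<i> / 2 * (x * (1 + \<i>)) = \<omega> * (\<i> * x)" "\<i> / 2 * (x * (1 - \<i>)) = \<omega> * x" for x
    by (simp_all add: half_unit_def algebra_simps add_divide_distrib diff_divide_distrib)
  have w2: "\<i> / 2 * (x * (1 + - \<i>)) = \<omega> * x" "\<i> / 2 * (x * (1 - - \<i>)) = \<omega> * (\<i> * x)" for x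
    by (simp_all add: half_unit_def algebra_simps add_divide_distrib diff_divide_distrib)
  \<comment> \<open>For r = 1 or -1 one of 1 + r and 1 - r vanishes and the product is monomial; for
    r = \<i> or -\<i> both are fourth roots of unity times 2 \<omega>, up to order, and the product
    is again full.\<close>
  consider "r = 1" | "r = -1" | "r = \<i>" | "r = -\<i>" using r by (auto simp: quarter_units_def)
  thus ?thesis
  proof cases
    case 1
    have "g * T_mat = diag_elt (\<i> * a) (\<i> * c)"
      unfolding eq diag_elt_def m2_eq_iff 1 by simp
    thus ?thesis using full by (simp add: H1_elementsI quarter_units_closed)
  next
    case 2
    have "g * T_mat = anti_elt (\<i> * a) (\<i> * c)"
      unfolding eq anti_elt_def m2_eq_iff 2 by simp
    thus ?thesis using full by (simp add: H1_elementsI quarter_units_closed)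
  next
    case 3
    have "g * T_mat = m2 (\<omega> * (\<i> * a)) (\<omega> * a) (\<omega> * c) (\<omega> * (\<i> * c))"
      unfolding eq 3 w1 by (rule refl)
    thus ?thesis using full full_eltI[of "\<i> * a" a c "\<i> * c"]
      by (simp add: quarter_units_closed mult_ac)
  next
    case 4
    have "g * T_mat = m2 (\<omega> * a) (\<omega> * (\<i> * a)) (\<omega> * (\<i> * c)) (\<omega> * c)"
      unfolding eq 4 w2 by (rule refl)
    thus ?thesis using full full_eltI[of a "\<i> * a" "\<i> * c" c]
      by (simp add: quarter_units_closed mult_ac)
  qed
qed

section \<open>The generated group is the explicit list of matrices\<close>

lemma group_GL2: "group GL2"
  unfolding GL2_def by (intro monoid.units_group ring.is_monoid ring_mat)

lemma mult_GL2 [simp]: "x \<otimes>\<^bsub>GL2\<^esub> y = x * y" and one_GL2 [simp]: "\<one>\<^bsub>GL2\<^esub> = 1\<^sub>m 2"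
  by (simp_all add: GL2_def units_of_def ring_mat_simps)

lemma mult_H1 [simp]: "x \<otimes>\<^bsub>H1\<^esub> y = x * y" and one_H1 [simp]: "\<one>\<^bsub>H1\<^esub> = m2 1 0 0 1"
  by (simp_all add: H1_def one_mat_eq_m2)

lemma carrier_H1_generate: "carrier H1 = generate GL2 {T_mat, D_mat}"
  using T_mat_D_mat_in_GL2 by (simp add: H1_def carrier_subgroup_generated)

interpretation H1: group H1 by (rule group_H1)

lemma TD_in_H1: "T_mat \<in> carrier H1" "D_mat \<in> carrier H1"
  by (auto simp: carrier_H1_generate intro: generate.incl)

text \<open>T T is the scalar \<i>, powers of D give the remaining diagonal matrices, and T D^2 T is
  \<i> times the coordinate swap. Every full element is a diagonal matrix times T times a power of
  D.\<close>

lemma H1_elements_subset: "H1_elements \<subseteq> carrier H1"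
proof -
  note mult = H1.m_closed[simplified]
  have scal: "m2 z 0 0 z \<in> carrier H1" if "z \<in> quarter_units" for z
  proof -
    have "m2 \<i> 0 0 \<i> = T_mat * T_mat"
      by (simp add: T_mat_eq m2_mult half_unit_mult)
    hence i: "m2 \<i> 0 0 \<i> \<in> carrier H1" using mult[OF TD_in_H1(1) TD_in_H1(1)] by simp
    have m: "m2 (-1) 0 0 (-1) \<in> carrier H1" using mult[OF i i] by (simp add: m2_mult)
    have "m2 (-\<i>) 0 0 (-\<i>) \<in> carrier H1" using mult[OF i m] by (simp add: m2_mult)
    with i m H1.one_closed that show ?thesis by (auto simp: quarter_units_def)
  qed
  have unipotent: "m2 1 0 0 z \<in> carrier H1" if "z \<in> quarter_units" for z
  proof -
    have i: "m2 1 0 0 \<i> \<in> carrier H1" using TD_in_H1(2) by (simp add: D_mat_eq)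
    have m: "m2 1 0 0 (-1) \<in> carrier H1" using mult[OF i i] by (simp add: m2_mult)
    have "m2 1 0 0 (-\<i>) \<in> carrier H1" using mult[OF i m] by (simp add: m2_mult)
    with i m H1.one_closed that show ?thesis by (auto simp: quarter_units_def)
  qed
  have cancel: "a * (a ^ 3 * b) = b" if "a \<in> quarter_units" for a b
    using quarter_units_power4[OF that] by (simp add: eval_nat_numeral mult.assoc[symmetric])
  have diag: "diag_elt a b \<in> carrier H1" if "a \<in> quarter_units" "b \<in> quarter_units" for a b
  proof -
    have "diag_elt a b = m2 a 0 0 a * m2 1 0 0 (a ^ 3 * b)"
      using that by (simp add: diag_elt_def m2_mult cancel)
    thus ?thesis using mult[OF scal unipotent] that by (simp add: quarter_units_closed)
  qed
  have "T_mat * m2 1 0 0 (-1) * T_mat = m2 0 \<i> \<i> 0"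
    by (simp add: T_mat_eq m2_mult half_unit_mult)
  hence X: "m2 0 \<i> \<i> 0 \<in> carrier H1"
    using mult[OF mult[OF TD_in_H1(1) unipotent[of "-1"]] TD_in_H1(1)] by simp
  have anti: "anti_elt a b \<in> carrier H1" if "a \<in> quarter_units" "b \<in> quarter_units" for a b
  proof -
    have "anti_elt a b = diag_elt (a * - \<i>) (b * - \<i>) * m2 0 \<i> \<i> 0"
      by (simp add: anti_elt_def diag_elt_def m2_mult mult.assoc)
    thus ?thesis using mult[OF diag X] that by (simp add: quarter_units_closed)
  qed
  have full: "full_elt a b c \<in> carrier H1"
    if "a \<in> quarter_units" "b \<in> quarter_units" "c \<in> quarter_units" for a b c
  proof -
    have "full_elt a b c = diag_elt a c * T_mat * m2 1 0 0 (a ^ 3 * b)"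
      using that cancel[of a 1]
      by (simp add: full_elt_def diag_elt_def T_mat_eq m2_mult m2_eq_iff cancel mult_ac)
    thus ?thesis using mult[OF mult[OF diag TD_in_H1(1)] unipotent] that
      by (simp add: quarter_units_closed)
  qed
  show ?thesis using diag anti full by (auto elim!: H1_elements_cases)
qed

text \<open>Stability under right multiplication passes from the generators to all words. For the
  inverse of a generator it comes from finiteness: an injective self-map of a finite set is onto, so
  each element of the list is a listed element times the generator.\<close>

lemma carrier_H1: "carrier H1 = H1_elements"
proof
  interpret GL2: group GL2 by (rule group_GL2)
  have gen: "generate GL2 {T_mat, D_mat} \<subseteq> carrier GL2"
    using T_mat_D_mat_in_GL2 by (intro GL2.generate_incl) auto
  have sub: "H1_elements \<subseteq> carrier GL2"
    using H1_elements_subset gen by (simp add: carrier_H1_generate)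
  have "\<forall>g\<in>H1_elements. g * x \<in> H1_elements" if "x \<in> generate GL2 {T_mat, D_mat}" for x
    using that
  proof (induction rule: generate.induct)
    case one
    thus ?case using sub by (auto simp: GL2.r_one[simplified])
  next
    case (incl h)
    thus ?case using H1_elements_mult_T H1_elements_mult_D by auto
  next
    case (inv h)
    show ?case
    proof
      fix g assume g: "g \<in> H1_elements"
      have h: "h \<in> carrier GL2" using inv T_mat_D_mat_in_GL2 by auto
      have "(\<lambda>g. g * h) ` H1_elements = H1_elements"
      proof (rule endo_inj_surj)
        show "inj_on (\<lambda>g. g * h) H1_elements"
          using h sub GL2.right_cancel[OF h] by (auto simp: inj_on_def subset_iff)
        show "(\<lambda>g. g * h) ` H1_elements \<subseteq> H1_elements"
          using inv H1_elements_mult_T H1_elements_mult_D by auto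
      qed (simp add: finite_H1_elements)
      then obtain g' where g': "g' \<in> H1_elements" "g = g' * h" using g by blast
      hence "g * inv\<^bsub>GL2\<^esub> h = g' * (h * inv\<^bsub>GL2\<^esub> h)"
        using h sub GL2.m_assoc[of g' h "inv\<^bsub>GL2\<^esub> h"] by auto
      also have "\<dots> = g'"
        using h sub g' GL2.r_inv[OF h] GL2.r_one[of g'] by auto
      finally show "g * inv\<^bsub>GL2\<^esub> h \<in> H1_elements" using g' by simp
    qed
  next
    case (eng h1 h2)
    have "g * (h1 * h2) = g * h1 * h2" if "g \<in> H1_elements" for g
      using GL2.m_assoc[of g h1 h2] subsetD[OF gen eng.hyps(1)] subsetD[OF gen eng.hyps(2)]
        subsetD[OF sub that] by simp
    thus ?case using eng.IH by simp
  qed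
  note stable = this
  have one: "1\<^sub>m 2 \<in> H1_elements"
    using H1_elementsI(1)[of 1 1] by (simp add: diag_elt_def one_mat_eq_m2)
  show "carrier H1 \<subseteq> H1_elements"
  proof
    fix x assume x: "x \<in> carrier H1"
    hence "1\<^sub>m 2 * x \<in> H1_elements" using stable one by (simp add: carrier_H1_generate)
    thus "x \<in> H1_elements" using x gen GL2.l_one[of x] by (auto simp: carrier_H1_generate)
  qed
qed (rule H1_elements_subset)

section \<open>The irreducible representations of the reflection group\<close>

lemma sum_lessThan_2: "(\<Sum>l<2::nat. f l) = f 0 + f (Suc 0)"
  by (simp add: numeral_2_eq_2)

definition tr2 :: "complex mat \<Rightarrow> complex" where
  "tr2 g = g $$ (0, 0) + g $$ (Suc 0, Suc 0)"

definition det2 :: "complex mat \<Rightarrow> complex" where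
  "det2 g = g $$ (0, 0) * g $$ (Suc 0, Suc 0) - g $$ (0, Suc 0) * g $$ (Suc 0, 0)"

text \<open>The second symmetric power of the natural representation: if \<open>v' = g v\<close>, then this matrix
  takes \<open>(v\<^sub>0\<^sup>2, v\<^sub>0 v\<^sub>1, v\<^sub>1\<^sup>2)\<close> to \<open>(v'\<^sub>0\<^sup>2, v'\<^sub>0 v'\<^sub>1, v'\<^sub>1\<^sup>2)\<close>.\<close>

definition sym2_rep :: "complex mat \<Rightarrow> nat \<Rightarrow> nat \<Rightarrow> complex" where
  "sym2_rep g i j = (let a = g $$ (0, 0); b = g $$ (0, Suc 0); c = g $$ (Suc 0, 0); d = g $$ (Suc 0, Suc 0)
     in [[a ^ 2, 2 * a * b, b ^ 2], [a * c, a * d + b * c, b * d], [c ^ 2, 2 * c * d, d ^ 2]] ! i ! j)"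

text \<open>The same construction for the quartic forms \<open>(v\<^sub>0\<^sup>4 + v\<^sub>1\<^sup>4, v\<^sub>0\<^sup>2 v\<^sub>1\<^sup>2)\<close>, whose span is invariant under
  \<open>H1\<close> (but not under all of \<open>GL2\<close>).\<close>

definition quartic_rep :: "complex mat \<Rightarrow> nat \<Rightarrow> nat \<Rightarrow> complex" where
  "quartic_rep g i j = (let a = g $$ (0, 0); b = g $$ (0, Suc 0); c = g $$ (Suc 0, 0); d = g $$ (Suc 0, Suc 0)
     in [[a ^ 4 + c ^ 4, 6 * (a ^ 2 * b ^ 2 + c ^ 2 * d ^ 2)],
         [a ^ 2 * c ^ 2, a ^ 2 * d ^ 2 + 4 * a * b * c * d + b ^ 2 * c ^ 2]] ! i ! j)"

text \<open>On \<open>H1\<close> the trace and the determinant determine this value; it is carried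
  as a third invariant so that every irreducible character is a polynomial in the three.\<close>

definition quartic_tr :: "complex mat \<Rightarrow> complex" where
  "quartic_tr g = quartic_rep g 0 0 + quartic_rep g 1 1"

text \<open>The first six identities say that substitution maps the span of x^4 + y^4 and x^2 y^2 to
  itself: the coefficients of x^3 y and x y^3 vanish, and those of x^4 and y^4 agree. The last one
  makes the quartic trace compatible with transposition.\<close>

lemma H1_quartic_invariants:
  assumes "g \<in> carrier H1"
  obtains a b c d where "g = m2 a b c d"
    and "b ^ 4 + d ^ 4 = a ^ 4 + c ^ 4" "a ^ 3 * b + c ^ 3 * d = 0" "a * b ^ 3 + c * d ^ 3 = 0"
    and "b ^ 2 * d ^ 2 = a ^ 2 * c ^ 2" "a * c * (a * d + b * c) = 0" "b * d * (a * d + b * c) = 0"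
    and "b ^ 4 = c ^ 4"
proof -
  from assms have "g \<in> H1_elements" by (simp add: carrier_H1)
  thus thesis
  proof (cases rule: H1_elements_cases)
    case (diag a b)
    show thesis using diag by (intro that[of a 0 0 b]) (auto simp: diag_elt_def quarter_units_power4)
  next
    case (anti a b)
    show thesis using anti by (intro that[of 0 a b 0]) (auto simp: anti_elt_def quarter_units_power4)
  next
    case (full a b c)
    define d where "d = - (a ^ 3 * b * c)"
    have p4: "a ^ 4 = 1" "b ^ 4 = 1" "c ^ 4 = 1" using full by (auto simp: quarter_units_power4)
    have "a * d = - (a ^ 4 * b * c)" by (simp add: d_def eval_nat_numeral)
    hence ad: "a * d = - (b * c)" using p4 by simp
    have "d ^ 4 = (a ^ 4) ^ 3 * b ^ 4 * c ^ 4" by (simp add: d_def power_mult_distrib flip: power_mult)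
    hence d4: "d ^ 4 = 1" using p4 by simp
    have sq: "a ^ 2 * d ^ 2 = b ^ 2 * c ^ 2" using arg_cong[OF ad, of "\<lambda>x. x ^ 2"] by (simp add: power_mult_distrib)
    have bd: "b ^ 2 * d ^ 2 = a ^ 2 * c ^ 2"
    proof -
      have "b ^ 2 * d ^ 2 = a ^ 4 * (b ^ 2 * d ^ 2)" using p4 by simp
      also have "\<dots> = a ^ 2 * b ^ 2 * (a ^ 2 * d ^ 2)" by (simp add: eval_nat_numeral)
      also have "\<dots> = a ^ 2 * b ^ 4 * c ^ 2" unfolding sq by (simp add: eval_nat_numeral)
      finally show ?thesis using p4 by simp
    qed
    \<comment> \<open>Multiplying by the unit a lets \<open>ad\<close> eliminate d; afterwards a is
      cancelled.\<close>
    have "a * (a ^ 3 * b + c ^ 3 * d) = a ^ 4 * b - c ^ 4 * b"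
      using arg_cong[OF ad, of "\<lambda>x. c ^ 3 * x"] by (simp add: algebra_simps eval_nat_numeral)
    hence 1: "a ^ 3 * b + c ^ 3 * d = 0" using p4 by auto
    have "d * (a * b ^ 3 + c * d ^ 3) = - (b ^ 4 * c) + c * d ^ 4"
      using arg_cong[OF ad, of "\<lambda>x. b ^ 3 * x"] by (simp add: algebra_simps eval_nat_numeral)
    hence 2: "a * b ^ 3 + c * d ^ 3 = 0" using p4 d4 by auto
    have m: "(\<omega> * x) ^ k = \<omega> ^ k * x ^ k" for x k by (rule power_mult_distrib)
    show thesis
    proof (rule that[of "\<omega> * a" "\<omega> * b" "\<omega> * c" "\<omega> * d"])
      show "g = m2 (\<omega> * a) (\<omega> * b) (\<omega> * c) (\<omega> * d)" using full by (simp add: full_elt_def d_def)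
      have "(\<omega> * a) ^ 3 * (\<omega> * b) + (\<omega> * c) ^ 3 * (\<omega> * d) = \<omega> ^ 4 * (a ^ 3 * b + c ^ 3 * d)"
        by (simp add: m algebra_simps eval_nat_numeral)
      thus "(\<omega> * a) ^ 3 * (\<omega> * b) + (\<omega> * c) ^ 3 * (\<omega> * d) = 0" unfolding 1 by simp
      have "(\<omega> * a) * (\<omega> * b) ^ 3 + (\<omega> * c) * (\<omega> * d) ^ 3 = \<omega> ^ 4 * (a * b ^ 3 + c * d ^ 3)"
        by (simp add: m algebra_simps eval_nat_numeral)
      thus "(\<omega> * a) * (\<omega> * b) ^ 3 + (\<omega> * c) * (\<omega> * d) ^ 3 = 0" unfolding 2 by simp
      have "(\<omega> * b) ^ 2 * (\<omega> * d) ^ 2 = \<omega> ^ 4 * (b ^ 2 * d ^ 2)"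
        "(\<omega> * a) ^ 2 * (\<omega> * c) ^ 2 = \<omega> ^ 4 * (a ^ 2 * c ^ 2)"
        by (simp_all add: m eval_nat_numeral)
      thus "(\<omega> * b) ^ 2 * (\<omega> * d) ^ 2 = (\<omega> * a) ^ 2 * (\<omega> * c) ^ 2" unfolding bd by simp
      have "\<omega> * a * (\<omega> * d) + \<omega> * b * (\<omega> * c) = \<omega> ^ 2 * (a * d + b * c)"
        by (simp add: algebra_simps eval_nat_numeral)
      hence "\<omega> * a * (\<omega> * d) + \<omega> * b * (\<omega> * c) = 0" unfolding ad by simp
      thus "\<omega> * a * (\<omega> * c) * (\<omega> * a * (\<omega> * d) + \<omega> * b * (\<omega> * c)) = 0"
        "\<omega> * b * (\<omega> * d) * (\<omega> * a * (\<omega> * d) + \<omega> * b * (\<omega> * c)) = 0" by simp_all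
    qed (simp_all add: m p4 d4 sq)
  qed
qed

section \<open>The building blocks as representations\<close>

lemma H1_mult_index:
  assumes "g \<in> carrier H1" "h \<in> carrier H1"
  shows "(g * h) $$ (0, 0) = g $$ (0, 0) * h $$ (0, 0) + g $$ (0, Suc 0) * h $$ (Suc 0, 0)"
    "(g * h) $$ (0, Suc 0) = g $$ (0, 0) * h $$ (0, Suc 0) + g $$ (0, Suc 0) * h $$ (Suc 0, Suc 0)"
    "(g * h) $$ (Suc 0, 0) = g $$ (Suc 0, 0) * h $$ (0, 0) + g $$ (Suc 0, Suc 0) * h $$ (Suc 0, 0)"
    "(g * h) $$ (Suc 0, Suc 0) = g $$ (Suc 0, 0) * h $$ (0, Suc 0) + g $$ (Suc 0, Suc 0) * h $$ (Suc 0, Suc 0)"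
proof -
  obtain a b c d where "g = m2 a b c d" by (rule H1_quartic_invariants[OF assms(1)])
  moreover obtain a' b' c' d' where "h = m2 a' b' c' d'" by (rule H1_quartic_invariants[OF assms(2)])
  ultimately show "(g * h) $$ (0, 0) = g $$ (0, 0) * h $$ (0, 0) + g $$ (0, Suc 0) * h $$ (Suc 0, 0)"
    "(g * h) $$ (0, Suc 0) = g $$ (0, 0) * h $$ (0, Suc 0) + g $$ (0, Suc 0) * h $$ (Suc 0, Suc 0)"
    "(g * h) $$ (Suc 0, 0) = g $$ (Suc 0, 0) * h $$ (0, 0) + g $$ (Suc 0, Suc 0) * h $$ (Suc 0, 0)"
    "(g * h) $$ (Suc 0, Suc 0) = g $$ (Suc 0, 0) * h $$ (0, Suc 0) + g $$ (Suc 0, Suc 0) * h $$ (Suc 0, Suc 0)"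
    by (simp_all add: m2_mult)
qed

text \<open>Each entry is first expanded for arbitrary matrices. The terms that would leave the span
  carry factors depending on g alone, and \<open>H1_quartic_invariants\<close> kills these; the
  remaining terms are the matrix product.\<close>

lemma matrix_rep_quartic: "matrix_rep H1 2 quartic_rep"
proof -
  have "quartic_rep (g * h) i j = (\<Sum>l<2. quartic_rep g i l * quartic_rep h l j)"
    if gh: "g \<in> carrier H1" "h \<in> carrier H1" and ij: "i < 2" "j < 2" for g h i j
  proof -
    obtain a b c d where g: "g = m2 a b c d"
      and F: "b ^ 4 + d ^ 4 = a ^ 4 + c ^ 4" and B: "a ^ 3 * b + c ^ 3 * d = 0"
      and E: "a * b ^ 3 + c * d ^ 3 = 0" and X: "b ^ 2 * d ^ 2 = a ^ 2 * c ^ 2"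
      and Y: "a * c * (a * d + b * c) = 0" "b * d * (a * d + b * c) = 0"
      and "b ^ 4 = c ^ 4"
      by (rule H1_quartic_invariants[OF gh(1)]) (rule that)
    obtain p q r s where h: "h = m2 p q r s"
      by (rule H1_quartic_invariants[OF gh(2)])
    have 00: "(a*p+b*r)^4 + (c*p+d*r)^4 =
        (a^4+c^4) * (p^4 + r^4) + 6 * (a^2*b^2+c^2*d^2) * (p^2*r^2)"
    proof -
      have "(a*p+b*r)^4 + (c*p+d*r)^4 = (a^4+c^4) * p^4 + 4 * (a^3*b+c^3*d) * p^3*r
          + 6 * (a^2*b^2+c^2*d^2) * (p^2*r^2) + 4 * (a*b^3+c*d^3) * p*r^3 + (b^4+d^4) * r^4"
        by (simp add: power4_eq_xxxx power3_eq_cube power2_eq_square algebra_simps)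
      thus ?thesis unfolding F B E by (simp add: algebra_simps)
    qed
    have 01: "6 * ((a*p+b*r)^2 * (a*q+b*s)^2 + (c*p+d*r)^2 * (c*q+d*s)^2) =
        (a^4+c^4) * (6 * (p^2*q^2 + r^2*s^2)) + 6 * (a^2*b^2+c^2*d^2) * (p^2*s^2 + 4*p*q*r*s + q^2*r^2)"
    proof -
      have "6 * ((a*p+b*r)^2 * (a*q+b*s)^2 + (c*p+d*r)^2 * (c*q+d*s)^2) =
          (a^4+c^4) * (6*p^2*q^2) + (a^3*b+c^3*d) * (12*p*q*(p*s+q*r))
          + 6 * (a^2*b^2+c^2*d^2) * (p^2*s^2 + 4*p*q*r*s + q^2*r^2)
          + (a*b^3+c*d^3) * (12*r*s*(p*s+q*r)) + (b^4+d^4) * (6*r^2*s^2)"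
        by (simp add: power4_eq_xxxx power3_eq_cube power2_eq_square algebra_simps)
      thus ?thesis unfolding F B E by (simp add: algebra_simps)
    qed
    have 10: "(a*p+b*r)^2 * (c*p+d*r)^2 =
        a^2*c^2 * (p^4 + r^4) + (a^2*d^2 + 4*a*b*c*d + b^2*c^2) * (p^2*r^2)"
    proof -
      have "(a*p+b*r)^2 * (c*p+d*r)^2 = a^2*c^2 * p^4 + (a*c*(a*d+b*c)) * (2*p^3*r)
          + (a^2*d^2 + 4*a*b*c*d + b^2*c^2) * (p^2*r^2) + (b*d*(a*d+b*c)) * (2*p*r^3) + (b^2*d^2) * r^4"
        by (simp add: power4_eq_xxxx power3_eq_cube power2_eq_square algebra_simps)
      thus ?thesis unfolding X Y by (simp add: algebra_simps)
    qed
    have 11: "(a*p+b*r)^2 * (c*q+d*s)^2 + 4 * (a*p+b*r) * (a*q+b*s) * (c*p+d*r) * (c*q+d*s)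
          + (a*q+b*s)^2 * (c*p+d*r)^2 =
        a^2*c^2 * (6 * (p^2*q^2 + r^2*s^2)) +
        (a^2*d^2 + 4*a*b*c*d + b^2*c^2) * (p^2*s^2 + 4*p*q*r*s + q^2*r^2)"
    proof -
      have "(a*p+b*r)^2 * (c*q+d*s)^2 + 4 * (a*p+b*r) * (a*q+b*s) * (c*p+d*r) * (c*q+d*s)
          + (a*q+b*s)^2 * (c*p+d*r)^2 =
        a^2*c^2 * (6*p^2*q^2) + (a*c*(a*d+b*c)) * (6*p*q*(p*s+q*r))
        + (a^2*d^2 + 4*a*b*c*d + b^2*c^2) * (p^2*s^2 + 4*p*q*r*s + q^2*r^2)
        + (b*d*(a*d+b*c)) * (6*r*s*(p*s+q*r)) + (b^2*d^2) * (6*r^2*s^2)"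
        by (simp add: power4_eq_xxxx power3_eq_cube power2_eq_square algebra_simps)
      thus ?thesis unfolding X Y by (simp add: algebra_simps)
    qed
    have "(i = 0 \<or> i = 1) \<and> (j = 0 \<or> j = 1)" using ij by auto
    thus ?thesis
      using 00 01 10 11
      by (elim conjE disjE) (simp_all add: quartic_rep_def g h m2_mult sum_lessThan_2)
  qed
  moreover have "quartic_rep (m2 1 0 0 1) i j = (if i = j then 1 else 0)" if "i < 2" "j < 2" for i j
    using that by (auto simp: quartic_rep_def less_2_cases_iff)
  ultimately show ?thesis by (simp add: matrix_rep_def)
qed

lemma matrix_rep_sym2: "matrix_rep H1 3 sym2_rep"
proof -
  have "sym2_rep (g * h) i j = (\<Sum>l<3. sym2_rep g i l * sym2_rep h l j)"
    if gh: "g \<in> carrier H1" "h \<in> carrier H1" and "i < 3" "j < 3" for g h i j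
  proof -
    have "i = 0 \<or> i = 1 \<or> i = 2" "j = 0 \<or> j = 1 \<or> j = 2" using that by auto
    thus ?thesis
      by (elim disjE) (simp_all add: sym2_rep_def H1_mult_index[OF gh] numeral_3_eq_3 lessThan_Suc Let_def,
          simp_all add: algebra_simps power2_eq_square)
  qed
  moreover have "sym2_rep (m2 1 0 0 1) i j = (if i = j then 1 else 0)" if "i < 3" "j < 3" for i j
  proof -
    have "i = 0 \<or> i = 1 \<or> i = 2" "j = 0 \<or> j = 1 \<or> j = 2" using that by auto
    thus ?thesis by (elim disjE) (simp_all add: sym2_rep_def)
  qed
  ultimately show ?thesis by (simp add: matrix_rep_def)
qed

lemma matrix_rep_natural: "matrix_rep H1 2 (\<lambda>g i j. g $$ (i, j))"
proof -
  have "(g * h) $$ (i, j) = (\<Sum>l<2. g $$ (i, l) * h $$ (l, j))"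
    if "g \<in> carrier H1" "h \<in> carrier H1" "i < 2" "j < 2" for g h i j
  proof -
    have "(i = 0 \<or> i = 1) \<and> (j = 0 \<or> j = 1)" using that by auto
    thus ?thesis
      by (elim conjE disjE) (simp_all add: H1_mult_index[OF that(1,2)] sum_lessThan_2)
  qed
  moreover have "m2 1 0 0 1 $$ (i, j) = (if i = j then 1 else (0 :: complex))" if "i < 2" "j < 2" for i j
    using that by (auto simp: less_2_cases_iff)
  ultimately show ?thesis by (simp add: matrix_rep_def)
qed

text \<open>An index below 4 encodes a pair of indices below 2 by quotient and remainder, as in the
  Kronecker product.\<close>

lemma matrix_rep_tensor2:
  assumes "matrix_rep G 2 \<rho>" "matrix_rep G 2 \<sigma>"
  shows "matrix_rep G 4 (\<lambda>g i j. \<rho> g (i div 2) (j div 2) * \<sigma> g (i mod 2) (j mod 2))"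
proof -
  have 4: "(\<Sum>l<4. f (l div 2) (l mod 2)) = (\<Sum>k<2. \<Sum>l<2. f k l)" for f :: "nat \<Rightarrow> nat \<Rightarrow> complex"
  proof -
    have "{..<4::nat} = {0, 1, 2, 3}" "{..<2::nat} = {0, 1}" by auto
    thus ?thesis by (simp add: add.assoc)
  qed
  have "i div 2 = j div 2 \<and> i mod 2 = j mod 2 \<longleftrightarrow> i = j" for i j :: nat
    by (metis div_mod_decomp)
  thus ?thesis
    using assms 4[of "\<lambda>k l. \<rho> _ _ k * \<sigma> _ _ l * (\<rho> _ k _ * \<sigma> _ l _)"]
    by (auto simp: matrix_rep_def sum_product less_mult_imp_div_less mult_ac)
qed

lemma matrix_rep_twist:
  assumes "matrix_rep G d \<rho>" and "f \<one>\<^bsub>G\<^esub> = 1"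
    and "\<And>g h. g \<in> carrier G \<Longrightarrow> h \<in> carrier G \<Longrightarrow> f (g \<otimes>\<^bsub>G\<^esub> h) = f g * f h"
  shows "matrix_rep G d (\<lambda>g i j. f g ^ e * \<rho> g i j)"
  using assms by (auto simp: matrix_rep_def power_mult_distrib sum_distrib_left mult_ac)

lemma det2_mult:
  assumes "g \<in> carrier H1" "h \<in> carrier H1"
  shows "det2 (g * h) = det2 g * det2 h"
  by (simp add: det2_def H1_mult_index[OF assms] algebra_simps)

section \<open>The character table\<close>

text \<open>One entry \<open>(k, t, \<delta>, w)\<close> for each of the 16 conjugacy classes: its cardinality and the values of
  \<^const>\<open>tr2\<close>, \<^const>\<open>det2\<close> and \<^const>\<open>quartic_tr\<close> on it. The first class is that of the identity.\<close>

definition H1_classes :: "(complex \<times> complex \<times> complex \<times> complex) list" where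
  "H1_classes =
    [(1, Complex 2 0, Complex 1 0, Complex 2 0),
     (1, Complex (-2) 0, Complex 1 0, Complex 2 0),
     (6, Complex (-1) (-1), Complex 0 1, Complex 0 0),
     (8, Complex (-1) 0, Complex 1 0, Complex (-1) 0),
     (6, Complex (-1) 1, Complex 0 (-1), Complex 0 0),
     (1, Complex 0 (-2), Complex (-1) 0, Complex 2 0),
     (8, Complex 0 (-1), Complex (-1) 0, Complex (-1) 0),
     (6, Complex 0 0, Complex (-1) 0, Complex 2 0),
     (12, Complex 0 0, Complex 0 (-1), Complex 0 0),
     (12, Complex 0 0, Complex 0 1, Complex 0 0),
     (6, Complex 0 0, Complex 1 0, Complex 2 0),
     (8, Complex 0 1, Complex (-1) 0, Complex (-1) 0),
     (1, Complex 0 2, Complex (-1) 0, Complex 2 0),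
     (6, Complex 1 (-1), Complex 0 (-1), Complex 0 0),
     (8, Complex 1 0, Complex 1 0, Complex (-1) 0),
     (6, Complex 1 1, Complex 0 1, Complex 0 0)]"

lemma sum_quarter_units: "(\<Sum>a\<in>quarter_units. f a) = f 1 + f \<i> + f (- 1) + f (- \<i>)"
  by (simp add: quarter_units_def complex_eq_iff add.assoc)

lemma half_unit_nonzero: "\<omega> \<noteq> 0"
  by (simp add: half_unit_def complex_eq_iff)

text \<open>The pattern of zero entries separates the three families, and within each family the
  entries recover the parameters.\<close>

lemma sum_H1_elements:
  "(\<Sum>g\<in>carrier H1. f g) =
     (\<Sum>a\<in>quarter_units. \<Sum>b\<in>quarter_units. f (diag_elt a b)) +
     (\<Sum>a\<in>quarter_units. \<Sum>b\<in>quarter_units. f (anti_elt a b)) +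
     (\<Sum>a\<in>quarter_units. \<Sum>b\<in>quarter_units. \<Sum>c\<in>quarter_units. f (full_elt a b c))"
proof -
  have nz: "a \<noteq> 0" if "a \<in> quarter_units" for a using that by (auto simp: quarter_units_def)
  have inj: "inj_on (\<lambda>(a, b). diag_elt a b) (quarter_units \<times> quarter_units)"
    "inj_on (\<lambda>(a, b). anti_elt a b) (quarter_units \<times> quarter_units)"
    "inj_on (\<lambda>(a, b, c). full_elt a b c) (quarter_units \<times> quarter_units \<times> quarter_units)"
    by (auto simp: inj_on_def diag_elt_def anti_elt_def full_elt_def m2_eq_iff half_unit_nonzero)
  let ?D = "(\<lambda>(a, b). diag_elt a b) ` (quarter_units \<times> quarter_units)"
  let ?A = "(\<lambda>(a, b). anti_elt a b) ` (quarter_units \<times> quarter_units)"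
  let ?F = "(\<lambda>(a, b, c). full_elt a b c) ` (quarter_units \<times> quarter_units \<times> quarter_units)"
  have disj: "?D \<inter> ?A = {}" "(?D \<union> ?A) \<inter> ?F = {}"
    by (auto simp: diag_elt_def anti_elt_def full_elt_def m2_eq_iff half_unit_nonzero nz)
  have fin: "finite ?D" "finite ?A" "finite (?D \<union> ?A)" "finite ?F"
    by (intro finite_UnI finite_imageI finite_cartesian_product finite_quarter_units)+
  have "(\<Sum>g\<in>carrier H1. f g) = sum f ?D + sum f ?A + sum f ?F"
    unfolding carrier_H1 H1_elements_eq
      sum.union_disjoint[OF fin(3,4) disj(2)] sum.union_disjoint[OF fin(1,2) disj(1)] by (rule refl)
  thus ?thesis
    unfolding sum.reindex[OF inj(1)] sum.reindex[OF inj(2)] sum.reindex[OF inj(3)]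
    by (simp add: sum.cartesian_product case_prod_beta comp_def)
qed

lemma invariants_diag:
  assumes "a \<in> quarter_units" "b \<in> quarter_units"
  shows "tr2 (diag_elt a b) = a + b" "det2 (diag_elt a b) = a * b"
    "quartic_tr (diag_elt a b) = 1 + a * a * b * b"
  using assms by (simp_all add: diag_elt_def tr2_def det2_def quartic_tr_def quartic_rep_def
      quarter_units_power4 power2_eq_square)

lemma invariants_anti:
  assumes "a \<in> quarter_units" "b \<in> quarter_units"
  shows "tr2 (anti_elt a b) = 0" "det2 (anti_elt a b) = - (a * b)"
    "quartic_tr (anti_elt a b) = 1 + a * a * b * b"
  using assms by (simp_all add: anti_elt_def tr2_def det2_def quartic_tr_def quartic_rep_def
      quarter_units_power4 power2_eq_square)

lemma invariants_full:
  assumes "a \<in> quarter_units" "b \<in> quarter_units" "c \<in> quarter_units"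
  shows "tr2 (full_elt a b c) = \<omega> * (a - a * a * a * (b * c))"
    "det2 (full_elt a b c) = - (\<i> * (b * c))"
    "quartic_tr (full_elt a b c) = (b * c * (b * c) - 1) / 2"
proof -
  define d where "d = - (a ^ 3 * b * c)"
  have p4: "a ^ 4 = 1" "b ^ 4 = 1" "c ^ 4 = 1" using assms by (auto simp: quarter_units_power4)
  have "a * d = - (a ^ 4 * b * c)" by (simp add: d_def eval_nat_numeral)
  hence ad: "a * d = - (b * c)" using p4 by simp
  have g: "full_elt a b c = m2 (\<omega> * a) (\<omega> * b) (\<omega> * c) (\<omega> * d)"
    by (simp add: full_elt_def d_def)
  show "tr2 (full_elt a b c) = \<omega> * (a - a * a * a * (b * c))"
    by (simp add: tr2_def full_elt_def power3_eq_cube algebra_simps)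
  have "det2 (full_elt a b c) = \<omega> ^ 2 * (a * d - b * c)"
    by (simp add: g det2_def power2_eq_square algebra_simps)
  thus "det2 (full_elt a b c) = - (\<i> * (b * c))" by (simp add: ad half_unit_power)
  have "quartic_tr (full_elt a b c)
      = \<omega> ^ 4 * (a ^ 4 + c ^ 4 + (a * d) ^ 2 + 4 * (a * d) * (b * c) + (b * c) ^ 2)"
    by (simp add: g quartic_tr_def quartic_rep_def eval_nat_numeral algebra_simps)
  also have "\<dots> = - 1 / 4 * (1 + 1 + (- (b * c)) ^ 2 + 4 * (- (b * c)) * (b * c) + (b * c) ^ 2)"
    unfolding ad p4 half_unit_power by (rule refl)
  also have "\<dots> = (b * c * (b * c) - 1) / 2"
    by (simp add: field_simps power2_eq_square)
  finally show "quartic_tr (full_elt a b c) = (b * c * (b * c) - 1) / 2" .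
qed

text \<open>With every constant in the form \<open>Complex x y\<close>, arithmetic and equality
  tests on the character table reduce to real numerals.\<close>

lemma complex_numerals:
  "(0 :: complex) = Complex 0 0" "(1 :: complex) = Complex 1 0" "\<i> = Complex 0 1"
  "(numeral n :: complex) = Complex (numeral n) 0"
  by (simp_all add: complex_eq_iff)

lemmas Complex_arith = complex_add complex_minus complex_diff complex_mult complex_cnj

lemma Complex_div_numeral: "Complex a b / Complex (numeral k) 0 = Complex (a / numeral k) (b / numeral k)"
  by (simp flip: complex_numerals(4) add: complex_eq_iff)

text \<open>As F is arbitrary, this says that the table lists the multiset of invariants of the 96
  elements. For a full element they depend on b and c only through b c, which takes each of the four
  values four times.\<close>

lemma sum_H1_invariants:
  "(\<Sum>g\<in>carrier H1. F (tr2 g) (det2 g) (quartic_tr g)) =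
     (\<Sum>(k, t, \<delta>, w)\<leftarrow>H1_classes. k * F t \<delta> w)"
proof -
  have full: "(\<Sum>b\<in>quarter_units. \<Sum>c\<in>quarter_units. h (b * c)) = 4 * (\<Sum>q\<in>quarter_units. h q)"
    for h :: "complex \<Rightarrow> complex"
    by (simp add: sum_quarter_units)
  have "(\<Sum>g\<in>carrier H1. F (tr2 g) (det2 g) (quartic_tr g)) =
      (\<Sum>a\<in>quarter_units. \<Sum>b\<in>quarter_units. F (a + b) (a * b) (1 + a * a * b * b)) +
      (\<Sum>a\<in>quarter_units. \<Sum>b\<in>quarter_units. F 0 (- (a * b)) (1 + a * a * b * b)) +
      (\<Sum>a\<in>quarter_units. 4 * (\<Sum>q\<in>quarter_units. F (\<omega> * (a - a * a * a * q)) (- (\<i> * q)) ((q * q - 1) / 2)))"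
    unfolding sum_H1_elements full[symmetric]
    by (simp add: invariants_diag invariants_anti invariants_full)
  also have "\<dots> = (\<Sum>(k, t, \<delta>, w)\<leftarrow>H1_classes. k * F t \<delta> w)"
    unfolding sum_quarter_units half_unit_def H1_classes_def complex_numerals
    by (simp add: Complex_arith Complex_div_numeral, simp flip: complex_numerals)
  finally show ?thesis .
qed

text \<open>Taking F to be the indicator of the triples missing from the table, the table side of
  \<open>sum_H1_invariants\<close> vanishes row by row, so no element has such a triple.\<close>

lemma invariants_in_classes:
  assumes "g \<in> carrier H1"
  shows "(tr2 g, det2 g, quartic_tr g) \<in> snd ` set H1_classes"
proof -
  have "(\<Sum>g\<in>carrier H1. if (tr2 g, det2 g, quartic_tr g) \<in> snd ` set H1_classes then 0 else 1) =
      (\<Sum>(k, t, \<delta>, w)\<leftarrow>H1_classes. k * (if (t, \<delta>, w) \<in> snd ` set H1_classes then 0 else 1))"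
    by (rule sum_H1_invariants[of "\<lambda>t \<delta> w. if (t, \<delta>, w) \<in> snd ` set H1_classes then 0 else 1"])
  also have "\<dots> = (\<Sum>x\<leftarrow>H1_classes. 0)"
    by (rule arg_cong[of _ _ sum_list], rule map_cong) (auto simp: image_iff, metis snd_conv)
  finally have "of_nat (card {g\<in>carrier H1. (tr2 g, det2 g, quartic_tr g) \<notin> snd ` set H1_classes}) = (0 :: complex)"
    using finite_H1_elements by (simp add: sum.If_cases carrier_H1 Int_def sum_list_0 cong: conj_cong)
  hence "{g\<in>carrier H1. (tr2 g, det2 g, quartic_tr g) \<notin> snd ` set H1_classes} = {}"
    using finite_H1_elements by (simp add: carrier_H1)
  thus ?thesis using assms by blast
qed

lemma order_H1: "of_nat (order H1) = (96 :: complex)"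
  using sum_H1_invariants[of "\<lambda>_ _ _. 1"] by (simp add: order_def H1_classes_def)

lemma H1_identity_iff:
  assumes "g \<in> carrier H1"
  shows "g = \<one>\<^bsub>H1\<^esub> \<longleftrightarrow> tr2 g = 2 \<and> det2 g = 1"
proof
  assume "tr2 g = 2 \<and> det2 g = 1"
  have "g \<in> H1_elements" using assms by (simp add: carrier_H1)
  thus "g = \<one>\<^bsub>H1\<^esub>"
  proof (cases rule: H1_elements_cases)
    case (diag a b)
    hence "a + b = 2" using \<open>tr2 g = 2 \<and> _\<close> by (simp add: invariants_diag)
    hence "a = 1" "b = 1" using diag(1,2) by (auto simp: quarter_units_def complex_eq_iff)
    thus ?thesis using diag(3) by (simp add: diag_elt_def)
  next
    case (anti a b)
    thus ?thesis using \<open>tr2 g = 2 \<and> _\<close> by (auto simp: invariants_anti)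
  next
    case (full a b c)
    have q: "b * c \<in> quarter_units" using full by (auto intro: quarter_units_closed)
    have "\<omega> * (a - a * a * a * q) \<noteq> 2" if "q \<in> quarter_units" for q
      using \<open>a \<in> quarter_units\<close> that
      by (auto simp: quarter_units_def half_unit_def complex_eq_iff)
    thus ?thesis using \<open>tr2 g = 2 \<and> _\<close> full q by (auto simp: invariants_full)
  qed
qed (simp add: tr2_def det2_def)

text \<open>The group is unitary, so the inverse is the conjugate transpose. Transposition replaces
  c^4 by b^4 in the quartic trace, which is harmless because the two agree on
  \<open>H1\<close>.\<close>

lemma inv_H1:
  assumes "g \<in> carrier H1"
  shows "tr2 (inv\<^bsub>H1\<^esub> g) = cnj (tr2 g)" "det2 (inv\<^bsub>H1\<^esub> g) = cnj (det2 g)"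
    "quartic_tr (inv\<^bsub>H1\<^esub> g) = cnj (quartic_tr g)"
proof -
  interpret H1: group H1 by (rule group_H1)
  obtain a b c d where g: "g = m2 a b c d" and "b ^ 4 + d ^ 4 = a ^ 4 + c ^ 4"
    "a ^ 3 * b + c ^ 3 * d = 0" "a * b ^ 3 + c * d ^ 3 = 0"
    "b ^ 2 * d ^ 2 = a ^ 2 * c ^ 2" "a * c * (a * d + b * c) = 0" "b * d * (a * d + b * c) = 0"
    and bc: "b ^ 4 = c ^ 4"
    by (rule H1_quartic_invariants[OF assms]) (rule that)
  let ?h = "m2 (cnj a) (cnj c) (cnj b) (cnj d)"
  have unit: "cnj x * x = 1" "cnj x * (x * y) = y" if "x \<in> quarter_units" for x y
    using that by (auto simp: quarter_units_def)
  have "g \<in> H1_elements" using assms by (simp add: carrier_H1)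
  hence "?h \<in> H1_elements \<and> ?h * g = m2 1 0 0 1"
  proof (cases rule: H1_elements_cases)
    case (diag x y)
    hence [simp]: "a = x" "b = 0" "c = 0" "d = y" using g by (auto simp: diag_elt_def m2_eq_iff)
    show ?thesis
      using diag H1_elementsI(1)[of "cnj x" "cnj y"]
      by (simp add: m2_mult diag_elt_def quarter_units_closed unit)
  next
    case (anti x y)
    hence [simp]: "a = 0" "b = x" "c = y" "d = 0" using g by (auto simp: anti_elt_def m2_eq_iff)
    show ?thesis
      using anti H1_elementsI(2)[of "cnj y" "cnj x"]
      by (simp add: m2_mult anti_elt_def quarter_units_closed unit)
  next
    case (full x y z)
    define u where "u = - (cnj x * y * z)"
    have eq [simp]: "a = \<omega> * x" "b = \<omega> * y" "c = \<omega> * z" "d = \<omega> * u"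
      using g full quarter_units_cnj[of x] by (auto simp: full_elt_def m2_eq_iff u_def)
    \<comment> \<open>The conjugate of \<omega> is \<omega> times a fourth root of unity, so the
      conjugate transpose of a full element is again of the full form.\<close>
    have \<omega>: "cnj \<omega> = \<omega> * - \<i>" "cnj \<omega> * \<omega> = 1 / 2"
      by (simp_all add: half_unit_def complex_eq_iff)
    have xu: "x * u = - (y * z)" using unit[OF full(1)] by (simp add: u_def mult_ac)
    have "?h = m2 (\<omega> * (- \<i> * cnj x)) (\<omega> * (- \<i> * cnj z)) (\<omega> * (- \<i> * cnj y)) (\<omega> * (- \<i> * cnj u))"
      by (simp add: \<omega>(1) mult.assoc)
    moreover have "- \<i> * cnj x * (- \<i> * cnj u) = - (- \<i> * cnj z * (- \<i> * cnj y))"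
    proof -
      have "- \<i> * cnj x * (- \<i> * cnj u) = (- \<i> * - \<i>) * cnj (x * u)"
        by (simp only: complex_cnj_mult mult_ac)
      also have "\<dots> = (- \<i> * - \<i>) * - (cnj z * cnj y)" unfolding xu by (simp add: mult.commute)
      also have "\<dots> = - (- \<i> * cnj z * (- \<i> * cnj y))" by (simp only: mult_ac mult_minus_right)
      finally show ?thesis .
    qed
    ultimately have "?h \<in> H1_elements"
      using full by (simp only:) (intro full_eltI, auto intro!: quarter_units_closed)
    moreover have "?h * g = m2 1 0 0 1"
    proof -
      have "?h * g = m2 (cnj \<omega> * \<omega> * (cnj x * x + cnj z * z)) (cnj \<omega> * \<omega> * (cnj x * y + cnj z * u))
          (cnj \<omega> * \<omega> * (cnj y * x + cnj u * z)) (cnj \<omega> * \<omega> * (cnj y * y + cnj u * u))"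
        by (simp add: g m2_mult m2_eq_iff algebra_simps)
      also have "cnj x * y + cnj z * u = 0"
        using unit[OF full(3)] by (simp add: u_def mult_ac)
      also have "cnj y * x + cnj u * z = 0"
        using unit[OF full(3)] by (simp add: u_def mult_ac)
      also have "cnj u * u = 1"
        using full(1-3) unfolding u_def by (intro unit quarter_units_closed)
      finally show ?thesis using full by (simp add: unit \<omega>(2))
    qed
    ultimately show ?thesis by blast
  qed
  hence inv: "inv\<^bsub>H1\<^esub> g = ?h"
    using assms by (intro H1.inv_equality) (simp_all add: carrier_H1)
  show "tr2 (inv\<^bsub>H1\<^esub> g) = cnj (tr2 g)" "det2 (inv\<^bsub>H1\<^esub> g) = cnj (det2 g)"
    unfolding inv by (simp_all add: g tr2_def det2_def mult.commute)
  have "quartic_tr ?h = cnj (a ^ 4 + b ^ 4 + a ^ 2 * d ^ 2 + 4 * a * b * c * d + b ^ 2 * c ^ 2)"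
  proof -
    have "quartic_tr ?h = cnj a ^ 4 + cnj b ^ 4 +
        (cnj a ^ 2 * cnj d ^ 2 + 4 * cnj a * cnj c * cnj b * cnj d + cnj c ^ 2 * cnj b ^ 2)"
      by (simp add: quartic_tr_def quartic_rep_def Let_def)
    thus ?thesis
      by (simp only: complex_cnj_add complex_cnj_mult complex_cnj_power complex_cnj_numeral ac_simps)
  qed
  thus "quartic_tr (inv\<^bsub>H1\<^esub> g) = cnj (quartic_tr g)"
    unfolding inv bc by (simp add: g quartic_tr_def quartic_rep_def)
qed

text \<open>The irreducible representations are the trivial, the natural, the quartic and the symmetric
  square representations and the tensor product of the natural and quartic ones, each twisted by
  the distinguishable powers of the determinant.\<close>

definition H1_twist :: "nat \<Rightarrow> nat" where
  "H1_twist p = (if p < 4 then p else if p < 8 then p - 4 else if p < 10 then p - 8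
     else if p < 14 then p - 10 else p - 14)"

text \<open>The squares add up to 4 * 1 + 6 * 4 + 4 * 9 + 2 * 16 = 96.\<close>

definition H1_dim :: "nat \<Rightarrow> nat" where
  "H1_dim p = (if p < 4 then 1 else if p < 10 then 2 else if p < 14 then 3 else 4)"

text \<open>The quartic trace vanishes wherever the determinant is \<i> or -\<i>, and elsewhere the
  square of the determinant is 1. Hence twisting by that square does not change the quartic
  character or its product with the natural one, and these two families have only two members
  each.\<close>

definition H1_rep :: "nat \<Rightarrow> complex mat \<Rightarrow> nat \<Rightarrow> nat \<Rightarrow> complex" where
  "H1_rep p g i j = det2 g ^ H1_twist p *
     (if p < 4 then 1 else if p < 8 then g $$ (i, j) else if p < 10 then quartic_rep g i j
      else if p < 14 then sym2_rep g i j
      else g $$ (i div 2, j div 2) * quartic_rep g (i mod 2) (j mod 2))"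

text \<open>The polynomial \<open>t * t - \<delta>\<close> is the trace of the symmetric
  square.\<close>

definition H1_char :: "nat \<Rightarrow> complex \<Rightarrow> complex \<Rightarrow> complex \<Rightarrow> complex" where
  "H1_char p t \<delta> w = \<delta> ^ H1_twist p *
     (if p < 4 then 1 else if p < 8 then t else if p < 10 then w else if p < 14 then t * t - \<delta> else t * w)"

lemma matrix_rep_H1: "matrix_rep H1 (H1_dim p) (H1_rep p)"
proof -
  have 1: "matrix_rep H1 1 (\<lambda>g i j. 1)" by (simp add: matrix_rep_def)
  note base = 1 matrix_rep_natural matrix_rep_quartic matrix_rep_sym2
    matrix_rep_tensor2[OF matrix_rep_natural matrix_rep_quartic]
  have det: "det2 \<one>\<^bsub>H1\<^esub> = 1" by (simp add: det2_def)
  have det': "det2 (g \<otimes>\<^bsub>H1\<^esub> h) = det2 g * det2 h" if "g \<in> carrier H1" "h \<in> carrier H1" for g h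
    using det2_mult that by simp
  show ?thesis
    using base[THEN matrix_rep_twist[where f = det2, OF _ det det']]
    by (cases "p < 4"; cases "p < 8"; cases "p < 10"; cases "p < 14")
      (simp_all add: H1_rep_def[abs_def] H1_dim_def)
qed

lemma mat_character_H1: "mat_character (H1_dim p) (H1_rep p) g = H1_char p (tr2 g) (det2 g) (quartic_tr g)"
proof -
  have "{..<4::nat} = {0, 1, 2, 3}" "{..<3::nat} = {0, 1, 2}" by auto
  hence "(\<Sum>i<4. f i) = f 0 + f 1 + f 2 + f 3" "(\<Sum>i<3. f i) = f 0 + f 1 + f 2" for f :: "nat \<Rightarrow> complex"
    by (simp_all add: add.assoc)
  thus ?thesis
    unfolding mat_character_def H1_rep_def H1_char_def H1_dim_def sum_distrib_left[symmetric]
    by (simp add: sum_lessThan_2 tr2_def det2_def quartic_tr_def sym2_rep_def Let_def power2_eq_square)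
       (simp add: algebra_simps)
qed

section \<open>Numerical verification of orthogonality and completeness\<close>

lemma less_16_iff: "(\<forall>p<16. P p) \<longleftrightarrow> P 0 \<and> P 1 \<and> P 2 \<and> P 3 \<and> P 4 \<and> P 5 \<and> P 6 \<and> P 7 \<and>
    P 8 \<and> P 9 \<and> P 10 \<and> P 11 \<and> P 12 \<and> P 13 \<and> P 14 \<and> P (15 :: nat)"
  by (simp add: eval_nat_numeral All_less_Suc conj_assoc conj_commute conj_left_commute)

lemma sum_16: "(\<Sum>p<16. f p) = f 0 + f 1 + f 2 + f 3 + f 4 + f 5 + f 6 + f 7 +
    f 8 + f 9 + f 10 + f 11 + f 12 + f 13 + f 14 + f (15 :: nat)" for f :: "nat \<Rightarrow> complex"
  by (simp add: eval_nat_numeral)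

lemmas H1_char_simps = H1_char_def H1_twist_def

lemma H1_character_orthogonal:
  "\<forall>p<16. \<forall>q<16. (\<Sum>(k, t, \<delta>, w)\<leftarrow>H1_classes. k * (H1_char p t \<delta> w * cnj (H1_char q t \<delta> w))) =
     (if p = q then 96 else 0)"
  unfolding less_16_iff
  by (intro conjI; simp add: H1_char_simps H1_classes_def complex_numerals Complex_arith
      power2_eq_square power3_eq_cube)

lemma H1_regular_character:
  "\<forall>x\<in>set H1_classes. case x of (k, t, \<delta>, w) \<Rightarrow>
     (\<Sum>p<16. of_nat (H1_dim p) * H1_char p t \<delta> w) = (if t = 2 \<and> \<delta> = 1 then 96 else 0)"
  by (simp add: H1_classes_def sum_16 H1_dim_def H1_char_simps complex_numerals Complex_arith
      power2_eq_square power3_eq_cube)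

lemma H1_char_cnj: "H1_char p (cnj t) (cnj \<delta>) (cnj w) = cnj (H1_char p t \<delta> w)"
  by (simp add: H1_char_def)

interpretation H1: irreducible_system H1 16 H1_dim H1_rep
proof (intro irreducible_system.intro group_H1 irreducible_system_axioms.intro)
  show "finite (carrier H1)" by (simp add: carrier_H1 finite_H1_elements)
next
  fix p q :: nat assume pq: "p < 16" "q < 16"
  have "(\<Sum>g\<in>carrier H1. mat_character (H1_dim p) (H1_rep p) g * mat_character (H1_dim q) (H1_rep q) (inv\<^bsub>H1\<^esub> g))
      = (\<Sum>(k, t, \<delta>, w)\<leftarrow>H1_classes. k * (H1_char p t \<delta> w * cnj (H1_char q t \<delta> w)))"
    by (subst sum_H1_invariants[symmetric]) (simp add: mat_character_H1 inv_H1 H1_char_cnj)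
  thus "(\<Sum>g\<in>carrier H1. mat_character (H1_dim p) (H1_rep p) g * mat_character (H1_dim q) (H1_rep q) (inv\<^bsub>H1\<^esub> g))
      = (if p = q then of_nat (order H1) else 0)"
    using H1_character_orthogonal pq by (simp add: order_H1)
next
  fix g assume g: "g \<in> carrier H1"
  obtain k where "(k, tr2 g, det2 g, quartic_tr g) \<in> set H1_classes"
    using invariants_in_classes[OF g] by force
  thus "(\<Sum>p<16. of_nat (H1_dim p) * mat_character (H1_dim p) (H1_rep p) g)
      = (if g = \<one>\<^bsub>H1\<^esub> then of_nat (order H1) else 0)"
    using bspec[OF H1_regular_character] H1_identity_iff[OF g] by (auto simp: mat_character_H1 order_H1)
qed (rule matrix_rep_H1, simp add: H1_dim_def)

section \<open>The subgroups with faithful coset action\<close>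

lemma minus_one_in_H1: "m2 (- 1) 0 0 (- 1) \<in> carrier H1"
  using H1_elementsI(1)[of "- 1" "- 1"] by (simp add: carrier_H1 diag_elt_def)

lemma minus_one_mult:
  assumes "g \<in> carrier H1"
  shows "m2 (- 1) 0 0 (- 1) * g = g * m2 (- 1) 0 0 (- 1)"
proof -
  obtain a b c d where "g = m2 a b c d" by (rule H1_quartic_invariants[OF assms])
  thus ?thesis by (simp add: m2_mult)
qed

text \<open>A central element of K fixes every coset, since K x z = K z x = K x; so -1 in K would
  act like the identity.\<close>

lemma faithful_minus_one:
  assumes K: "subgroup K H1" and faithful: "faithful_on_cosets H1 K"
  shows "m2 (- 1) 0 0 (- 1) \<notin> K"
proof
  let ?z = "m2 (- 1) 0 0 (- 1) :: complex mat"
  assume z: "?z \<in> K"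
  have KG: "K \<subseteq> carrier H1" using K by (rule subgroup.subset)
  have "C #>\<^bsub>H1\<^esub> ?z = C #>\<^bsub>H1\<^esub> \<one>\<^bsub>H1\<^esub>" if C: "C \<in> rcosets\<^bsub>H1\<^esub> K" for C
  proof -
    obtain x where x: "x \<in> carrier H1" "C = K #>\<^bsub>H1\<^esub> x" using C by (auto simp: RCOSETS_def)
    have "C #>\<^bsub>H1\<^esub> ?z = K #>\<^bsub>H1\<^esub> (x \<otimes>\<^bsub>H1\<^esub> ?z)"
      unfolding x(2) by (rule H1.coset_mult_assoc[OF KG x(1) minus_one_in_H1])
    also have "x \<otimes>\<^bsub>H1\<^esub> ?z = ?z \<otimes>\<^bsub>H1\<^esub> x" using minus_one_mult[OF x(1)] by simp
    also have "K #>\<^bsub>H1\<^esub> (?z \<otimes>\<^bsub>H1\<^esub> x) = K #>\<^bsub>H1\<^esub> ?z #>\<^bsub>H1\<^esub> x"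
      by (rule H1.coset_mult_assoc[OF KG minus_one_in_H1 x(1), symmetric])
    also have "K #>\<^bsub>H1\<^esub> ?z = K" by (rule H1.coset_join2[OF minus_one_in_H1 K z])
    also have "K #>\<^bsub>H1\<^esub> x = C #>\<^bsub>H1\<^esub> \<one>\<^bsub>H1\<^esub>"
      unfolding x(2) using H1.coset_mult_assoc[OF KG x(1) H1.one_closed] x(1)
      by (simp only: H1.r_one)
    finally show ?thesis .
  qed
  hence "(\<lambda>C\<in>rcosets\<^bsub>H1\<^esub> K. C #>\<^bsub>H1\<^esub> ?z) = (\<lambda>C\<in>rcosets\<^bsub>H1\<^esub> K. C #>\<^bsub>H1\<^esub> \<one>\<^bsub>H1\<^esub>)"
    by (intro restrict_ext)
  hence "?z = \<one>\<^bsub>H1\<^esub>"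
    using faithful minus_one_in_H1 H1.one_closed unfolding faithful_on_cosets_def inj_on_def by blast
  thus False by (simp add: m2_eq_iff)
qed

lemma invariants_one: "tr2 (m2 1 0 0 1) = 2" "det2 (m2 1 0 0 1) = 1" "quartic_tr (m2 1 0 0 1) = 2"
  by (simp_all add: tr2_def det2_def quartic_tr_def quartic_rep_def)

lemma invariants_square:
  assumes "h \<in> carrier H1"
  shows "tr2 (h * h) = tr2 h * tr2 h - 2 * det2 h" "det2 (h * h) = det2 h * det2 h"
  by (simp_all add: tr2_def det2_def H1_mult_index[OF assms assms] algebra_simps)

text \<open>If the trace were nonzero, the off-diagonal equations of h h = 1 would make h scalar,
  hence 1 or -1. Trace zero gives determinant -1, and the table has one row with these
  values.\<close>

lemma involution_invariants:
  assumes h: "h \<in> carrier H1" and "h * h = m2 1 0 0 1" "h \<noteq> m2 1 0 0 1" "h \<noteq> m2 (- 1) 0 0 (- 1)"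
  shows "tr2 h = 0" "det2 h = - 1" "quartic_tr h = 2"
proof -
  obtain a b c d where g: "h = m2 a b c d" by (rule H1_quartic_invariants[OF h])
  have eq: "a * a + b * c = 1" "b * (a + d) = 0" "c * (a + d) = 0" "d * d + b * c = 1"
    using assms(2) by (simp_all add: g m2_mult m2_eq_iff algebra_simps)
  have "a + d = 0"
  proof (rule ccontr)
    assume nz: "a + d \<noteq> 0"
    hence "b = 0" "c = 0" using eq by auto
    moreover from this have "(a - d) * (a + d) = 0" using eq by (simp add: algebra_simps)
    hence "d = a" using nz by simp
    moreover have "a = 1 \<or> a = - 1" using eq \<open>b = 0\<close> by (simp add: square_eq_1_iff)
    ultimately show False using assms(3,4) by (auto simp: g)
  qed
  hence d: "d = - a" by (simp add: add_eq_0_iff)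
  show t: "tr2 h = 0" by (simp add: g tr2_def d)
  have "det2 h = - (a * a + b * c)" by (simp add: g det2_def d)
  thus \<delta>: "det2 h = - 1" by (simp add: eq(1))
  show "quartic_tr h = 2"
    using invariants_in_classes[OF h] by (auto simp: t \<delta> H1_classes_def complex_numerals Complex_arith)
qed

text \<open>The arbitrary f makes this a statement about the multiset of invariants of K, the form
  in which K enters the computation of its permutation character.\<close>

lemma subgroup_order2_invariants:
  assumes K: "subgroup K H1" "faithful_on_cosets H1 K" and card: "card K = 2"
  shows "(\<Sum>h\<in>K. f (tr2 h) (det2 h) (quartic_tr h)) = f 2 1 2 + (f 0 (- 1) 2 :: complex)"
proof -
  have one: "m2 1 0 0 1 \<in> K" using subgroup.one_closed[OF K(1)] by simp
  obtain h where h: "K = {m2 1 0 0 1, h}" "h \<noteq> m2 1 0 0 1"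
    using card one by (auto simp: card_2_iff)
  have hG: "h \<in> carrier H1" using h subgroup.mem_carrier[OF K(1)] by blast
  have "h * h \<in> K" using subgroup.m_closed[OF K(1), of h h] h by simp
  moreover have "h * h \<noteq> h" using H1.l_cancel_one[OF hG hG] h(2) by simp
  ultimately have "h * h = m2 1 0 0 1" using h by simp
  moreover have "h \<noteq> m2 (- 1) 0 0 (- 1)" using faithful_minus_one[OF K] h by auto
  ultimately show ?thesis
    using involution_invariants[OF hG] h by (simp add: invariants_one)
qed

lemma subgroup_pow_card:
  assumes K: "subgroup K H1" and h: "h \<in> K"
  shows "h [^]\<^bsub>H1\<^esub> card K = m2 1 0 0 1"
proof -
  interpret K: group "H1\<lparr>carrier := K\<rparr>" by (rule H1.subgroup_imp_group[OF K])
  have "h [^]\<^bsub>H1\<lparr>carrier := K\<rparr>\<^esub> order (H1\<lparr>carrier := K\<rparr>) = \<one>\<^bsub>H1\<lparr>carrier := K\<rparr>\<^esub>"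
    using h by (intro K.pow_order_eq_1) simp
  thus ?thesis by (simp add: order_def H1.nat_pow_consistent[symmetric])
qed

text \<open>For a generator h the determinant is a cube root of unity occurring in the table, hence
  1, and h^2 = h^-1 gives tr(h)^2 - 2 = cnj(tr h). Apart from the identity only the row with trace
  -1 and determinant 1 satisfies this.\<close>

lemma subgroup_order3_invariants:
  assumes K: "subgroup K H1" and card: "card K = 3"
  shows "(\<Sum>h\<in>K. f (tr2 h) (det2 h) (quartic_tr h)) = f 2 1 2 + 2 * (f (- 1) 1 (- 1) :: complex)"
proof -
  have one: "m2 1 0 0 1 \<in> K" using subgroup.one_closed[OF K] by simp
  have "K \<noteq> {m2 1 0 0 1}" using card by auto
  then obtain h where h: "h \<in> K" "h \<noteq> m2 1 0 0 1" using one by blast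
  have hG: "h \<in> carrier H1" using h subgroup.mem_carrier[OF K] by blast
  have h2: "h * h \<in> K" using subgroup.m_closed[OF K h(1) h(1)] by simp
  have h2G: "h * h \<in> carrier H1" using h2 subgroup.mem_carrier[OF K] by blast
  have "h [^]\<^bsub>H1\<^esub> (3::nat) = m2 1 0 0 1" using subgroup_pow_card[OF K h(1)] card by simp
  hence h3: "h * h * h = m2 1 0 0 1"
    using H1.l_one[OF hG] by (simp add: numeral_3_eq_3)
  have 1: "h * h \<noteq> h" using H1.l_cancel_one[OF hG hG] h(2) by simp
  have 2: "h * h \<noteq> m2 1 0 0 1"
    using h3 h(2) H1.l_one[OF hG] by auto
  have "finite K" using card by (metis card.infinite zero_neq_numeral)
  hence Keq: "K = {m2 1 0 0 1, h, h * h}"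
    using card one h h2 1 2 by (intro card_subset_eq[symmetric]) auto
  have inv: "inv\<^bsub>H1\<^esub> h = h * h" using h3 hG h2G by (intro H1.inv_equality) simp_all
  have "det2 h * det2 h * det2 h = 1"
    using arg_cong[OF h3, of det2] det2_mult[OF h2G hG] det2_mult[OF hG hG] by (simp add: invariants_one)
  moreover have "tr2 h * tr2 h - 2 * det2 h = cnj (tr2 h)"
    using inv_H1(1)[OF hG] invariants_square(1)[OF hG] unfolding inv by simp
  moreover have "\<not> (tr2 h = 2 \<and> det2 h = 1)"
    using H1_identity_iff[OF hG] h(2) by simp
  ultimately have i: "tr2 h = - 1" "det2 h = 1" "quartic_tr h = - 1"
    using invariants_in_classes[OF hG] by (auto simp: H1_classes_def complex_numerals Complex_arith)
  have "tr2 (h * h) = - 1" "det2 (h * h) = 1" "quartic_tr (h * h) = - 1"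
    using inv_H1[OF hG] i unfolding inv by simp_all
  thus ?thesis unfolding Keq using 1 2 h(2) i by (simp add: invariants_one)
qed

text \<open>K is cyclic: if every element squared to 1, all nontrivial ones would have determinant
  -1, but the product of two distinct ones has determinant 1. A generator and its inverse have
  conjugate invariants, so they share the sign s, which remains undetermined.\<close>

lemma subgroup_order4_invariants:
  assumes K: "subgroup K H1" "faithful_on_cosets H1 K" and card: "card K = 4"
  obtains s :: complex where "s = 1 \<or> s = - 1"
    and "\<And>f. (\<Sum>h\<in>K. f (tr2 h) (det2 h) (quartic_tr h)) =
      f 2 1 2 + f 0 (- 1) 2 + (f (s * (1 + \<i>)) \<i> 0 + f (s * (1 - \<i>)) (- \<i>) 0 :: complex)"
proof -
  have one: "m2 1 0 0 1 \<in> K" using subgroup.one_closed[OF K(1)] by simp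
  have KG: "h \<in> carrier H1" if "h \<in> K" for h using that subgroup.mem_carrier[OF K(1)] by blast
  have mult: "g * h \<in> K" if "g \<in> K" "h \<in> K" for g h using subgroup.m_closed[OF K(1) that] by simp
  have fin: "finite K" using card by (metis card.infinite zero_neq_numeral)
  have "\<exists>h\<in>K. h * h \<noteq> m2 1 0 0 1"
  proof (rule ccontr)
    assume "\<not> ?thesis"
    hence sq: "h * h = m2 1 0 0 1" if "h \<in> K" for h using that by blast
    have det: "det2 h = - 1" if "h \<in> K" "h \<noteq> m2 1 0 0 1" for h
      using involution_invariants(2)[OF KG sq] faithful_minus_one[OF K] that by blast
    have "card (K - {m2 1 0 0 1}) = 3" using one card fin by simp
    then obtain x y where xy: "x \<in> K" "y \<in> K" "x \<noteq> m2 1 0 0 1" "y \<noteq> m2 1 0 0 1" "x \<noteq> y"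
      by (auto simp: card_3_iff)
    have "det2 (x * y) = 1" using det2_mult[OF KG KG, of x y] det xy by simp
    hence "x * y = m2 1 0 0 1" using det[of "x * y"] mult xy by force
    hence "x * y = y * y" using sq xy by simp
    thus False using H1.right_cancel[of y x y] KG xy by simp
  qed
  then obtain h where h: "h \<in> K" "h * h \<noteq> m2 1 0 0 1" by blast
  have hG: "h \<in> carrier H1" "h * h \<in> carrier H1" "h * h * h \<in> carrier H1"
    using h mult KG by blast+
  have "h [^]\<^bsub>H1\<^esub> (4::nat) = m2 1 0 0 1" using subgroup_pow_card[OF K(1) h(1)] card by simp
  hence h4: "h * h * h * h = m2 1 0 0 1"
    using H1.l_one[OF hG(1)] by (simp add: eval_nat_numeral)
  have inv: "inv\<^bsub>H1\<^esub> h = h * h * h" using h4 hG by (intro H1.inv_equality) simp_all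
  have "h * h * (h * h) = m2 1 0 0 1" using h4 H1.m_assoc[OF hG(2) hG(1) hG(1)] by simp
  moreover have "h * h \<noteq> m2 (- 1) 0 0 (- 1)" using faithful_minus_one[OF K] mult h by metis
  ultimately have i2: "tr2 (h * h) = 0" "det2 (h * h) = - 1" "quartic_tr (h * h) = 2"
    using involution_invariants[OF hG(2)] h(2) by blast+
  have ne: "h \<noteq> m2 1 0 0 1" "h * h \<noteq> h" "h * h * h \<noteq> m2 1 0 0 1" "h * h * h \<noteq> h" "h * h * h \<noteq> h * h"
  proof -
    show 1: "h \<noteq> m2 1 0 0 1" using h(2) by (auto simp: m2_mult)
    thus "h * h \<noteq> h" using H1.l_cancel_one[OF hG(1) hG(1)] by simp
    show "h * h * h \<noteq> m2 1 0 0 1" using h4 1 H1.l_one[OF hG(1)] by auto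
    show "h * h * h \<noteq> h" using H1.r_cancel_one[OF hG(1) hG(2)] h(2) by simp
    show "h * h * h \<noteq> h * h" using H1.l_cancel_one[OF hG(2) hG(1)] 1 by simp
  qed
  have Keq: "K = {m2 1 0 0 1, h, h * h, h * h * h}"
    using card one h mult ne fin by (intro card_subset_eq[symmetric]) auto
  \<comment> \<open>The square of h is an involution other than -1, so its trace and determinant are
    known. They leave \<i> or -\<i> as determinant of h and the two square roots of twice that value
    as trace.\<close>
  have "det2 h * det2 h = - 1" "tr2 h * tr2 h = 2 * det2 h"
    using i2 invariants_square[OF hG(1)] by simp_all
  hence "\<exists>s. (s = 1 \<or> s = - 1) \<and> quartic_tr h = 0 \<and>
      (tr2 h = s * (1 + \<i>) \<and> det2 h = \<i> \<or> tr2 h = s * (1 - \<i>) \<and> det2 h = - \<i>)"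
    using invariants_in_classes[OF hG(1)]
    by (simp add: H1_classes_def complex_numerals Complex_arith ex_disj_distrib conj_disj_distribR)
       (auto simp: Complex_arith)
  then obtain s where s: "s = 1 \<or> s = - 1" and i: "quartic_tr h = 0"
      "tr2 h = s * (1 + \<i>) \<and> det2 h = \<i> \<or> tr2 h = s * (1 - \<i>) \<and> det2 h = - \<i>"
    by blast
  have cs: "cnj s = s" using s by auto
  have sum: "(\<Sum>h\<in>K. f (tr2 h) (det2 h) (quartic_tr h)) =
      f 2 1 2 + f 0 (- 1) 2 + (f (s * (1 + \<i>)) \<i> 0 + f (s * (1 - \<i>)) (- \<i>) 0)"
    for f :: "complex \<Rightarrow> complex \<Rightarrow> complex \<Rightarrow> complex"
    using i(2) inv_H1[OF hG(1)] unfolding Keq inv using ne h(2) i(1) i2 ne[symmetric] h(2)[symmetric]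
    by (elim disjE) (simp_all add: invariants_one cs)
  show thesis using s sum by (rule that)
qed

section \<open>The centralizer rings\<close>

lemma H1_degree_class_sum:
  "\<forall>p<16. (\<Sum>(c, t, \<delta>, w)\<leftarrow>H1_classes. if t = 2 \<and> \<delta> = 1 then c * cnj (H1_char p t \<delta> w) else 0)
     = of_nat (H1_dim p)"
  unfolding less_16_iff
  by (intro conjI; simp add: H1_char_simps H1_dim_def H1_classes_def complex_numerals Complex_arith
      power2_eq_square power3_eq_cube)

text \<open>The functional \<open>\<Phi>\<close> is summation over \<open>K\<close>. The hypothesis on \<open>\<Phi>\<close> says, in view of column orthogonality,
  that the permutation character is \<open>n\<close> on the identity, \<open>m\<close> on the classes in \<open>S\<close> and \<open>0\<close>
  elsewhere.\<close>

lemma H1_centralizer_ring: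
  fixes B :: "nat \<Rightarrow> real" and n m :: nat
  assumes K: "subgroup K H1" and k: "0 < k"
    and \<Phi>: "\<And>f. (\<Sum>h\<in>K. f (tr2 h) (det2 h) (quartic_tr h)) = (\<Phi> f :: complex)"
    and column: "\<forall>x\<in>set H1_classes. case x of (c, t, \<delta>, w) \<Rightarrow>
      \<Phi> (\<lambda>t' \<delta>' w'. \<Sum>p<16. H1_char p t \<delta> w * cnj (H1_char p t' \<delta>' w')) =
        of_nat (card K) * of_nat (if t = 2 \<and> \<delta> = 1 then n else if S t \<delta> then m else 0)"
    and S: "\<not> S 2 1"
    and B: "\<forall>p<16. (\<Sum>(c, t, \<delta>, w)\<leftarrow>H1_classes. if S t \<delta> then c * cnj (H1_char p t \<delta> w) else 0) = of_real (B p)"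
  shows "\<exists>r. (\<forall>p<16. 96 * real (r p) = real (H1_dim p) * real n ^ k + B p * real m ^ k) \<and>
    (\<forall>ps. distinct ps \<longrightarrow> set ps = {..<16} \<longrightarrow> centralizer_ring H1 K k \<cong>\<^sub>A mat_alg_sum (map r ps))"
proof -
  obtain r where r: "\<And>p. p < 16 \<Longrightarrow> of_nat (r p) =
      (\<Sum>g\<in>carrier H1. mat_character (H1_dim p) (H1_rep p) (inv\<^bsub>H1\<^esub> g) * of_nat (coset_fixed_points H1 K g) ^ k)
        / of_nat (order H1)"
    and iso: "\<And>ps. distinct ps \<Longrightarrow> set ps = {..<16} \<Longrightarrow> centralizer_ring H1 K k \<cong>\<^sub>A mat_alg_sum (map r ps)"
    using H1.centralizer_ring_decomposition[OF K, of k] by blast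
  \<comment> \<open>The values that the hypothesis on \<Phi> gives to the permutation
    character.\<close>
  define \<theta> where "\<theta> t \<delta> = (if t = 2 \<and> \<delta> = 1 then n else if S t \<delta> then m else 0)" for t \<delta>
  have "finite K" using subgroup.subset[OF K] finite_H1_elements by (simp add: carrier_H1 finite_subset)
  moreover have "K \<noteq> {}" using subgroup.one_closed[OF K] by blast
  ultimately have card: "of_nat (card K) \<noteq> (0 :: complex)" by simp
  have fix_eq: "coset_fixed_points H1 K g = \<theta> (tr2 g) (det2 g)" if g: "g \<in> carrier H1" for g
  proof -
    obtain c where "(c, tr2 g, det2 g, quartic_tr g) \<in> set H1_classes"
      using invariants_in_classes[OF g] by force
    hence "\<Phi> (\<lambda>t' \<delta>' w'. \<Sum>p<16. H1_char p (tr2 g) (det2 g) (quartic_tr g) * cnj (H1_char p t' \<delta>' w')) =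
        of_nat (card K) * of_nat (\<theta> (tr2 g) (det2 g))"
      using column by (force simp: \<theta>_def)
    moreover have "of_nat (coset_fixed_points H1 K g) =
        \<Phi> (\<lambda>t' \<delta>' w'. \<Sum>p<16. H1_char p (tr2 g) (det2 g) (quartic_tr g) * cnj (H1_char p t' \<delta>' w')) / of_nat (card K)"
      unfolding H1.coset_fixed_points_character[OF K g] \<Phi>[symmetric]
      using subgroup.mem_carrier[OF K]
      by (intro arg_cong2[where f = "(/)"] sum.cong refl) (simp add: mat_character_H1 inv_H1 H1_char_cnj)
    ultimately have "of_nat (coset_fixed_points H1 K g) = (of_nat (\<theta> (tr2 g) (det2 g)) :: complex)"
      using card by simp
    thus ?thesis by (simp only: of_nat_eq_iff)
  qed
  have vals: "96 * real (r p) = real (H1_dim p) * real n ^ k + B p * real m ^ k" if p: "p < 16" for p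
  proof -
    have "of_nat (r p) * 96 = (\<Sum>g\<in>carrier H1. cnj (H1_char p (tr2 g) (det2 g) (quartic_tr g)) *
        of_nat (\<theta> (tr2 g) (det2 g)) ^ k)"
      using r[OF p] by (simp add: order_H1 fix_eq mat_character_H1 inv_H1 H1_char_cnj)
    also have "\<dots> = (\<Sum>(c, t, \<delta>, w)\<leftarrow>H1_classes. c * (cnj (H1_char p t \<delta> w) * of_nat (\<theta> t \<delta>) ^ k))"
      by (rule sum_H1_invariants[of "\<lambda>t \<delta> w. cnj (H1_char p t \<delta> w) * of_nat (\<theta> t \<delta>) ^ k"])
    \<comment> \<open>Positivity of k makes the k-th power vanish where the character does, and
      \<open>S\<close> omits the identity, so the two contributions do not overlap.\<close>
    also have "\<dots> = (\<Sum>(c, t, \<delta>, w)\<leftarrow>H1_classes.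
        of_nat n ^ k * (if t = 2 \<and> \<delta> = 1 then c * cnj (H1_char p t \<delta> w) else 0) +
        of_nat m ^ k * (if S t \<delta> then c * cnj (H1_char p t \<delta> w) else 0))"
      using k S by (intro arg_cong[where f = sum_list] map_cong refl) (auto simp: \<theta>_def)
    also have "\<dots> = of_nat n ^ k * (\<Sum>(c, t, \<delta>, w)\<leftarrow>H1_classes. if t = 2 \<and> \<delta> = 1 then c * cnj (H1_char p t \<delta> w) else 0) +
        of_nat m ^ k * (\<Sum>(c, t, \<delta>, w)\<leftarrow>H1_classes. if S t \<delta> then c * cnj (H1_char p t \<delta> w) else 0)"
      by (simp add: split_def sum_list_addf sum_list_const_mult)
    also have "\<dots> = of_real (real (H1_dim p) * real n ^ k + B p * real m ^ k)"
      using H1_degree_class_sum B p by (simp add: mult.commute)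
    finally have "complex_of_real (96 * real (r p)) = of_real (real (H1_dim p) * real n ^ k + B p * real m ^ k)"
      by (simp add: mult.commute)
    thus ?thesis by (simp only: of_real_eq_iff)
  qed
  show ?thesis using vals iso by blast
qed

section \<open>Explicit degrees for each subgroup order\<close>

lemma less_16_set: "{..<16 :: nat} = {0, 1, 2, 3, 4, 5, 6, 7, 8, 9, 10, 11, 12, 13, 14, 15}"
  by (simp add: eval_nat_numeral lessThan_Suc insert_commute)

lemmas H1_column_simps = H1_classes_def sum_16 H1_char_simps complex_numerals Complex_arith
  power2_eq_square power3_eq_cube

text \<open>For k = j + 1 the exponent k - 2 becomes j - 1. It is negative when k = 1, where the
  value is 1 / 4.\<close>

lemma four_powi: "4 powi (int j - 1) = (4 ^ j / 4 :: real)"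
  using power_int_diff[of "4 :: real" "int j" 1] by (simp add: algebra_simps)

lemma centralizer_ring_order1:
  assumes K: "subgroup K H1" and card: "card K = 1" and k: "k = Suc j"
  shows "\<exists>a e l p :: nat.
        real a = 96 ^ (k - 1) \<and>
        real e = 96 ^ k / 48 \<and>
        real l = 96 ^ k / 32 \<and>
        real p = 96 ^ k / 24 \<and>
        centralizer_ring H1 K k \<cong>\<^sub>A
          mat_alg_sum (replicate 4 a @ replicate 6 e @ replicate 4 l @ replicate 2 p)"
proof -
  have "K = {m2 1 0 0 1}"
    using card subgroup.one_closed[OF K] by (auto simp: card_1_singleton_iff)
  hence sum: "(\<Sum>h\<in>K. f (tr2 h) (det2 h) (quartic_tr h)) = f 2 1 2"
    for f :: "complex \<Rightarrow> complex \<Rightarrow> complex \<Rightarrow> complex"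
    by (simp add: invariants_one)
  \<comment> \<open>The regular character lives on the identity alone, so the support
    \<open>?S\<close> is empty and the value 1 given to m is multiplied by zero.\<close>
  let ?bs = "[0, 0, 0, 0, 0, 0, 0, 0, 0, 0, 0, 0, 0, 0, 0, 0] :: real list"
  let ?S = "\<lambda>t \<delta> :: complex. False"
  have "\<exists>r. (\<forall>p<16. 96 * real (r p) = real (H1_dim p) * real 96 ^ k + ?bs ! p * real 1 ^ k) \<and>
    (\<forall>ps. distinct ps \<longrightarrow> set ps = {..<16} \<longrightarrow> centralizer_ring H1 K k \<cong>\<^sub>A mat_alg_sum (map r ps))"
  proof (rule H1_centralizer_ring[OF K _ sum, where S = ?S and B = "nth ?bs"])
    show "\<forall>x\<in>set H1_classes. case x of (c, t, \<delta>, w) \<Rightarrow>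
        (\<Sum>p<16. H1_char p t \<delta> w * cnj (H1_char p 2 1 2)) =
        of_nat (card K) * of_nat (if t = 2 \<and> \<delta> = 1 then 96 else if ?S t \<delta> then 1 else 0)"
      by (simp add: H1_column_simps card)
    show "\<forall>p<16. (\<Sum>(c, t, \<delta>, w)\<leftarrow>H1_classes. if ?S t \<delta> then c * cnj (H1_char p t \<delta> w) else 0) =
        complex_of_real (?bs ! p)"
      unfolding less_16_iff by (intro conjI; simp add: H1_column_simps)
  qed (simp_all add: k complex_numerals Complex_arith)
  then obtain r where
      r: "\<And>p. p < 16 \<Longrightarrow> 96 * real (r p) = real (H1_dim p) * real 96 ^ k + ?bs ! p * real 1 ^ k"
    and iso: "\<And>ps. distinct ps \<Longrightarrow> set ps = {..<16} \<Longrightarrow> centralizer_ring H1 K k \<cong>\<^sub>A mat_alg_sum (map r ps)"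
    by blast
  have eq: "r p = r q" if "p < 16" "q < 16" "H1_dim p = H1_dim q" "?bs ! p = ?bs ! q" for p q
  proof -
    have "96 * real (r p) = 96 * real (r q)" unfolding r[OF that(1)] r[OF that(2)] that(3,4) by (rule refl)
    thus ?thesis by simp
  qed
  \<comment> \<open>The degree of a block depends only on the dimension of the representation and on
    its entry in \<open>?bs\<close>.\<close>
  have eqs: "r 1 = r 0" "r 2 = r 0" "r 3 = r 0" "r 5 = r 4" "r 6 = r 4" "r 7 = r 4" "r 8 = r 4" "r 9 = r 4" "r 11 = r 10" "r 12 = r 10" "r 13 = r 10" "r 15 = r 14"
    by (rule eq; simp add: H1_dim_def)+
  have "map r [0, 1, 2, 3, 4, 5, 6, 7, 8, 9, 10, 11, 12, 13, 14, 15] =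
      replicate 4 (r 0) @ replicate 6 (r 4) @ replicate 4 (r 10) @ replicate 2 (r 14)"
    by (simp only: list.map eqs) (simp add: numeral_eq_Suc)
  moreover have "centralizer_ring H1 K k \<cong>\<^sub>A mat_alg_sum (map r [0, 1, 2, 3, 4, 5, 6, 7, 8, 9, 10, 11, 12, 13, 14, 15])"
    by (rule iso) (auto simp: less_16_set)
  ultimately have "centralizer_ring H1 K k \<cong>\<^sub>A
      mat_alg_sum (replicate 4 (r 0) @ replicate 6 (r 4) @ replicate 4 (r 10) @ replicate 2 (r 14))"
    by (simp only:)
  moreover have
    "real (r 0) = 96 ^ (k - 1)"
    "real (r 4) = 96 ^ k / 48"
    "real (r 10) = 96 ^ k / 32"
    "real (r 14) = 96 ^ k / 24"
    using r[of 0] r[of 4] r[of 10] r[of 14]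
    by (simp_all add: H1_dim_def k field_simps)
  ultimately show ?thesis by blast
qed

lemma centralizer_ring_order2:
  assumes K: "subgroup K H1" "faithful_on_cosets H1 K" and card: "card K = 2" and k: "k = Suc j"
  shows "\<exists>a c e f g l n p :: nat.
        real a = 48 ^ (k - 1) / 2 + 8 ^ (k - 1) / 2 \<and>
        real c = 48 ^ (k - 1) / 2 - 8 ^ (k - 1) / 2 \<and>
        real e = 48 ^ (k - 1) + 8 ^ (k - 1) \<and>
        real f = 48 ^ (k - 1) - 8 ^ (k - 1) \<and>
        real g = 48 ^ (k - 1) \<and>
        real l = 48 ^ k / 32 - 8 ^ (k - 1) / 2 \<and>
        real n = 48 ^ k / 32 + 8 ^ (k - 1) / 2 \<and>
        real p = 48 ^ k / 24 \<and>
        centralizer_ring H1 K k \<cong>\<^sub>A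
          mat_alg_sum (replicate 2 a @ replicate 2 c @ replicate 1 e @ replicate 1 f @
            replicate 4 g @ replicate 2 l @ replicate 2 n @ replicate 2 p)"
proof -
  note sum = subgroup_order2_invariants[OF K card]
  \<comment> \<open>Six times the character values at trace 0 and determinant -1, a class of size 6.
    Its centralizers have order 16, so the permutation character there is 16 / 2 = 8.\<close>
  let ?bs = "[6, -6, 6, -6, 0, 0, 0, 0, 12, -12, 6, -6, 6, -6, 0, 0] :: real list"
  let ?S = "\<lambda>t \<delta> :: complex. t = 0 \<and> \<delta> = - 1"
  have "\<exists>r. (\<forall>p<16. 96 * real (r p) = real (H1_dim p) * real 48 ^ k + ?bs ! p * real 8 ^ k) \<and>
    (\<forall>ps. distinct ps \<longrightarrow> set ps = {..<16} \<longrightarrow> centralizer_ring H1 K k \<cong>\<^sub>A mat_alg_sum (map r ps))"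
  proof (rule H1_centralizer_ring[OF K(1) _ sum, where S = ?S and B = "nth ?bs"])
    show "\<forall>x\<in>set H1_classes. case x of (c, t, \<delta>, w) \<Rightarrow>
        (\<Sum>p<16. H1_char p t \<delta> w * cnj (H1_char p 2 1 2)) +
        (\<Sum>p<16. H1_char p t \<delta> w * cnj (H1_char p 0 (- 1) 2)) =
        of_nat (card K) * of_nat (if t = 2 \<and> \<delta> = 1 then 48 else if ?S t \<delta> then 8 else 0)"
      by (simp add: H1_column_simps card)
    show "\<forall>p<16. (\<Sum>(c, t, \<delta>, w)\<leftarrow>H1_classes. if ?S t \<delta> then c * cnj (H1_char p t \<delta> w) else 0) =
        complex_of_real (?bs ! p)"
      unfolding less_16_iff by (intro conjI; simp add: H1_column_simps)
  qed (simp_all add: k complex_numerals Complex_arith)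
  then obtain r where
      r: "\<And>p. p < 16 \<Longrightarrow> 96 * real (r p) = real (H1_dim p) * real 48 ^ k + ?bs ! p * real 8 ^ k"
    and iso: "\<And>ps. distinct ps \<Longrightarrow> set ps = {..<16} \<Longrightarrow> centralizer_ring H1 K k \<cong>\<^sub>A mat_alg_sum (map r ps)"
    by blast
  have eq: "r p = r q" if "p < 16" "q < 16" "H1_dim p = H1_dim q" "?bs ! p = ?bs ! q" for p q
  proof -
    have "96 * real (r p) = 96 * real (r q)" unfolding r[OF that(1)] r[OF that(2)] that(3,4) by (rule refl)
    thus ?thesis by simp
  qed
  have eqs: "r 2 = r 0" "r 3 = r 1" "r 5 = r 4" "r 6 = r 4" "r 7 = r 4" "r 13 = r 11" "r 12 = r 10" "r 15 = r 14"
    by (rule eq; simp add: H1_dim_def)+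
  \<comment> \<open>Even and odd powers of the determinant differ in sign on the support, so the
    twists of the trivial, quartic and symmetric square representations split by parity.\<close>
  have "map r [0, 2, 1, 3, 8, 9, 4, 5, 6, 7, 11, 13, 10, 12, 14, 15] =
      replicate 2 (r 0) @ replicate 2 (r 1) @ replicate 1 (r 8) @ replicate 1 (r 9) @ replicate 4 (r 4) @ replicate 2 (r 11) @ replicate 2 (r 10) @ replicate 2 (r 14)"
    by (simp only: list.map eqs) (simp add: numeral_eq_Suc)
  moreover have "centralizer_ring H1 K k \<cong>\<^sub>A mat_alg_sum (map r [0, 2, 1, 3, 8, 9, 4, 5, 6, 7, 11, 13, 10, 12, 14, 15])"
    by (rule iso) (auto simp: less_16_set)
  ultimately have "centralizer_ring H1 K k \<cong>\<^sub>A
      mat_alg_sum (replicate 2 (r 0) @ replicate 2 (r 1) @ replicate 1 (r 8) @ replicate 1 (r 9) @ replicate 4 (r 4) @ replicate 2 (r 11) @ replicate 2 (r 10) @ replicate 2 (r 14))"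
    by (simp only:)
  moreover have
    "real (r 0) = 48 ^ (k - 1) / 2 + 8 ^ (k - 1) / 2"
    "real (r 1) = 48 ^ (k - 1) / 2 - 8 ^ (k - 1) / 2"
    "real (r 8) = 48 ^ (k - 1) + 8 ^ (k - 1)"
    "real (r 9) = 48 ^ (k - 1) - 8 ^ (k - 1)"
    "real (r 4) = 48 ^ (k - 1)"
    "real (r 11) = 48 ^ k / 32 - 8 ^ (k - 1) / 2"
    "real (r 10) = 48 ^ k / 32 + 8 ^ (k - 1) / 2"
    "real (r 14) = 48 ^ k / 24"
    using r[of 0] r[of 1] r[of 8] r[of 9] r[of 4] r[of 11] r[of 10] r[of 14]
    by (simp_all add: H1_dim_def k field_simps)
  ultimately show ?thesis by blast
qed

lemma centralizer_ring_order3: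
  assumes K: "subgroup K H1" and card: "card K = 3" and k: "k = Suc j"
  shows "\<exists>a e l p :: nat.
        real a = 32 ^ (k - 1) / 3 + 8 ^ k / 12 \<and>
        real e = 32 ^ k / 48 - 8 ^ k / 12 \<and>
        real l = 32 ^ (k - 1) \<and>
        real p = 32 ^ k / 24 + 8 ^ k / 12 \<and>
        centralizer_ring H1 K k \<cong>\<^sub>A
          mat_alg_sum (replicate 4 a @ replicate 6 e @ replicate 4 l @ replicate 2 p)"
proof -
  note sum = subgroup_order3_invariants[OF K card]
  \<comment> \<open>Eight times the character values at trace -1 and determinant 1, a class of size
    8 with centralizers of order 12. Two elements of K lie in it, so the permutation character there
    is 2 * 12 / 3 = 8.\<close>
  let ?bs = "[8, 8, 8, 8, -8, -8, -8, -8, -8, -8, 0, 0, 0, 0, 8, 8] :: real list"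
  let ?S = "\<lambda>t \<delta> :: complex. t = - 1 \<and> \<delta> = 1"
  have "\<exists>r. (\<forall>p<16. 96 * real (r p) = real (H1_dim p) * real 32 ^ k + ?bs ! p * real 8 ^ k) \<and>
    (\<forall>ps. distinct ps \<longrightarrow> set ps = {..<16} \<longrightarrow> centralizer_ring H1 K k \<cong>\<^sub>A mat_alg_sum (map r ps))"
  proof (rule H1_centralizer_ring[OF K _ sum, where S = ?S and B = "nth ?bs"])
    show "\<forall>x\<in>set H1_classes. case x of (c, t, \<delta>, w) \<Rightarrow>
        (\<Sum>p<16. H1_char p t \<delta> w * cnj (H1_char p 2 1 2)) +
        2 * (\<Sum>p<16. H1_char p t \<delta> w * cnj (H1_char p (- 1) 1 (- 1))) =
        of_nat (card K) * of_nat (if t = 2 \<and> \<delta> = 1 then 32 else if ?S t \<delta> then 8 else 0)"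
      by (simp add: H1_column_simps card)
    show "\<forall>p<16. (\<Sum>(c, t, \<delta>, w)\<leftarrow>H1_classes. if ?S t \<delta> then c * cnj (H1_char p t \<delta> w) else 0) =
        complex_of_real (?bs ! p)"
      unfolding less_16_iff by (intro conjI; simp add: H1_column_simps)
  qed (simp_all add: k complex_numerals Complex_arith)
  then obtain r where
      r: "\<And>p. p < 16 \<Longrightarrow> 96 * real (r p) = real (H1_dim p) * real 32 ^ k + ?bs ! p * real 8 ^ k"
    and iso: "\<And>ps. distinct ps \<Longrightarrow> set ps = {..<16} \<Longrightarrow> centralizer_ring H1 K k \<cong>\<^sub>A mat_alg_sum (map r ps)"
    by blast
  have eq: "r p = r q" if "p < 16" "q < 16" "H1_dim p = H1_dim q" "?bs ! p = ?bs ! q" for p q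
  proof -
    have "96 * real (r p) = 96 * real (r q)" unfolding r[OF that(1)] r[OF that(2)] that(3,4) by (rule refl)
    thus ?thesis by simp
  qed
  have eqs: "r 1 = r 0" "r 2 = r 0" "r 3 = r 0" "r 5 = r 4" "r 6 = r 4" "r 7 = r 4" "r 8 = r 4" "r 9 = r 4" "r 11 = r 10" "r 12 = r 10" "r 13 = r 10" "r 15 = r 14"
    by (rule eq; simp add: H1_dim_def)+
  have "map r [0, 1, 2, 3, 4, 5, 6, 7, 8, 9, 10, 11, 12, 13, 14, 15] =
      replicate 4 (r 0) @ replicate 6 (r 4) @ replicate 4 (r 10) @ replicate 2 (r 14)"
    by (simp only: list.map eqs) (simp add: numeral_eq_Suc)
  moreover have "centralizer_ring H1 K k \<cong>\<^sub>A mat_alg_sum (map r [0, 1, 2, 3, 4, 5, 6, 7, 8, 9, 10, 11, 12, 13, 14, 15])"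
    by (rule iso) (auto simp: less_16_set)
  ultimately have "centralizer_ring H1 K k \<cong>\<^sub>A
      mat_alg_sum (replicate 4 (r 0) @ replicate 6 (r 4) @ replicate 4 (r 10) @ replicate 2 (r 14))"
    by (simp only:)
  moreover have
    "real (r 0) = 32 ^ (k - 1) / 3 + 8 ^ k / 12"
    "real (r 4) = 32 ^ k / 48 - 8 ^ k / 12"
    "real (r 10) = 32 ^ (k - 1)"
    "real (r 14) = 32 ^ k / 24 + 8 ^ k / 12"
    using r[of 0] r[of 4] r[of 10] r[of 14]
    by (simp_all add: H1_dim_def k field_simps)
  ultimately show ?thesis by blast
qed

lemma centralizer_ring_order4_plus:
  assumes K: "subgroup K H1" and card: "card K = 4" and k: "k = Suc j"
    and sum: "\<And>f. (\<Sum>h\<in>K. f (tr2 h) (det2 h) (quartic_tr h)) =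
      f 2 1 2 + f 0 (- 1) 2 + (f (1 + \<i>) \<i> 0 + f (1 - \<i>) (- \<i>) 0 :: complex)"
  shows "\<exists>a b e f l m p :: nat.
        real a = 24 ^ (k - 1) / 4 + 3 * 4 powi (int k - 2) \<and>
        real b = 24 ^ (k - 1) / 4 - 4 powi (int k - 2) \<and>
        real e = 24 ^ (k - 1) / 2 + 4 ^ (k - 1) / 2 \<and>
        real f = 24 ^ (k - 1) / 2 - 4 ^ (k - 1) / 2 \<and>
        real l = 24 ^ k / 32 - 3 * 4 powi (int k - 2) \<and>
        real m = 24 ^ k / 32 + 4 powi (int k - 2) \<and>
        real p = 24 ^ (k - 1) \<and>
        centralizer_ring H1 K k \<cong>\<^sub>A
          mat_alg_sum (replicate 1 a @ replicate 3 b @ replicate 1 e @ replicate 3 f @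
            replicate 2 e @ replicate 1 l @ replicate 3 m @ replicate 2 p)"
proof -
  \<comment> \<open>Sums of conjugate character values over the three classes of size 6 that meet K.
    Each has centralizers of order 16 and contains one element of K, which gives the value 16 / 4 =
    4.\<close>
  let ?bs = "[18, -6, -6, -6, 12, -12, -12, 12, 12, -12, 6, -18, 6, 6, 0, 0] :: real list"
  let ?S = "\<lambda>t \<delta> :: complex. t = 0 \<and> \<delta> = - 1 \<or> t = 1 + \<i> \<and> \<delta> = \<i> \<or> t = 1 - \<i> \<and> \<delta> = - \<i>"
  have "\<exists>r. (\<forall>p<16. 96 * real (r p) = real (H1_dim p) * real 24 ^ k + ?bs ! p * real 4 ^ k) \<and>
    (\<forall>ps. distinct ps \<longrightarrow> set ps = {..<16} \<longrightarrow> centralizer_ring H1 K k \<cong>\<^sub>A mat_alg_sum (map r ps))"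
  proof (rule H1_centralizer_ring[OF K _ sum, where S = ?S and B = "nth ?bs"])
    show "\<forall>x\<in>set H1_classes. case x of (c, t, \<delta>, w) \<Rightarrow>
        (\<Sum>p<16. H1_char p t \<delta> w * cnj (H1_char p 2 1 2)) +
        (\<Sum>p<16. H1_char p t \<delta> w * cnj (H1_char p 0 (- 1) 2)) +
        ((\<Sum>p<16. H1_char p t \<delta> w * cnj (H1_char p (1 + \<i>) \<i> 0)) +
        (\<Sum>p<16. H1_char p t \<delta> w * cnj (H1_char p (1 - \<i>) (- \<i>) 0))) =
        of_nat (card K) * of_nat (if t = 2 \<and> \<delta> = 1 then 24 else if ?S t \<delta> then 4 else 0)"
      by (simp add: H1_column_simps card)
    show "\<forall>p<16. (\<Sum>(c, t, \<delta>, w)\<leftarrow>H1_classes. if ?S t \<delta> then c * cnj (H1_char p t \<delta> w) else 0) =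
        complex_of_real (?bs ! p)"
      unfolding less_16_iff by (intro conjI; simp add: H1_column_simps)
  qed (simp_all add: k complex_numerals Complex_arith)
  then obtain r where
      r: "\<And>p. p < 16 \<Longrightarrow> 96 * real (r p) = real (H1_dim p) * real 24 ^ k + ?bs ! p * real 4 ^ k"
    and iso: "\<And>ps. distinct ps \<Longrightarrow> set ps = {..<16} \<Longrightarrow> centralizer_ring H1 K k \<cong>\<^sub>A mat_alg_sum (map r ps)"
    by blast
  have eq: "r p = r q" if "p < 16" "q < 16" "H1_dim p = H1_dim q" "?bs ! p = ?bs ! q" for p q
  proof -
    have "96 * real (r p) = 96 * real (r q)" unfolding r[OF that(1)] r[OF that(2)] that(3,4) by (rule refl)
    thus ?thesis by simp
  qed
  have eqs: "r 2 = r 1" "r 3 = r 1" "r 6 = r 5" "r 9 = r 5" "r 7 = r 4" "r 8 = r 4" "r 12 = r 10" "r 13 = r 10" "r 15 = r 14"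
    by (rule eq; simp add: H1_dim_def)+
  \<comment> \<open>Three of the six two-dimensional representations have degree e and three have
    degree f; the former are listed as 4, then 7 and 8.\<close>
  have "map r [0, 1, 2, 3, 4, 5, 6, 9, 7, 8, 11, 10, 12, 13, 14, 15] =
      replicate 1 (r 0) @ replicate 3 (r 1) @ replicate 1 (r 4) @ replicate 3 (r 5) @ replicate 2 (r 4) @ replicate 1 (r 11) @ replicate 3 (r 10) @ replicate 2 (r 14)"
    by (simp only: list.map eqs) (simp add: numeral_eq_Suc)
  moreover have "centralizer_ring H1 K k \<cong>\<^sub>A mat_alg_sum (map r [0, 1, 2, 3, 4, 5, 6, 9, 7, 8, 11, 10, 12, 13, 14, 15])"
    by (rule iso) (auto simp: less_16_set)
  ultimately have "centralizer_ring H1 K k \<cong>\<^sub>A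
      mat_alg_sum (replicate 1 (r 0) @ replicate 3 (r 1) @ replicate 1 (r 4) @ replicate 3 (r 5) @ replicate 2 (r 4) @ replicate 1 (r 11) @ replicate 3 (r 10) @ replicate 2 (r 14))"
    by (simp only:)
  moreover have
    "real (r 0) = 24 ^ (k - 1) / 4 + 3 * 4 powi (int k - 2)"
    "real (r 1) = 24 ^ (k - 1) / 4 - 4 powi (int k - 2)"
    "real (r 4) = 24 ^ (k - 1) / 2 + 4 ^ (k - 1) / 2"
    "real (r 5) = 24 ^ (k - 1) / 2 - 4 ^ (k - 1) / 2"
    "real (r 11) = 24 ^ k / 32 - 3 * 4 powi (int k - 2)"
    "real (r 10) = 24 ^ k / 32 + 4 powi (int k - 2)"
    "real (r 14) = 24 ^ (k - 1)"
    using r[of 0] r[of 1] r[of 4] r[of 5] r[of 11] r[of 10] r[of 14]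
    by (simp_all add: H1_dim_def k four_powi field_simps)
  ultimately show ?thesis by blast
qed

text \<open>The map g to det(g)^2 g is an automorphism of the group and reverses the sign of the
  trace where the determinant is \<i> or -\<i>. It twists the natural representation by the square
  of the determinant and preserves the characters of the blocks of dimension 1, 3 and 4 and of the
  quartic ones.\<close>

lemma centralizer_ring_order4_minus:
  assumes K: "subgroup K H1" and card: "card K = 4" and k: "k = Suc j"
    and sum: "\<And>f. (\<Sum>h\<in>K. f (tr2 h) (det2 h) (quartic_tr h)) =
      f 2 1 2 + f 0 (- 1) 2 + (f (- 1 - \<i>) \<i> 0 + f (- 1 + \<i>) (- \<i>) 0 :: complex)"
  shows "\<exists>a b e f l m p :: nat.
        real a = 24 ^ (k - 1) / 4 + 3 * 4 powi (int k - 2) \<and>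
        real b = 24 ^ (k - 1) / 4 - 4 powi (int k - 2) \<and>
        real e = 24 ^ (k - 1) / 2 + 4 ^ (k - 1) / 2 \<and>
        real f = 24 ^ (k - 1) / 2 - 4 ^ (k - 1) / 2 \<and>
        real l = 24 ^ k / 32 - 3 * 4 powi (int k - 2) \<and>
        real m = 24 ^ k / 32 + 4 powi (int k - 2) \<and>
        real p = 24 ^ (k - 1) \<and>
        centralizer_ring H1 K k \<cong>\<^sub>A
          mat_alg_sum (replicate 1 a @ replicate 3 b @ replicate 1 e @ replicate 3 f @
            replicate 2 e @ replicate 1 l @ replicate 3 m @ replicate 2 p)"
proof -
  let ?bs = "[18, -6, -6, -6, -12, 12, 12, -12, 12, -12, 6, -18, 6, 6, 0, 0] :: real list"
  let ?S = "\<lambda>t \<delta> :: complex. t = 0 \<and> \<delta> = - 1 \<or> t = - 1 - \<i> \<and> \<delta> = \<i> \<or> t = - 1 + \<i> \<and> \<delta> = - \<i>"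
  have "\<exists>r. (\<forall>p<16. 96 * real (r p) = real (H1_dim p) * real 24 ^ k + ?bs ! p * real 4 ^ k) \<and>
    (\<forall>ps. distinct ps \<longrightarrow> set ps = {..<16} \<longrightarrow> centralizer_ring H1 K k \<cong>\<^sub>A mat_alg_sum (map r ps))"
  proof (rule H1_centralizer_ring[OF K _ sum, where S = ?S and B = "nth ?bs"])
    show "\<forall>x\<in>set H1_classes. case x of (c, t, \<delta>, w) \<Rightarrow>
        (\<Sum>p<16. H1_char p t \<delta> w * cnj (H1_char p 2 1 2)) +
        (\<Sum>p<16. H1_char p t \<delta> w * cnj (H1_char p 0 (- 1) 2)) +
        ((\<Sum>p<16. H1_char p t \<delta> w * cnj (H1_char p (- 1 - \<i>) \<i> 0)) +
        (\<Sum>p<16. H1_char p t \<delta> w * cnj (H1_char p (- 1 + \<i>) (- \<i>) 0))) =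
        of_nat (card K) * of_nat (if t = 2 \<and> \<delta> = 1 then 24 else if ?S t \<delta> then 4 else 0)"
      by (simp add: H1_column_simps card)
    show "\<forall>p<16. (\<Sum>(c, t, \<delta>, w)\<leftarrow>H1_classes. if ?S t \<delta> then c * cnj (H1_char p t \<delta> w) else 0) =
        complex_of_real (?bs ! p)"
      unfolding less_16_iff by (intro conjI; simp add: H1_column_simps)
  qed (simp_all add: k complex_numerals Complex_arith)
  then obtain r where
      r: "\<And>p. p < 16 \<Longrightarrow> 96 * real (r p) = real (H1_dim p) * real 24 ^ k + ?bs ! p * real 4 ^ k"
    and iso: "\<And>ps. distinct ps \<Longrightarrow> set ps = {..<16} \<Longrightarrow> centralizer_ring H1 K k \<cong>\<^sub>A mat_alg_sum (map r ps)"
    by blast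
  have eq: "r p = r q" if "p < 16" "q < 16" "H1_dim p = H1_dim q" "?bs ! p = ?bs ! q" for p q
  proof -
    have "96 * real (r p) = 96 * real (r q)" unfolding r[OF that(1)] r[OF that(2)] that(3,4) by (rule refl)
    thus ?thesis by simp
  qed
  have eqs: "r 2 = r 1" "r 3 = r 1" "r 7 = r 4" "r 9 = r 4" "r 6 = r 5" "r 8 = r 5" "r 12 = r 10" "r 13 = r 10" "r 15 = r 14"
    by (rule eq; simp add: H1_dim_def)+
  \<comment> \<open>Compared with the other sign, 4 and 7 exchange roles with 5 and 6, so degree e
    now sits at 5, 6 and 8.\<close>
  have "map r [0, 1, 2, 3, 5, 4, 7, 9, 6, 8, 11, 10, 12, 13, 14, 15] =
      replicate 1 (r 0) @ replicate 3 (r 1) @ replicate 1 (r 5) @ replicate 3 (r 4) @ replicate 2 (r 5) @ replicate 1 (r 11) @ replicate 3 (r 10) @ replicate 2 (r 14)"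
    by (simp only: list.map eqs) (simp add: numeral_eq_Suc)
  moreover have "centralizer_ring H1 K k \<cong>\<^sub>A mat_alg_sum (map r [0, 1, 2, 3, 5, 4, 7, 9, 6, 8, 11, 10, 12, 13, 14, 15])"
    by (rule iso) (auto simp: less_16_set)
  ultimately have "centralizer_ring H1 K k \<cong>\<^sub>A
      mat_alg_sum (replicate 1 (r 0) @ replicate 3 (r 1) @ replicate 1 (r 5) @ replicate 3 (r 4) @ replicate 2 (r 5) @ replicate 1 (r 11) @ replicate 3 (r 10) @ replicate 2 (r 14))"
    by (simp only:)
  moreover have
    "real (r 0) = 24 ^ (k - 1) / 4 + 3 * 4 powi (int k - 2)"
    "real (r 1) = 24 ^ (k - 1) / 4 - 4 powi (int k - 2)"
    "real (r 5) = 24 ^ (k - 1) / 2 + 4 ^ (k - 1) / 2"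
    "real (r 4) = 24 ^ (k - 1) / 2 - 4 ^ (k - 1) / 2"
    "real (r 11) = 24 ^ k / 32 - 3 * 4 powi (int k - 2)"
    "real (r 10) = 24 ^ k / 32 + 4 powi (int k - 2)"
    "real (r 14) = 24 ^ (k - 1)"
    using r[of 0] r[of 1] r[of 5] r[of 4] r[of 11] r[of 10] r[of 14]
    by (simp_all add: H1_dim_def k four_powi field_simps)
  ultimately show ?thesis by blast
qed

theorem theorem3:
  fixes K :: "nat \<Rightarrow> complex mat set" and k :: nat
  assumes subgroups: "\<And>i. i \<in> {1, 3, 4, 8, 9} \<Longrightarrow> subgroup (K i) H1 \<and> faithful_on_cosets H1 (K i)"
    and representatives: "\<And>L. subgroup L H1 \<Longrightarrow> faithful_on_cosets H1 L \<Longrightarrow>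
          \<exists>!i. i \<in> {1, 3, 4, 8, 9} \<and> conjugate_subgroups H1 (K i) L"
    and orders: "card (K 1) = 1" "card (K 3) = 2" "card (K 4) = 3" "card (K 8) = 4" "card (K 9) = 4"
    and k: "k \<ge> 1"
  shows
    "(\<exists>a e l p :: nat.
        real a = 96 ^ (k - 1) \<and>
        real e = 96 ^ k / 48 \<and>
        real l = 96 ^ k / 32 \<and>
        real p = 96 ^ k / 24 \<and>
        centralizer_ring H1 (K 1) k \<cong>\<^sub>A
          mat_alg_sum (replicate 4 a @ replicate 6 e @ replicate 4 l @ replicate 2 p))
   \<and> (\<exists>a c e f g l n p :: nat.
        real a = 48 ^ (k - 1) / 2 + 8 ^ (k - 1) / 2 \<and>
        real c = 48 ^ (k - 1) / 2 - 8 ^ (k - 1) / 2 \<and>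
        real e = 48 ^ (k - 1) + 8 ^ (k - 1) \<and>
        real f = 48 ^ (k - 1) - 8 ^ (k - 1) \<and>
        real g = 48 ^ (k - 1) \<and>
        real l = 48 ^ k / 32 - 8 ^ (k - 1) / 2 \<and>
        real n = 48 ^ k / 32 + 8 ^ (k - 1) / 2 \<and>
        real p = 48 ^ k / 24 \<and>
        centralizer_ring H1 (K 3) k \<cong>\<^sub>A
          mat_alg_sum (replicate 2 a @ replicate 2 c @ replicate 1 e @ replicate 1 f @
            replicate 4 g @ replicate 2 l @ replicate 2 n @ replicate 2 p))
   \<and> (\<exists>a e l p :: nat.
        real a = 32 ^ (k - 1) / 3 + 8 ^ k / 12 \<and>
        real e = 32 ^ k / 48 - 8 ^ k / 12 \<and>
        real l = 32 ^ (k - 1) \<and>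
        real p = 32 ^ k / 24 + 8 ^ k / 12 \<and>
        centralizer_ring H1 (K 4) k \<cong>\<^sub>A
          mat_alg_sum (replicate 4 a @ replicate 6 e @ replicate 4 l @ replicate 2 p))
   \<and> (\<forall>i \<in> {8, 9}. \<exists>a b e f l m p :: nat.
        real a = 24 ^ (k - 1) / 4 + 3 * 4 powi (int k - 2) \<and>
        real b = 24 ^ (k - 1) / 4 - 4 powi (int k - 2) \<and>
        real e = 24 ^ (k - 1) / 2 + 4 ^ (k - 1) / 2 \<and>
        real f = 24 ^ (k - 1) / 2 - 4 ^ (k - 1) / 2 \<and>
        real l = 24 ^ k / 32 - 3 * 4 powi (int k - 2) \<and>
        real m = 24 ^ k / 32 + 4 powi (int k - 2) \<and>
        real p = 24 ^ (k - 1) \<and>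
        centralizer_ring H1 (K i) k \<cong>\<^sub>A
          mat_alg_sum (replicate 1 a @ replicate 3 b @ replicate 1 e @ replicate 3 f @
            replicate 2 e @ replicate 1 l @ replicate 3 m @ replicate 2 p))"
proof -
  obtain j where j: "k = Suc j" using k by (cases k) auto
  have K: "subgroup (K i) H1" "faithful_on_cosets H1 (K i)" if "i \<in> {1, 3, 4, 8, 9}" for i
    using subgroups[OF that] by auto
  have order4: "\<exists>a b e f l m p :: nat.
        real a = 24 ^ (k - 1) / 4 + 3 * 4 powi (int k - 2) \<and>
        real b = 24 ^ (k - 1) / 4 - 4 powi (int k - 2) \<and>
        real e = 24 ^ (k - 1) / 2 + 4 ^ (k - 1) / 2 \<and>
        real f = 24 ^ (k - 1) / 2 - 4 ^ (k - 1) / 2 \<and>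
        real l = 24 ^ k / 32 - 3 * 4 powi (int k - 2) \<and>
        real m = 24 ^ k / 32 + 4 powi (int k - 2) \<and>
        real p = 24 ^ (k - 1) \<and>
        centralizer_ring H1 (K i) k \<cong>\<^sub>A
          mat_alg_sum (replicate 1 a @ replicate 3 b @ replicate 1 e @ replicate 3 f @
            replicate 2 e @ replicate 1 l @ replicate 3 m @ replicate 2 p)" if i: "i \<in> {8, 9}" for i
  proof -
    have Ki: "subgroup (K i) H1" "faithful_on_cosets H1 (K i)" "card (K i) = 4"
      using i K[of i] orders(4,5) by auto
    obtain s :: complex where s: "s = 1 \<or> s = - 1"
      and sum: "\<And>f. (\<Sum>h\<in>K i. f (tr2 h) (det2 h) (quartic_tr h)) =
        f 2 1 2 + f 0 (- 1) 2 + (f (s * (1 + \<i>)) \<i> 0 + f (s * (1 - \<i>)) (- \<i>) 0 :: complex)"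
      by (rule subgroup_order4_invariants[OF Ki]) (rule that)
    \<comment> \<open>The sign for a given i is not known, but both signs lead to the same list of
      degrees.\<close>
    from s show ?thesis
    proof
      assume "s = 1"
      thus ?thesis using sum by (intro centralizer_ring_order4_plus[OF Ki(1,3) j]) simp
    next
      assume "s = - 1"
      thus ?thesis using sum by (intro centralizer_ring_order4_minus[OF Ki(1,3) j]) simp
    qed
  qed
  show ?thesis
    using centralizer_ring_order1[OF K(1) orders(1) j] centralizer_ring_order2[OF K orders(2) j]
      centralizer_ring_order3[OF K(1) orders(3) j] order4
    by blast
qed

end
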